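(* Assume that $\lambda,\mu\in C^N((-\infty,0])$ for some $N$ sufficiently large. Then there are constants $c_2,c_4,c_6,c_8,c_{10},c_{12}\in\mathbb{R}$ and $C_1>0$ such that every wavenumber resonance $\xi_n$ (zero of $F$) with $\operatorname{Re}\xi_n<0$ satisfies $$\left|\xi_n^2\left(\xi_n^{12}-c_2\xi_n^{10}+c_4\xi_n^{8}-c_6\xi_n^{6}+c_8\xi_n^4-c_{10}\xi_n^2+c_{12}\right)\right|\le C_1e^{-8H\operatorname{Re}\xi_n}.$$ As a consequence, for any $A>0$ there are only finitely many resonances in the region $$0>\operatorname{Re}\xi\ge -A-\frac{7}{4H}\log|\operatorname{Im}\xi| .$$
   Context: Setting. Fix $\omega>0$, $H>0$ and real functions $\lambda,\mu$ on $(-\infty,0]$, at least $C^3$, with $\mu\ge\alpha_0>0$, $2\mu+3\lambda\ge\beta_0>0$ for some constants $\alpha_0,\beta_0$, and $\lambda(Z)=\lambda_0$, $\mu(Z)=\mu_0$ (constants) for $Z<-H$ (an inhomogeneous slab of thickness $H$ bonded to a homogeneous half space). Put $\sigma_0=\lambda_0+2\mu_0$. For $\xi\in\mathbb{C}$ the Rayleigh system for $\psi=(\psi_1,\psi_2)^{T}$ on $Z<0$ is $$(P\psi')'+\xi\,(N\psi'-(N^{T}\psi)')+(\omega^2 I-\xi^2M)\psi=0,$$ with $P=\begin{pmatrix}\mu&0\\0&\lambda+2\mu\end{pmatrix}$, $M=\begin{pmatrix}\lambda+2\mu&0\\0&\mu\end{pmatrix}$, $N=\begin{pmatrix}0&-\lambda\\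 \mu&0\end{pmatrix}$, $'=d/dZ$. Riemann surface. $\mathcal{R}$ is the four-fold cover of $\mathbb{C}$ on which $q_P=\sqrt{\omega^2/\sigma_0-\xi^2}$ and $q_S=\sqrt{\omega^2/\mu_0-\xi^2}$ are single-valued; a point of $\mathcal{R}$ is a triple $(\xi,q_P,q_S)$ with $q_P^2=\omega^2/\sigma_0-\xi^2$, $q_S^2=\omega^2/\mu_0-\xi^2$, and is denoted simply by $\xi$. The maps $w_P,w_S,w_{PS}:\mathcal{R}\to\mathcal{R}$ keep the complex number $\xi$ and act by $w_P:(q_P,q_S)\mapsto(-q_P,q_S)$, $w_S:(q_P,q_S)\mapsto(q_P,-q_S)$, $w_{PS}:(q_P,q_S)\mapsto(-q_P,-q_S)$. Jost solutions. $\psi_P^\pm,\psi_S^\pm$ are the solutions of the Rayleigh system which for $Z\le -H$ equal $$\psi_P^\pm=\begin{pmatrix}-\xi\\ \pm i q_P\end{pmatrix}e^{\pm iZq_P},\qquad \psi_S^\pm=\begin{pmatrix}\pm i q_S\\ -\xi\end{pmatrix}e^{\pm iZq_S}.$$ Boundary tractions: $\hat a(\psi)=i\big(\lambda(0^-)\xi\psi_1(0^-)+(\lambda(0^-)+2\mu(0^-))\psi_2'(0^-)\big)$, $\hat b(\psi)=-\xi\mu(0^-)\psi_2(0^-)+\mu(0^-)\psi_1'(0^-)$. The boundary matrix is $\mathcal{B}=\begin{pmatrix}\hat a(\psi_P^-)&\hat a(\psi_S^-)\\ \hat b(\psi_P^-)&\hat b(\psi_S^-)\end{pmatrix}$ and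 the Rayleigh determinant is $\Delta=\det\mathcal{B}$, a function on $\mathcal{R}$. Its zeros on $\mathcal{R}$ are the wavenumber resonances; they are identified with their projections to $\mathbb{C}$, which are the zeros of the entire function $$F(\xi)=\Delta(\xi)\Delta(w_S(\xi))\Delta(w_P(\xi))\Delta(w_{PS}(\xi)),\qquad \xi\in\mathbb{C}.$$ *)

theory Defs
  imports "HOL-Analysis.Analysis"
begin

text \<open>Derivatives are taken within \<open>S\<close>, hence one-sided at an endpoint of an interval.\<close>

definition Ck_on :: "nat \<Rightarrow> real set \<Rightarrow> (real \<Rightarrow> real) \<Rightarrow> bool" where
  "Ck_on k S f \<longleftrightarrow>
     (\<exists>D :: nat \<Rightarrow> real \<Rightarrow> real.
        (\<forall>x\<in>S. D 0 x = f x) \<and>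
        (\<forall>j<k. \<forall>x\<in>S. (D j has_real_derivative D (Suc j) x) (at x within S)) \<and>
        (\<forall>j\<le>k. continuous_on S (D j)))"

definition slab_medium ::
  "real \<Rightarrow> real \<Rightarrow> (real \<Rightarrow> real) \<Rightarrow> (real \<Rightarrow> real) \<Rightarrow> real \<Rightarrow> real \<Rightarrow> bool" where
  "slab_medium \<omega> H lam mu lam0 mu0 \<longleftrightarrow>
     \<omega> > 0 \<and> H > 0 \<and>
     Ck_on 3 {..0} lam \<and> Ck_on 3 {..0} mu \<and>
     (\<exists>\<alpha>0>0. \<forall>Z\<le>0. mu Z \<ge> \<alpha>0) \<and>
     (\<exists>\<beta>0>0. \<forall>Z\<le>0. 2 * mu Z + 3 * lam Z \<ge> \<beta>0) \<and>
     (\<forall>Z < - H. lam Z = lam0 \<and> mu Z = mu0)"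

definition matP :: "(real \<Rightarrow> real) \<Rightarrow> (real \<Rightarrow> real) \<Rightarrow> real \<Rightarrow> complex^2^2" where
  "matP lam mu Z = vector [vector [of_real (mu Z), 0],
                           vector [0, of_real (lam Z + 2 * mu Z)]]"

definition matM :: "(real \<Rightarrow> real) \<Rightarrow> (real \<Rightarrow> real) \<Rightarrow> real \<Rightarrow> complex^2^2" where
  "matM lam mu Z = vector [vector [of_real (lam Z + 2 * mu Z), 0],
                           vector [0, of_real (mu Z)]]"

definition matN :: "(real \<Rightarrow> real) \<Rightarrow> (real \<Rightarrow> real) \<Rightarrow> real \<Rightarrow> complex^2^2" where
  "matN lam mu Z = vector [vector [0, - of_real (lam Z)],
                           vector [of_real (mu Z), 0]]"

abbreviation vderiv :: "(real \<Rightarrow> complex^2) \<Rightarrow> real \<Rightarrow> complex^2" where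
  "vderiv \<psi> Z \<equiv> vector_derivative \<psi> (at Z)"

text \<open>Classical solutions on the open half line; the product \<open>(N\<^sup>T \<psi>)'\<close> is
  differentiable as soon as \<open>\<psi>\<close>, \<open>lam\<close> and \<open>mu\<close> are.\<close>

definition rayleigh_solution ::
  "real \<Rightarrow> (real \<Rightarrow> real) \<Rightarrow> (real \<Rightarrow> real) \<Rightarrow> complex \<Rightarrow> (real \<Rightarrow> complex^2) \<Rightarrow> bool" where
  "rayleigh_solution \<omega> lam mu \<xi> \<psi> \<longleftrightarrow>
     (\<forall>Z<0. \<psi> differentiable at Z \<and>
        (\<lambda>z. matP lam mu z *v vderiv \<psi> z) differentiable at Z \<and>
        vderiv (\<lambda>z. matP lam mu z *v vderiv \<psi> z) Z
        + \<xi> *s (matN lam mu Z *v vderiv \<psi> Z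
                - vderiv (\<lambda>z. transpose (matN lam mu z) *v \<psi> z) Z)
        + (of_real (\<omega>\<^sup>2) *s \<psi> Z - \<xi>\<^sup>2 *s (matM lam mu Z *v \<psi> Z)) = 0)"

type_synonym sheet_point = "complex \<times> complex \<times> complex"

definition rayleigh_surface :: "real \<Rightarrow> real \<Rightarrow> real \<Rightarrow> sheet_point set" where
  "rayleigh_surface \<omega> lam0 mu0 =
     {(\<xi>, qP, qS). qP\<^sup>2 = of_real (\<omega>\<^sup>2 / (lam0 + 2 * mu0)) - \<xi>\<^sup>2 \<and>
                   qS\<^sup>2 = of_real (\<omega>\<^sup>2 / mu0) - \<xi>\<^sup>2}"

fun w_P :: "sheet_point \<Rightarrow> sheet_point" where "w_P (\<xi>, qP, qS) = (\<xi>, - qP, qS)"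
fun w_S :: "sheet_point \<Rightarrow> sheet_point" where "w_S (\<xi>, qP, qS) = (\<xi>, qP, - qS)"
fun w_PS :: "sheet_point \<Rightarrow> sheet_point" where "w_PS (\<xi>, qP, qS) = (\<xi>, - qP, - qS)"

text \<open>The sign of a Jost solution is the argument \<open>s \<in> {1, -1}\<close>.  A Jost solution is unique on
  the open half line \<open>Z < 0\<close>; its values for \<open>Z \<ge> 0\<close> are unspecified and never used.\<close>

fun jost_P :: "real \<Rightarrow> real \<Rightarrow> (real \<Rightarrow> real) \<Rightarrow> (real \<Rightarrow> real) \<Rightarrow> complex \<Rightarrow> sheet_point
    \<Rightarrow> real \<Rightarrow> complex^2" where
  "jost_P \<omega> H lam mu s (\<xi>, qP, qS) =
     (SOME \<psi>. rayleigh_solution \<omega> lam mu \<xi> \<psi> \<and>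
        (\<forall>Z \<le> - H. \<psi> Z = exp (s * \<i> * of_real Z * qP) *s vector [- \<xi>, s * \<i> * qP]))"

fun jost_S :: "real \<Rightarrow> real \<Rightarrow> (real \<Rightarrow> real) \<Rightarrow> (real \<Rightarrow> real) \<Rightarrow> complex \<Rightarrow> sheet_point
    \<Rightarrow> real \<Rightarrow> complex^2" where
  "jost_S \<omega> H lam mu s (\<xi>, qP, qS) =
     (SOME \<psi>. rayleigh_solution \<omega> lam mu \<xi> \<psi> \<and>
        (\<forall>Z \<le> - H. \<psi> Z = exp (s * \<i> * of_real Z * qS) *s vector [s * \<i> * qS, - \<xi>]))"

abbreviation left0 :: "(real \<Rightarrow> 'a::t2_space) \<Rightarrow> 'a" where
  "left0 f \<equiv> Lim (at_left 0) f"

definition traction_a ::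
  "(real \<Rightarrow> real) \<Rightarrow> (real \<Rightarrow> real) \<Rightarrow> complex \<Rightarrow> (real \<Rightarrow> complex^2) \<Rightarrow> complex" where
  "traction_a lam mu \<xi> \<psi> =
     \<i> * (of_real (left0 lam) * \<xi> * left0 (\<lambda>Z. \<psi> Z $ 1)
          + of_real (left0 lam + 2 * left0 mu) * left0 (\<lambda>Z. vderiv \<psi> Z $ 2))"

definition traction_b ::
  "(real \<Rightarrow> real) \<Rightarrow> complex \<Rightarrow> (real \<Rightarrow> complex^2) \<Rightarrow> complex" where
  "traction_b mu \<xi> \<psi> =
     - \<xi> * of_real (left0 mu) * left0 (\<lambda>Z. \<psi> Z $ 2)
     + of_real (left0 mu) * left0 (\<lambda>Z. vderiv \<psi> Z $ 1)"

definition boundary_matrix ::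
  "real \<Rightarrow> real \<Rightarrow> (real \<Rightarrow> real) \<Rightarrow> (real \<Rightarrow> real) \<Rightarrow> sheet_point \<Rightarrow> complex^2^2" where
  "boundary_matrix \<omega> H lam mu p =
     (let \<xi> = fst p; \<psi>P = jost_P \<omega> H lam mu (-1) p; \<psi>S = jost_S \<omega> H lam mu (-1) p in
      vector [vector [traction_a lam mu \<xi> \<psi>P, traction_a lam mu \<xi> \<psi>S],
              vector [traction_b mu \<xi> \<psi>P, traction_b mu \<xi> \<psi>S]])"

definition rayleigh_det ::
  "real \<Rightarrow> real \<Rightarrow> (real \<Rightarrow> real) \<Rightarrow> (real \<Rightarrow> real) \<Rightarrow> sheet_point \<Rightarrow> complex" where
  "rayleigh_det \<omega> H lam mu p = det (boundary_matrix \<omega> H lam mu p)"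

text \<open>The principal roots only select one of the points above \<open>\<xi>\<close>; by \<open>rayleigh_F_eq\<close> every
  other point above \<open>\<xi>\<close> gives the same product.\<close>

definition rayleigh_F ::
  "real \<Rightarrow> real \<Rightarrow> (real \<Rightarrow> real) \<Rightarrow> (real \<Rightarrow> real) \<Rightarrow> real \<Rightarrow> real \<Rightarrow> complex \<Rightarrow> complex" where
  "rayleigh_F \<omega> H lam mu lam0 mu0 \<xi> =
     (let p = (\<xi>, csqrt (of_real (\<omega>\<^sup>2 / (lam0 + 2 * mu0)) - \<xi>\<^sup>2),
                  csqrt (of_real (\<omega>\<^sup>2 / mu0) - \<xi>\<^sup>2));
          \<Delta> = rayleigh_det \<omega> H lam mu
      in \<Delta> p * \<Delta> (w_S p) * \<Delta> (w_P p) * \<Delta> (w_PS p))"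

lemma rayleigh_F_eq:
  assumes "p \<in> rayleigh_surface \<omega> lam0 mu0"
  shows "rayleigh_F \<omega> H lam mu lam0 mu0 (fst p) =
    rayleigh_det \<omega> H lam mu p * rayleigh_det \<omega> H lam mu (w_S p) *
    rayleigh_det \<omega> H lam mu (w_P p) * rayleigh_det \<omega> H lam mu (w_PS p)"
proof -
  obtain \<xi> qP qS where p: "p = (\<xi>, qP, qS)" by (cases p) auto
  define rP where "rP = csqrt (of_real (\<omega>\<^sup>2 / (lam0 + 2 * mu0)) - \<xi>\<^sup>2)"
  define rS where "rS = csqrt (of_real (\<omega>\<^sup>2 / mu0) - \<xi>\<^sup>2)"
  have "rP\<^sup>2 = qP\<^sup>2" "rS\<^sup>2 = qS\<^sup>2"
    using assms unfolding p rP_def rS_def rayleigh_surface_def by auto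
  then have P: "rP = qP \<or> rP = - qP" and S: "rS = qS \<or> rS = - qS"
    by (auto simp: power2_eq_iff)
  have "rayleigh_F \<omega> H lam mu lam0 mu0 \<xi> =
     rayleigh_det \<omega> H lam mu (\<xi>, rP, rS) * rayleigh_det \<omega> H lam mu (\<xi>, rP, - rS) *
     rayleigh_det \<omega> H lam mu (\<xi>, - rP, rS) * rayleigh_det \<omega> H lam mu (\<xi>, - rP, - rS)"
    by (simp add: rayleigh_F_def Let_def rP_def rS_def)
  then show ?thesis
    using P S by (elim disjE) (simp_all add: p mult.commute mult.left_commute)
qed

definition wavenumber_resonances ::
  "real \<Rightarrow> real \<Rightarrow> (real \<Rightarrow> real) \<Rightarrow> (real \<Rightarrow> real) \<Rightarrow> real \<Rightarrow> real \<Rightarrow> complex set" where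
  "wavenumber_resonances \<omega> H lam mu lam0 mu0 = {\<xi>. rayleigh_F \<omega> H lam mu lam0 mu0 \<xi> = 0}"

end

theory Submission
  imports Defs "HOL-Complex_Analysis.Complex_Analysis"
begin

text \<open>Put \<open>w = 1/\<xi>\<close>. In displacement and traction variables the Rayleigh system splits, up to bounded
  coefficients, into two planar blocks with exponents \<open>\<xi>\<close> and \<open>- \<xi>\<close> (the Jordan blocks of static
  elasticity). A Riccati recursion, which uses up the derivatives of the Lame functions, gives a graph
  \<open>y = S x\<close> over the first block that is invariant up to a high power of \<open>w\<close>; as the medium is constant
  below \<open>- H\<close>, all corrections are flat at \<open>- H\<close> and the Jost data lie on this graph up to the same
  order. The Jost solutions are thus \<open>exp (\<xi> H)\<close> times functions of \<open>w\<close> holomorphic near 0, with an error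
  \<open>O(\<bar>w\<bar>\<^sup>1\<^sup>3 exp (2 H \<bar>Re \<xi>\<bar>))\<close>.

  If both exponents have the same sign, the leading term of the determinant is the Wronskian of two
  columns times the entry \<open>S 1 2\<close>, hence bounded below by a power of \<open>w\<close>. If the signs differ, the leading
  term is a holomorphic function \<open>d w\<close>, and only its order of vanishing at 0 matters. On the imaginary axis the energy flux is
  conserved and is positive on the span of the two Jost solutions, while it vanishes at a traction-free
  surface; this bounds \<open>d\<close> from below on a ray, hence near 0. So \<open>F\<close> has no large zero with
  \<open>exp (H \<bar>Re \<xi>\<bar>) \<le> C \<bar>\<xi>\<bar>\<^sup>2\<close>, which gives the bound on the resonances, and the finiteness because \<open>F\<close> is entire.\<close>

section \<open>Differential equations depending holomorphically on a parameter\<close>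

text \<open>Write G = exp (H |Re \<xi>|). A resonance in the left half plane outside the region G
  \<le> |\<xi>|^2 has |\<xi>|^16 \<le> G^8 = exp (- 8 H Re \<xi>), which beats the degree 14 of the
  claim up to a constant; the logarithmic region has G \<le> exp (A H) |Im \<xi>|^(7/4). So one kind
  of zero-free region serves both claims. It contains the imaginary axis, near which neither
  exponential dominates, so the expansion must be uniform in the argument of \<xi>. Hence the
  amplitude on the graph is not estimated but solved for exactly, from an equation holomorphic at w
  = 0. Only the distance to the graph is estimated; the exponential loss of this estimate is paid
  for with powers of w, and G \<le> C |\<xi>|^2 makes finitely many of them enough. The obstacle is
  the case of opposite signs: \<open>d\<close> is built from amplitudes transported across the whole
  slab, so no formula tells whether d 0 vanishes. Being holomorphic, it can be bounded in every
  direction once it is bounded along one.\<close>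

definition jholo :: "real \<Rightarrow> real \<Rightarrow> complex set \<Rightarrow> (real \<Rightarrow> complex \<Rightarrow> complex) \<Rightarrow> bool" where
  "jholo a b W f \<longleftrightarrow> continuous_on ({a..b} \<times> W) (\<lambda>(z, w). f z w) \<and>
     (\<exists>f'. continuous_on ({a..b} \<times> W) (\<lambda>(z, w). f' z w) \<and>
        (\<forall>z\<in>{a..b}. \<forall>w\<in>W. (f z has_field_derivative f' z w) (at w)))"

lemma jholoI:
  assumes "continuous_on ({a..b} \<times> W) (\<lambda>(z, w). f z w)"
    "continuous_on ({a..b} \<times> W) (\<lambda>(z, w). f' z w)"
    "\<And>z w. z \<in> {a..b} \<Longrightarrow> w \<in> W \<Longrightarrow> (f z has_field_derivative f' z w) (at w)"
  shows "jholo a b W f"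
  using assms unfolding jholo_def by blast

lemma jholo_cong:
  assumes "jholo a b W f" "open W" "\<And>z w. z \<in> {a..b} \<Longrightarrow> w \<in> W \<Longrightarrow> f z w = g z w"
  shows "jholo a b W g"
proof -
  obtain f' where f: "continuous_on ({a..b} \<times> W) (\<lambda>(z, w). f z w)"
    "continuous_on ({a..b} \<times> W) (\<lambda>(z, w). f' z w)"
    "\<And>z w. z \<in> {a..b} \<Longrightarrow> w \<in> W \<Longrightarrow> (f z has_field_derivative f' z w) (at w)"
    using assms(1) unfolding jholo_def by blast
  show ?thesis
  proof (rule jholoI[OF _ f(2)])
    show "continuous_on ({a..b} \<times> W) (\<lambda>(z, w). g z w)"
      using f(1) by (rule continuous_on_eq) (auto simp: assms(3))
    show "(g z has_field_derivative f' z w) (at w)" if "z \<in> {a..b}" "w \<in> W" for z w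
      using has_field_derivative_transform_within_open[OF f(3)[OF that] assms(2) that(2)] assms(3) that(1)
      by blast
  qed
qed

lemma jholo_subset:
  assumes "jholo a b W f" "W' \<subseteq> W" "{a'..b'} \<subseteq> {a..b}"
  shows "jholo a' b' W' f"
proof -
  obtain f' where f: "continuous_on ({a..b} \<times> W) (\<lambda>(z, w). f z w)"
    "continuous_on ({a..b} \<times> W) (\<lambda>(z, w). f' z w)"
    "\<And>z w. z \<in> {a..b} \<Longrightarrow> w \<in> W \<Longrightarrow> (f z has_field_derivative f' z w) (at w)"
    using assms(1) unfolding jholo_def by blast
  have "{a'..b'} \<times> W' \<subseteq> {a..b} \<times> W" using assms by blast
  with f assms(2,3) show ?thesis
    by (intro jholoI[where f' = f']) (auto elim: continuous_on_subset)
qed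

lemma jholo_const [simp]: "jholo a b W (\<lambda>z w. c)"
  by (rule jholoI[where f' = "\<lambda>z w. 0"]) auto

lemma jholo_param: "f holomorphic_on W \<Longrightarrow> open W \<Longrightarrow> jholo a b W (\<lambda>z w. f w)"
proof (rule jholoI[where f' = "\<lambda>z w. deriv f w"])
  assume f: "f holomorphic_on W" "open W"
  have "continuous_on ({a..b} \<times> W) (\<lambda>p. f (snd p))" "continuous_on ({a..b} \<times> W) (\<lambda>p. deriv f (snd p))"
    by (rule continuous_on_compose2[OF holomorphic_on_imp_continuous_on[OF f(1)]]
      continuous_on_compose2[OF holomorphic_on_imp_continuous_on[OF holomorphic_deriv[OF f]]],
      auto intro: continuous_intros)+
  then show "continuous_on ({a..b} \<times> W) (\<lambda>(z, w). f w)"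
    "continuous_on ({a..b} \<times> W) (\<lambda>(z, w). deriv f w)" by (simp_all add: case_prod_beta')
qed (auto intro: holomorphic_derivI)

lemma jholo_ident [simp]: "jholo a b W (\<lambda>z w. w)"
  by (rule jholoI[where f' = "\<lambda>z w. 1"]) (auto simp: case_prod_beta' intro!: continuous_intros)

lemma jholo_of_real: "continuous_on {a..b} f \<Longrightarrow> jholo a b W (\<lambda>z w. complex_of_real (f z))"
proof (rule jholoI[where f' = "\<lambda>z w. 0"])
  assume f: "continuous_on {a..b} f"
  have "continuous_on ({a..b} \<times> W) (\<lambda>p. complex_of_real (f (fst p)))"
    by (intro continuous_intros continuous_on_compose2[OF f]) auto
  then show "continuous_on ({a..b} \<times> W) (\<lambda>(z, w). complex_of_real (f z))" by (simp add: case_prod_beta')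
qed auto

lemma jholo_add: "jholo a b W f \<Longrightarrow> jholo a b W g \<Longrightarrow> jholo a b W (\<lambda>z w. f z w + g z w)"
proof -
  assume "jholo a b W f" "jholo a b W g"
  then obtain f' g' where f: "continuous_on ({a..b} \<times> W) (\<lambda>p. f (fst p) (snd p))"
    "continuous_on ({a..b} \<times> W) (\<lambda>p. f' (fst p) (snd p))"
    "\<And>z w. z \<in> {a..b} \<Longrightarrow> w \<in> W \<Longrightarrow> (f z has_field_derivative f' z w) (at w)"
    and g: "continuous_on ({a..b} \<times> W) (\<lambda>p. g (fst p) (snd p))"
    "continuous_on ({a..b} \<times> W) (\<lambda>p. g' (fst p) (snd p))"
    "\<And>z w. z \<in> {a..b} \<Longrightarrow> w \<in> W \<Longrightarrow> (g z has_field_derivative g' z w) (at w)"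
    unfolding jholo_def case_prod_beta' by blast
  show ?thesis
    by (rule jholoI[where f' = "\<lambda>z w. f' z w + g' z w"])
      (auto simp: case_prod_beta' intro!: continuous_on_add f(1,2) g(1,2) DERIV_add f(3) g(3))
qed

lemma jholo_mult: "jholo a b W f \<Longrightarrow> jholo a b W g \<Longrightarrow> jholo a b W (\<lambda>z w. f z w * g z w)"
proof -
  assume "jholo a b W f" "jholo a b W g"
  then obtain f' g' where f: "continuous_on ({a..b} \<times> W) (\<lambda>p. f (fst p) (snd p))"
    "continuous_on ({a..b} \<times> W) (\<lambda>p. f' (fst p) (snd p))"
    "\<And>z w. z \<in> {a..b} \<Longrightarrow> w \<in> W \<Longrightarrow> (f z has_field_derivative f' z w) (at w)"
    and g: "continuous_on ({a..b} \<times> W) (\<lambda>p. g (fst p) (snd p))"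
    "continuous_on ({a..b} \<times> W) (\<lambda>p. g' (fst p) (snd p))"
    "\<And>z w. z \<in> {a..b} \<Longrightarrow> w \<in> W \<Longrightarrow> (g z has_field_derivative g' z w) (at w)"
    unfolding jholo_def case_prod_beta' by blast
  show ?thesis
    by (rule jholoI[where f' = "\<lambda>z w. f' z w * g z w + g' z w * f z w"])
      (auto simp: case_prod_beta' intro!: continuous_intros f(1,2) g(1,2) DERIV_mult f(3) g(3))
qed

lemma jholo_inverse:
  assumes "jholo a b W f" and nz: "\<And>z w. z \<in> {a..b} \<Longrightarrow> w \<in> W \<Longrightarrow> f z w \<noteq> 0"
  shows "jholo a b W (\<lambda>z w. inverse (f z w))"
proof -
  from assms obtain f' where f: "continuous_on ({a..b} \<times> W) (\<lambda>p. f (fst p) (snd p))"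
    "continuous_on ({a..b} \<times> W) (\<lambda>p. f' (fst p) (snd p))"
    "\<And>z w. z \<in> {a..b} \<Longrightarrow> w \<in> W \<Longrightarrow> (f z has_field_derivative f' z w) (at w)"
    unfolding jholo_def case_prod_beta' by blast
  show ?thesis
    by (rule jholoI[where f' = "\<lambda>z w. - (inverse (f z w) * f' z w * inverse (f z w))"])
      (use nz in \<open>auto simp: case_prod_beta' intro!: continuous_intros f(1,2) DERIV_inverse' f(3)\<close>)
qed

lemma jholo_sum: "(\<And>i. i \<in> I \<Longrightarrow> jholo a b W (f i)) \<Longrightarrow> jholo a b W (\<lambda>z w. \<Sum>i\<in>I. f i z w)"
  by (induction I rule: infinite_finite_induct) (auto intro: jholo_add)

lemma jholo_minus: "jholo a b W f \<Longrightarrow> jholo a b W (\<lambda>z w. - f z w)"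
  using jholo_mult[OF jholo_const[of a b W "-1"]] by simp

lemma jholo_diff: "jholo a b W f \<Longrightarrow> jholo a b W g \<Longrightarrow> jholo a b W (\<lambda>z w. f z w - g z w)"
  using jholo_add[OF _ jholo_minus] by fastforce

lemma jholo_power: "jholo a b W f \<Longrightarrow> jholo a b W (\<lambda>z w. f z w ^ n)"
  by (induction n) (auto intro: jholo_mult)

lemma jholo_holomorphic: "jholo a b W f \<Longrightarrow> z \<in> {a..b} \<Longrightarrow> f z holomorphic_on W"
  unfolding jholo_def holomorphic_on_def field_differentiable_def
  by (meson has_field_derivative_at_within)

lemma jholo_continuous_z:
  assumes "jholo a b W f" "w \<in> W" shows "continuous_on {a..b} (\<lambda>z. f z w)"
proof -
  have "continuous_on {a..b} ((\<lambda>(z, w). f z w) \<circ> (\<lambda>z. (z, w)))"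
    using assms unfolding jholo_def
    by (intro continuous_on_compose continuous_intros) (auto elim: continuous_on_subset)
  then show ?thesis by (simp add: o_def)
qed

lemma jholo_bounded:
  assumes "jholo a b W f" "compact K" "K \<subseteq> W"
  shows "\<exists>C>0. \<forall>z\<in>{a..b}. \<forall>w\<in>K. norm (f z w) \<le> C"
proof -
  have "compact ((\<lambda>(z, w). f z w) ` ({a..b} \<times> K))"
    using assms unfolding jholo_def
    by (intro compact_continuous_image compact_Times) (auto elim: continuous_on_subset)
  then obtain C where C: "\<And>x. x \<in> ((\<lambda>(z, w). f z w) ` ({a..b} \<times> K)) \<Longrightarrow> norm x \<le> C"
    using compact_imp_bounded bounded_iff by metis
  have "norm (f z w) \<le> max C 1" if "z \<in> {a..b}" "w \<in> K" for z w
    using C[of "f z w"] that by force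
  then show ?thesis by (intro exI[of _ "max C 1"]) auto
qed

section \<open>Integrals and Picard series with a holomorphic parameter\<close>

lemma continuous_on_indefinite_integral_param:
  fixes f :: "real \<Rightarrow> complex \<Rightarrow> complex"
  assumes f: "continuous_on ({a..b} \<times> W) (\<lambda>(z, w). f z w)"
  shows "continuous_on ({a..b} \<times> W) (\<lambda>(z, w). integral {a..z} (\<lambda>s. f s w))"
proof -
  have cz: "continuous_on {a..b} (\<lambda>z. f z w)" if "w \<in> W" for w
  proof -
    have "continuous_on {a..b} ((\<lambda>(z, w). f z w) \<circ> (\<lambda>z. (z, w)))"
      using that f
      by (intro continuous_on_compose continuous_intros) (auto elim: continuous_on_subset)
    then show ?thesis by (simp add: o_def)
  qed
  \<comment> \<open>Freezing the integrand beyond \<open>z\<close> makes the domain of integration independent of \<open>z\<close>.\<close>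
  have eq: "integral {a..z} (\<lambda>s. f s w) = integral {a..b} (\<lambda>s. f (min s z) w) - of_real (b - z) * f z w"
    if "z \<in> {a..b}" "w \<in> W" for z w
  proof -
    have "continuous_on {a..b} (\<lambda>s. f (min s z) w)"
      using that by (intro continuous_on_compose2[OF cz] continuous_intros) auto
    then have "integral {a..z} (\<lambda>s. f (min s z) w) + integral {z..b} (\<lambda>s. f (min s z) w)
        = integral {a..b} (\<lambda>s. f (min s z) w)"
      using that by (intro Henstock_Kurzweil_Integration.integral_combine integrable_continuous_real) auto
    moreover have "integral {a..z} (\<lambda>s. f (min s z) w) = integral {a..z} (\<lambda>s. f s w)"
      by (intro integral_cong) (auto simp: min_def)
    moreover have "integral {z..b} (\<lambda>s. f (min s z) w) = integral {z..b} (\<lambda>s. f z w)"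
      by (intro integral_cong) (auto simp: min_def)
    moreover have "integral {z..b} (\<lambda>s. f z w) = of_real (b - z) * f z w"
      using that by (simp add: scaleR_conv_of_real)
    ultimately show ?thesis by (metis eq_diff_eq)
  qed
  have "continuous_on ({a..b} \<times> W) (\<lambda>p. integral (cbox a b) (\<lambda>s. f (min s (fst p)) (snd p)))"
  proof (rule integral_continuous_on_param)
    have "continuous_on (({a..b} \<times> W) \<times> cbox a b) ((\<lambda>(z, w). f z w) \<circ> (\<lambda>(p, s). (min s (fst p), snd p)))"
      unfolding case_prod_beta'
      by (intro continuous_on_compose continuous_intros continuous_on_subset[OF f[unfolded case_prod_beta']]) auto
    then show "continuous_on (({a..b} \<times> W) \<times> cbox a b) (\<lambda>(x, t). f (min t (fst x)) (snd x))"
      by (simp add: o_def case_prod_beta')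
  qed
  then have "continuous_on ({a..b} \<times> W)
      (\<lambda>p. integral {a..b} (\<lambda>s. f (min s (fst p)) (snd p)) - of_real (b - fst p) * f (fst p) (snd p))"
    using f by (auto simp: case_prod_beta' intro!: continuous_intros)
  then show ?thesis
    by (rule continuous_on_eq) (auto simp: eq)
qed

text \<open>This is Leibniz' rule. It asks for the w-derivative to be continuous jointly in depth
  and parameter, which is why \<open>jholo\<close> carries a continuous f' and does not merely ask
  every slice to be holomorphic.\<close>

lemma jholo_integral:
  assumes "jholo a b W f" "open W"
  shows "jholo a b W (\<lambda>z w. integral {a..z} (\<lambda>s. f s w))"
proof -
  from assms obtain f' where f: "continuous_on ({a..b} \<times> W) (\<lambda>(z, w). f z w)"
    "continuous_on ({a..b} \<times> W) (\<lambda>(z, w). f' z w)"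
    "\<And>z w. z \<in> {a..b} \<Longrightarrow> w \<in> W \<Longrightarrow> (f z has_field_derivative f' z w) (at w)"
    unfolding jholo_def by blast
  show ?thesis
  proof (rule jholoI[where f' = "\<lambda>z w. integral {a..z} (\<lambda>s. f' s w)"])
    fix z w assume zw: "z \<in> {a..b}" "w \<in> W"
    then obtain r where r: "r > 0" "ball w r \<subseteq> W" using \<open>open W\<close> openE by blast
    have "((\<lambda>w. integral (cbox a z) (\<lambda>s. f s w)) has_field_derivative integral (cbox a z) (\<lambda>s. f' s w))
        (at w within ball w r)"
    proof (rule leibniz_rule_field_derivative[where U = "ball w r"])
      show "((\<lambda>x. f t x) has_field_derivative f' t x) (at x within ball w r)"
        if "x \<in> ball w r" "t \<in> cbox a z" for x t
      proof -
        have "x \<in> W" using that r by blast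
        then show ?thesis using f(3)[of t x] that zw by (auto intro: has_field_derivative_at_within)
      qed
      show "(\<lambda>s. f s x) integrable_on cbox a z" if "x \<in> ball w r" for x
      proof -
        have "continuous_on (cbox a z) (\<lambda>s. f s x)"
          by (rule continuous_on_subset[OF jholo_continuous_z[OF assms(1), of x]]) (use that zw r in auto)
        then show ?thesis by (rule integrable_continuous)
      qed
      show "continuous_on (ball w r \<times> cbox a z) (\<lambda>(x, t). f' t x)"
      proof -
        have "continuous_on (ball w r \<times> cbox a z) ((\<lambda>(z, w). f' z w) \<circ> prod.swap)"
          by (intro continuous_on_compose continuous_on_swap continuous_on_subset[OF f(2)])
            (use zw r in auto)
        then show ?thesis by (simp add: o_def case_prod_beta')
      qed
    qed (use r in auto)
    then show "((\<lambda>w. integral {a..z} (\<lambda>s. f s w)) has_field_derivative integral {a..z} (\<lambda>s. f' s w)) (at w)"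
      using r by (simp add: at_within_open[of w "ball w r"])
  qed (use f in \<open>auto intro: continuous_on_indefinite_integral_param\<close>)
qed

text \<open>These are the terms of the Picard series, not its partial sums: the solution is their
  sum over n.\<close>

primrec picard :: "real \<Rightarrow> ('n::finite \<Rightarrow> 'n \<Rightarrow> real \<Rightarrow> complex \<Rightarrow> complex) \<Rightarrow>
    ('n \<Rightarrow> complex \<Rightarrow> complex) \<Rightarrow> nat \<Rightarrow> 'n \<Rightarrow> real \<Rightarrow> complex \<Rightarrow> complex" where
  "picard a A v 0 = (\<lambda>i z w. v i w)"
| "picard a A v (Suc n) = (\<lambda>i z w. integral {a..z} (\<lambda>s. \<Sum>j\<in>UNIV. A i j s w * picard a A v n j s w))"

lemma jholo_picard:
  assumes "open W" "\<And>i j. jholo a b W (A i j)" "\<And>i. v i holomorphic_on W"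
  shows "jholo a b W (picard a A v n i)"
proof (induction n arbitrary: i)
  case 0 then show ?case using assms(1,3) by (simp add: jholo_param)
next
  case (Suc n)
  show ?case
    by (simp, intro jholo_integral jholo_sum jholo_mult assms Suc.IH)
qed

lemma picard_bound:
  fixes A :: "'n::finite \<Rightarrow> 'n \<Rightarrow> real \<Rightarrow> complex \<Rightarrow> complex"
  assumes W: "open W" and A: "\<And>i j. jholo a b W (A i j)" and v: "\<And>i. v i holomorphic_on W"
    and K: "compact K" "K \<subseteq> W"
  obtains V M where "V > 0" "M > 0"
    "\<And>n i z w. z \<in> {a..b} \<Longrightarrow> w \<in> K \<Longrightarrow> norm (picard a A v n i z w) \<le> V * ((M * (z - a)) ^ n / fact n)"
    "\<And>i j z w. z \<in> {a..b} \<Longrightarrow> w \<in> K \<Longrightarrow> norm (A i j z w) \<le> M"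
proof -
  have "\<forall>i. \<exists>C>0. \<forall>z\<in>{a..b}. \<forall>w\<in>K. norm (v i w) \<le> C"
    using jholo_bounded[OF jholo_param[OF v W] K] by blast
  then obtain Vf where Vf: "\<And>i. Vf i > 0" "\<And>i z w. z \<in> {a..b} \<Longrightarrow> w \<in> K \<Longrightarrow> norm (v i w) \<le> Vf i" by metis
  have "\<forall>p. \<exists>C>0. \<forall>z\<in>{a..b}. \<forall>w\<in>K. norm (A (fst p) (snd p) z w) \<le> C"
    using jholo_bounded[OF A K] by blast
  then obtain Mf where Mf: "\<And>p. Mf p > 0"
    "\<And>p z w. z \<in> {a..b} \<Longrightarrow> w \<in> K \<Longrightarrow> norm (A (fst p) (snd p) z w) \<le> Mf p" by metis
  define V where "V = (\<Sum>i\<in>UNIV. Vf i)"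
  define m where "m = (\<Sum>p\<in>UNIV. Mf p)"
  \<comment> \<open>The factor \<open>CARD('n)\<close> absorbs the sum over j in one Picard step;
    since it is at least 1, M still bounds every single entry.\<close>
  define M where "M = of_nat CARD('n) * m"
  have Vi: "Vf i \<le> V" for i unfolding V_def by (rule member_le_sum) (auto simp: Vf(1) less_imp_le)
  have mi: "Mf p \<le> m" for p unfolding m_def by (rule member_le_sum) (auto simp: Mf(1) less_imp_le)
  have pos: "V > 0" "m > 0" "M > 0"
    unfolding M_def
  proof -
    show "V > 0" using Vi[of undefined] Vf(1)[of undefined] by linarith
    show "m > 0" using mi[of undefined] Mf(1)[of undefined] by linarith
    then show "of_nat CARD('n) * m > 0" by (simp add: zero_less_card_finite)
  qed
  have Am: "norm (A i j z w) \<le> m" if "z \<in> {a..b}" "w \<in> K" for i j z w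
    using Mf(2)[OF that, of "(i, j)"] mi[of "(i, j)"] by simp
  have "m \<le> M"
  proof -
    have "1 \<le> real CARD('n)" using zero_less_card_finite[where 'a='n] by linarith
    from mult_right_mono[OF this, of m] pos(2) show ?thesis by (simp add: M_def)
  qed
  have bnd: "norm (picard a A v n i z w) \<le> V * ((M * (z - a)) ^ n / fact n)"
    if "z \<in> {a..b}" "w \<in> K" for n i z w
    using that(1)
  proof (induction n arbitrary: i z)
    case 0 then show ?case using Vf(2)[OF 0 that(2), of i] Vi[of i] by simp
  next
    case (Suc n)
    have w: "w \<in> W" using that K by blast
    have J: "jholo a b W (\<lambda>s w. \<Sum>j\<in>UNIV. A i j s w * picard a A v n j s w)"
      by (intro jholo_sum jholo_mult A jholo_picard[OF W A v])
    have int: "((\<lambda>s. V * M * ((M * (s - a)) ^ n / fact n)) has_integral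
        V * ((M * (z - a)) ^ Suc n / fact (Suc n)) - V * ((M * (a - a)) ^ Suc n / fact (Suc n))) {a..z}"
    proof (rule fundamental_theorem_of_calculus)
      show "((\<lambda>s. V * ((M * (s - a)) ^ Suc n / fact (Suc n))) has_vector_derivative
          V * M * ((M * (x - a)) ^ n / fact n)) (at x within {a..z})" for x
        unfolding has_real_derivative_iff_has_vector_derivative[symmetric]
        by (rule derivative_eq_intros refl | simp)+
    qed (use Suc.prems in auto)
    have "norm (integral {a..z} (\<lambda>s. \<Sum>j\<in>UNIV. A i j s w * picard a A v n j s w))
        \<le> integral {a..z} (\<lambda>s. V * M * ((M * (s - a)) ^ n / fact n))"
    proof (rule integral_norm_bound_integral)
      show "(\<lambda>s. \<Sum>j\<in>UNIV. A i j s w * picard a A v n j s w) integrable_on {a..z}"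
        by (rule integrable_continuous_real, rule continuous_on_subset[OF jholo_continuous_z[OF J w]])
          (use Suc.prems in auto)
      show "(\<lambda>s. V * M * ((M * (s - a)) ^ n / fact n)) integrable_on {a..z}" using int by blast
      fix s assume s: "s \<in> {a..z}"
      then have s': "s \<in> {a..b}" using Suc.prems by auto
      have "norm (\<Sum>j\<in>UNIV. A i j s w * picard a A v n j s w)
          \<le> (\<Sum>j\<in>(UNIV::'n set). m * (V * ((M * (s - a)) ^ n / fact n)))"
      proof (rule sum_norm_le)
        show "norm (A i j s w * picard a A v n j s w) \<le> m * (V * ((M * (s - a)) ^ n / fact n))" for j
          unfolding norm_mult
          by (rule mult_mono[OF Am[OF s' that(2)] Suc.IH[OF s']]) (use pos in auto)
      qed
      then show "norm (\<Sum>j\<in>UNIV. A i j s w * picard a A v n j s w) \<le> V * M * ((M * (s - a)) ^ n / fact n)"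
        by (simp add: M_def mult_ac)
    qed
    also have "\<dots> = V * ((M * (z - a)) ^ Suc n / fact (Suc n))"
      unfolding integral_unique[OF int] by simp
    finally show ?case by simp
  qed
  have "norm (A i j z w) \<le> M" if "z \<in> {a..b}" "w \<in> K" for i j z w
    using Am[OF that, of i j] \<open>m \<le> M\<close> by linarith
  from that[OF pos(1,3) bnd this] show thesis by blast
qed

text \<open>On {a..b} times a compact set of parameters the factorial bound makes the Picard series
  converge uniformly. A locally uniform limit of holomorphic functions is holomorphic, and uniform
  convergence in depth lets the integral equation pass to the limit.\<close>

lemma linear_ode_holomorphic:
  fixes A :: "'n::finite \<Rightarrow> 'n \<Rightarrow> real \<Rightarrow> complex \<Rightarrow> complex"
  assumes ab: "a \<le> b" and W: "open W" and A: "\<And>i j. jholo a b W (A i j)"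
    and v: "\<And>i. v i holomorphic_on W"
  obtains Y where "\<And>i w. w \<in> W \<Longrightarrow> Y i a w = v i w"
    "\<And>i z w. z \<in> {a..b} \<Longrightarrow> w \<in> W \<Longrightarrow>
       ((\<lambda>z. Y i z w) has_vector_derivative (\<Sum>j\<in>UNIV. A i j z w * Y j z w)) (at z within {a..b})"
    "\<And>i z. z \<in> {a..b} \<Longrightarrow> Y i z holomorphic_on W"
proof -
  define y where "y = picard a A v"
  have jy: "jholo a b W (y n i)" for n i unfolding y_def by (rule jholo_picard[OF W A v])
  define Y where "Y i z w = (\<Sum>n. y n i z w)" for i z w
  have unif: "uniform_limit ({a..b} \<times> K) (\<lambda>N p. \<Sum>n<N. y n i (fst p) (snd p)) (\<lambda>p. Y i (fst p) (snd p)) sequentially"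
    and unifA: "uniform_limit ({a..b} \<times> K) (\<lambda>N p. \<Sum>n<N. \<Sum>j\<in>UNIV. A i j (fst p) (snd p) * y n j (fst p) (snd p))
        (\<lambda>p. \<Sum>j\<in>UNIV. A i j (fst p) (snd p) * Y j (fst p) (snd p)) sequentially"
    and summ: "\<And>z w. z \<in> {a..b} \<Longrightarrow> w \<in> K \<Longrightarrow> summable (\<lambda>n. y n i z w)"
    if K: "compact K" "K \<subseteq> W" for K i
  proof -
    obtain V M where VM: "V > 0" "M > 0"
      "\<And>n i z w. z \<in> {a..b} \<Longrightarrow> w \<in> K \<Longrightarrow> norm (y n i z w) \<le> V * ((M * (z - a)) ^ n / fact n)"
      "\<And>i j z w. z \<in> {a..b} \<Longrightarrow> w \<in> K \<Longrightarrow> norm (A i j z w) \<le> M"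
    proof (rule picard_bound[where A = A and v = v, OF W A v K, folded y_def], goal_cases)
      case (1 V M)
      show ?case by (rule 1(1)[OF 1(2-5)])
    qed
    have b1: "norm (y n i z w) \<le> V * ((M * (b - a)) ^ n / fact n)" if "z \<in> {a..b}" "w \<in> K" for n i z w
    proof -
      have "V * ((M * (z - a)) ^ n / fact n) \<le> V * ((M * (b - a)) ^ n / fact n)"
        using VM that by (intro mult_left_mono divide_right_mono power_mono mult_left_mono) auto
      with VM(3)[OF that, of n i] show ?thesis by linarith
    qed
    have sm: "summable (\<lambda>n. V * ((M * (b - a)) ^ n / fact n))"
      using summable_exp[of "M * (b - a)"] by (intro summable_mult) (simp add: divide_inverse mult.commute)
    show "uniform_limit ({a..b} \<times> K) (\<lambda>N p. \<Sum>n<N. y n i (fst p) (snd p)) (\<lambda>p. Y i (fst p) (snd p)) sequentially"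
      unfolding Y_def by (rule Weierstrass_m_test[OF _ sm], rule b1) auto
    show s: "summable (\<lambda>n. y n i z w)" if "z \<in> {a..b}" "w \<in> K" for z w i
      by (rule summable_comparison_test'[OF sm, of 0], rule b1[OF that])
    have "uniform_limit ({a..b} \<times> K) (\<lambda>N p. \<Sum>n<N. \<Sum>j\<in>UNIV. A i j (fst p) (snd p) * y n j (fst p) (snd p))
        (\<lambda>p. \<Sum>n. \<Sum>j\<in>UNIV. A i j (fst p) (snd p) * y n j (fst p) (snd p)) sequentially"
    proof (rule Weierstrass_m_test)
      show "summable (\<lambda>n. \<Sum>j\<in>(UNIV::'n set). M * (V * ((M * (b - a)) ^ n / fact n)))"
        by (intro summable_sum summable_mult sm)
      show "norm (\<Sum>j\<in>UNIV. A i j (fst p) (snd p) * y n j (fst p) (snd p))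
          \<le> (\<Sum>j\<in>(UNIV::'n set). M * (V * ((M * (b - a)) ^ n / fact n)))" if "p \<in> {a..b} \<times> K" for n p
      proof (rule sum_norm_le)
        have p: "fst p \<in> {a..b}" "snd p \<in> K" using that by auto
        show "norm (A i j (fst p) (snd p) * y n j (fst p) (snd p)) \<le> M * (V * ((M * (b - a)) ^ n / fact n))" for j
          unfolding norm_mult
          by (rule mult_mono[OF VM(4)[OF p] b1[OF p]]) (use VM(2) in auto)
      qed
    qed
    moreover have "(\<Sum>n. \<Sum>j\<in>UNIV. A i j (fst p) (snd p) * y n j (fst p) (snd p))
          = (\<Sum>j\<in>UNIV. A i j (fst p) (snd p) * Y j (fst p) (snd p))" if "p \<in> {a..b} \<times> K" for p
    proof -
      have p: "fst p \<in> {a..b}" "snd p \<in> K" using that by auto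
      have "summable (\<lambda>n. A i j (fst p) (snd p) * y n j (fst p) (snd p))" for j
        by (rule summable_mult[OF s[OF p]])
      then have "(\<Sum>n. \<Sum>j\<in>UNIV. A i j (fst p) (snd p) * y n j (fst p) (snd p))
          = (\<Sum>j\<in>UNIV. \<Sum>n. A i j (fst p) (snd p) * y n j (fst p) (snd p))"
        by (intro suminf_sum)
      also have "\<dots> = (\<Sum>j\<in>UNIV. A i j (fst p) (snd p) * Y j (fst p) (snd p))"
        unfolding Y_def by (intro sum.cong refl suminf_mult s[OF p])
      finally show ?thesis .
    qed
    ultimately show "uniform_limit ({a..b} \<times> K) (\<lambda>N p. \<Sum>n<N. \<Sum>j\<in>UNIV. A i j (fst p) (snd p) * y n j (fst p) (snd p))
        (\<lambda>p. \<Sum>j\<in>UNIV. A i j (fst p) (snd p) * Y j (fst p) (snd p)) sequentially"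
      by (simp add: uniform_limit_iff)
  qed
  have Yint: "Y i z w = v i w + integral {a..z} (\<lambda>s. \<Sum>j\<in>UNIV. A i j s w * Y j s w)"
    and Ycont: "continuous_on {a..b} (\<lambda>z. Y i z w)"
    if z: "z \<in> {a..b}" and w: "w \<in> W" for i z w
  proof -
    have K: "compact {w}" "{w} \<subseteq> W" using w by auto
    have slice: "uniform_limit {a..z} (\<lambda>N s. f N (s, w)) (\<lambda>s. g (s, w)) sequentially"
      if "uniform_limit ({a..b} \<times> {w}) f g sequentially" "z \<le> b" for f z and g :: "real \<times> complex \<Rightarrow> complex"
    proof (rule uniform_limitI)
      fix e :: real assume "e > 0"
      from uniform_limitD[OF that(1) this]
      show "\<forall>\<^sub>F N in sequentially. \<forall>s\<in>{a..z}. dist (f N (s, w)) (g (s, w)) < e"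
        by (rule eventually_mono) (use that(2) in auto)
    qed
    have c1: "continuous_on {a..z} (\<lambda>s. \<Sum>n<N. \<Sum>j\<in>UNIV. A i j s w * y n j s w)" for N
      by (intro continuous_intros continuous_on_subset[OF jholo_continuous_z[OF A w]]
          continuous_on_subset[OF jholo_continuous_z[OF jy w]]) (use z in auto)
    from slice[OF unifA[OF K, of i]] z
    have "uniform_limit {a..z} (\<lambda>N s. \<Sum>n<N. \<Sum>j\<in>UNIV. A i j s w * y n j s w)
        (\<lambda>s. \<Sum>j\<in>UNIV. A i j s w * Y j s w) sequentially" by simp
    then obtain I J where IJ: "\<And>N. ((\<lambda>s. \<Sum>n<N. \<Sum>j\<in>UNIV. A i j s w * y n j s w) has_integral I N) {a..z}"
      "((\<lambda>s. \<Sum>j\<in>UNIV. A i j s w * Y j s w) has_integral J) {a..z}" "I \<longlonglongrightarrow> J"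
      by (rule uniform_limit_integral[OF _ c1]) auto
    \<comment> \<open>Integration shifts the index of the series by one, so the limit is Y without
      its term y 0, the initial value.\<close>
    have "I = (\<lambda>N. \<Sum>n<N. y (Suc n) i z w)"
    proof
      fix N
      have "integral {a..z} (\<lambda>s. \<Sum>n<N. \<Sum>j\<in>UNIV. A i j s w * y n j s w)
          = (\<Sum>n<N. integral {a..z} (\<lambda>s. \<Sum>j\<in>UNIV. A i j s w * y n j s w))"
        by (rule integral_sum, simp, intro integrable_continuous_real continuous_intros
            continuous_on_subset[OF jholo_continuous_z[OF A w]]
            continuous_on_subset[OF jholo_continuous_z[OF jy w]]) (use z in auto)
      then show "I N = (\<Sum>n<N. y (Suc n) i z w)" using IJ(1)[of N] by (simp add: y_def integral_unique)
    qed
    moreover have "(\<lambda>n. y n i z w) sums Y i z w"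
      unfolding Y_def using summ[OF K z] by (intro summable_sums) auto
    then have "(\<lambda>n. y (Suc n) i z w) sums (Y i z w - y 0 i z w)"
      by (subst sums_Suc_iff) (simp del: picard.simps)
    ultimately have "I \<longlonglongrightarrow> Y i z w - y 0 i z w" by (simp add: sums_def)
    then have "Y i z w - y 0 i z w = J" using IJ(3) LIMSEQ_unique by blast
    then show "Y i z w = v i w + integral {a..z} (\<lambda>s. \<Sum>j\<in>UNIV. A i j s w * Y j s w)"
      using IJ(2) by (simp add: integral_unique y_def algebra_simps)
    have "uniform_limit {a..b} (\<lambda>N s. \<Sum>n<N. y n i s w) (\<lambda>s. Y i s w) sequentially"
      using slice[OF unif[OF K, of i], of b] by simp
    then show "continuous_on {a..b} (\<lambda>z. Y i z w)"
      by (rule uniform_limit_theorem[rotated]) (auto intro!: always_eventually continuous_intros jholo_continuous_z[OF jy w])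
  qed
  show thesis
  proof
    show "Y i a w = v i w" if "w \<in> W" for i w using Yint[of a w i] ab that by simp
    show "((\<lambda>z. Y i z w) has_vector_derivative (\<Sum>j\<in>UNIV. A i j z w * Y j z w)) (at z within {a..b})"
      if z: "z \<in> {a..b}" and w: "w \<in> W" for i z w
    proof -
      have "continuous_on {a..b} (\<lambda>s. \<Sum>j\<in>UNIV. A i j s w * Y j s w)"
        by (intro continuous_intros jholo_continuous_z[OF A w] Ycont[OF z w])
      from has_vector_derivative_add[OF has_vector_derivative_const[of "v i w"] integral_has_vector_derivative[OF this z]]
      have "((\<lambda>u. v i w + integral {a..u} (\<lambda>s. \<Sum>j\<in>UNIV. A i j s w * Y j s w)) has_vector_derivative
          (\<Sum>j\<in>UNIV. A i j z w * Y j z w)) (at z within {a..b})" by simp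
      then show ?thesis
        by (rule has_vector_derivative_transform[OF z, rotated]) (use Yint w in auto)
    qed
    show "Y i z holomorphic_on W" if z: "z \<in> {a..b}" for i z
    proof (rule holomorphic_uniform_sequence[OF W])
      show "(\<lambda>w. \<Sum>n<N. y n i z w) holomorphic_on W" for N
        by (intro holomorphic_intros jholo_holomorphic[OF jy z])
      show "\<exists>d>0. cball x d \<subseteq> W \<and> uniform_limit (cball x d) (\<lambda>N w. \<Sum>n<N. y n i z w) (Y i z) sequentially"
        if x: "x \<in> W" for x
      proof -
        obtain d where d: "d > 0" "cball x d \<subseteq> W" using W x open_contains_cball by blast
        have "uniform_limit (cball x d) (\<lambda>N w. \<Sum>n<N. y n i z w) (Y i z) sequentially"
        proof (rule uniform_limitI)
          fix e :: real assume "e > 0"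
          from uniform_limitD[OF unif[OF compact_cball d(2), of i] this]
          show "\<forall>\<^sub>F N in sequentially. \<forall>w\<in>cball x d. dist (\<Sum>n<N. y n i z w) (Y i z w) < e"
            by (rule eventually_mono) (use z in \<open>force simp del: mem_cball\<close>)
        qed
        with d show ?thesis by blast
      qed
    qed
  qed
qed

text \<open>The quantity (|e|^2 + r^2) exp (- (2 C + 1) (z - a)) does not increase. The forcing
  enters through 2 r |e| \<le> |e|^2 + r^2, which costs the 1 in 2 C + 1 and avoids dividing by |e|
  where e vanishes. The hypothesis concerns the inner product of e and e', not the norm of e', so
  that a skew part of the system such as i Im \<xi> does not contribute to the growth.\<close>

lemma gronwall_norm:
  fixes e :: "real \<Rightarrow> 'a::real_inner"
  assumes ab: "a \<le> b"
    and e: "\<And>z. z \<in> {a..b} \<Longrightarrow> (e has_vector_derivative e' z) (at z within {a..b})"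
    and bound: "\<And>z. z \<in> {a..b} \<Longrightarrow> e z \<bullet> e' z \<le> C * (norm (e z))\<^sup>2 + r * norm (e z)"
    and C: "0 \<le> C" and r: "0 \<le> r"
  shows "norm (e b) \<le> (norm (e a) + r) * exp ((C + 1/2) * (b - a))"
proof -
  define g where "g z = (e z \<bullet> e z + r\<^sup>2) * exp (- (2 * C + 1) * (z - a))" for z
  have dn: "((\<lambda>z. e z \<bullet> e z) has_vector_derivative 2 * (e z \<bullet> e' z)) (at z within {a..b})" if "z \<in> {a..b}" for z
    using bounded_bilinear.has_vector_derivative[OF bounded_bilinear_inner e[OF that] e[OF that]]
    by (simp add: inner_commute)
  have dg: "(g has_real_derivative (2 * (e z \<bullet> e' z) - (2 * C + 1) * (e z \<bullet> e z + r\<^sup>2)) * exp (- (2 * C + 1) * (z - a)))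
      (at z within {a..b})" if "z \<in> {a..b}" for z
    unfolding g_def
    by (rule derivative_eq_intros refl dn[OF that, folded has_real_derivative_iff_has_vector_derivative] | simp)+
      (simp add: algebra_simps)
  have le0: "2 * (e z \<bullet> e' z) - (2 * C + 1) * (e z \<bullet> e z + r\<^sup>2) \<le> 0" if "z \<in> {a..b}" for z
  proof -
    have "2 * (r * norm (e z)) \<le> (norm (e z))\<^sup>2 + r\<^sup>2"
      using sum_squares_bound[of r "norm (e z)"] by (simp add: algebra_simps)
    moreover have "0 \<le> C * r\<^sup>2" using C by simp
    ultimately show ?thesis
      using bound[OF that] by (simp add: power2_norm_eq_inner algebra_simps)
  qed
  have "g b \<le> g a"
  proof (rule DERIV_nonpos_imp_decreasing_open[OF ab])
    show "\<exists>y. (g has_real_derivative y) (at x) \<and> y \<le> 0" if "a < x" "x < b" for x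
    proof (intro exI conjI)
      show "(g has_real_derivative (2 * (e x \<bullet> e' x) - (2 * C + 1) * (e x \<bullet> e x + r\<^sup>2)) * exp (- (2 * C + 1) * (x - a))) (at x)"
        using dg[of x] that at_within_Icc_at[of a x b] by auto
      show "(2 * (e x \<bullet> e' x) - (2 * C + 1) * (e x \<bullet> e x + r\<^sup>2)) * exp (- (2 * C + 1) * (x - a)) \<le> 0"
        using le0[of x] that by (intro mult_nonpos_nonneg) auto
    qed
    show "continuous_on {a..b} g"
      unfolding continuous_on_eq_continuous_within
      by (intro ballI DERIV_continuous[OF dg])
  qed
  then have "((norm (e b))\<^sup>2 + r\<^sup>2) * exp (- (2 * C + 1) * (b - a)) \<le> (norm (e a))\<^sup>2 + r\<^sup>2"
    by (simp add: g_def power2_norm_eq_inner)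
  then have "((norm (e b))\<^sup>2 + r\<^sup>2) * exp (- (2 * C + 1) * (b - a)) * exp ((2 * C + 1) * (b - a))
      \<le> ((norm (e a))\<^sup>2 + r\<^sup>2) * exp ((2 * C + 1) * (b - a))"
    by (rule mult_right_mono) simp
  then have "((norm (e b))\<^sup>2 + r\<^sup>2) \<le> ((norm (e a))\<^sup>2 + r\<^sup>2) * exp ((2 * C + 1) * (b - a))"
    unfolding mult.assoc exp_add[symmetric] by (simp add: algebra_simps)
  moreover have "(norm (e a))\<^sup>2 + r\<^sup>2 \<le> (norm (e a) + r)\<^sup>2"
    using r by (simp add: power2_sum)
  moreover have "exp ((2 * C + 1) * (b - a)) = (exp ((C + 1/2) * (b - a)))\<^sup>2"
    by (simp add: power2_eq_square exp_add[symmetric] algebra_simps)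
  ultimately have "(norm (e b))\<^sup>2 + r\<^sup>2 \<le> (norm (e a) + r)\<^sup>2 * (exp ((C + 1/2) * (b - a)))\<^sup>2"
  proof -
    assume a: "(norm (e b))\<^sup>2 + r\<^sup>2 \<le> ((norm (e a))\<^sup>2 + r\<^sup>2) * exp ((2 * C + 1) * (b - a))"
      "(norm (e a))\<^sup>2 + r\<^sup>2 \<le> (norm (e a) + r)\<^sup>2"
      "exp ((2 * C + 1) * (b - a)) = (exp ((C + 1/2) * (b - a)))\<^sup>2"
    show ?thesis
      by (rule order_trans[OF a(1)[unfolded a(3)] mult_right_mono[OF a(2)]]) simp
  qed
  then have "(norm (e b))\<^sup>2 \<le> ((norm (e a) + r) * exp ((C + 1/2) * (b - a)))\<^sup>2"
    unfolding power_mult_distrib using zero_le_power2[of r] by linarith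
  then show ?thesis
    by (rule power2_le_imp_le) (use r in auto)
qed

lemma has_vector_derivative_vec_lambda:
  fixes f :: "'n::finite \<Rightarrow> real \<Rightarrow> complex"
  assumes "\<And>i. (f i has_vector_derivative f' i) (at x within S)"
  shows "((\<lambda>x. \<chi> i. f i x) has_vector_derivative (\<chi> i. f' i)) (at x within S)"
proof -
  have eq: "(\<chi> i. g i) = (\<Sum>i\<in>UNIV. axis i (g i))" for g :: "'n \<Rightarrow> complex"
    by (simp add: vec_eq_iff axis_def)
  have bl: "bounded_linear (axis i :: complex \<Rightarrow> complex ^ 'n)" for i
    unfolding linear_conv_bounded_linear[symmetric]
    by (rule linearI) (simp_all add: vec_eq_iff axis_def)
  show ?thesis
    unfolding eq by (intro has_vector_derivative_sum bounded_linear.has_vector_derivative[OF bl] assms)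
qed

lemma linear_ode_bound:
  fixes y :: "'n::finite \<Rightarrow> real \<Rightarrow> complex"
  assumes y: "\<And>i z. z \<in> {a..b} \<Longrightarrow> (y i has_vector_derivative (\<Sum>j\<in>UNIV. A i j z * y j z)) (at z within {a..b})"
    and A: "\<And>i j z. z \<in> {a..b} \<Longrightarrow> norm (A i j z) \<le> M" and z: "z \<in> {a..b}"
  shows "norm (y i z) \<le> (\<Sum>j\<in>UNIV. norm (y j a)) * exp ((real CARD('n) * (real CARD('n) * M) + 1/2) * (z - a))"
proof -
  have az: "a \<le> z" using z by auto
  have M: "0 \<le> M" by (rule order_trans[OF norm_ge_zero A[OF z, of undefined undefined]])
  define e where "e z = (\<chi> i. y i z)" for z
  define e' where "e' z = (\<chi> i. \<Sum>j\<in>UNIV. A i j z * y j z)" for z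
  have de: "(e has_vector_derivative e' x) (at x within {a..z})" if "x \<in> {a..z}" for x
    unfolding e_def e'_def
  proof (rule has_vector_derivative_vec_lambda)
    show "(y i has_vector_derivative (\<Sum>j\<in>UNIV. A i j x * y j x)) (at x within {a..z})" for i
      by (rule has_vector_derivative_within_subset[OF y]) (use that z in auto)
  qed
  have bnd: "norm (e z) \<le> (norm (e a) + 0) * exp ((real CARD('n) * (real CARD('n) * M) + 1/2) * (z - a))"
  proof (rule gronwall_norm[OF az de])
    fix x assume x: "x \<in> {a..z}"
    then have xb: "x \<in> {a..b}" using z by auto
    have "norm (e' x $ i) \<le> real CARD('n) * (M * norm (e x))" for i
    proof -
      have "norm (A i j x * y j x) \<le> M * norm (e x)" for j
        using A[OF xb, of i j] Finite_Cartesian_Product.norm_nth_le[of "e x" j] M unfolding norm_mult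
        by (intro mult_mono) (auto simp: e_def)
      then have "norm (\<Sum>j\<in>UNIV. A i j x * y j x) \<le> (\<Sum>j\<in>(UNIV::'n set). M * norm (e x))"
        by (intro sum_norm_le) auto
      then show ?thesis by (simp add: e'_def)
    qed
    then have "(\<Sum>i\<in>UNIV. norm (e' x $ i)) \<le> (\<Sum>i\<in>(UNIV::'n set). real CARD('n) * (M * norm (e x)))"
      by (intro sum_mono)
    then have ne: "norm (e' x) \<le> real CARD('n) * (real CARD('n) * M) * norm (e x)"
      using L2_set_le_sum[of UNIV "\<lambda>i. norm (e' x $ i)"] by (simp add: norm_vec_def)
    have "e x \<bullet> e' x \<le> norm (e x) * norm (e' x)" by (rule norm_cauchy_schwarz)
    also have "\<dots> \<le> norm (e x) * (real CARD('n) * (real CARD('n) * M) * norm (e x))"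
      by (intro mult_left_mono ne) auto
    finally show "e x \<bullet> e' x \<le> real CARD('n) * (real CARD('n) * M) * (norm (e x))\<^sup>2 + 0 * norm (e x)"
      by (simp add: power2_eq_square mult_ac)
  qed (use M in auto)
  have comp: "norm (y i z) \<le> norm (e z)" using Finite_Cartesian_Product.norm_nth_le[of "e z" i] by (simp add: e_def)
  have "norm (e a) \<le> (\<Sum>j\<in>UNIV. norm (y j a))"
    using L2_set_le_sum[of UNIV "\<lambda>i. norm (e a $ i)"] by (simp add: norm_vec_def e_def)
  then have "norm (e a) * exp ((real CARD('n) * (real CARD('n) * M) + 1/2) * (z - a))
      \<le> (\<Sum>j\<in>UNIV. norm (y j a)) * exp ((real CARD('n) * (real CARD('n) * M) + 1/2) * (z - a))"
    by (rule mult_right_mono) simp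
  from order_trans[OF comp order_trans[OF bnd[unfolded add_0_right] this]] show ?thesis .
qed

lemma linear_ode_unique:
  fixes x y :: "'n::finite \<Rightarrow> real \<Rightarrow> complex"
  assumes x: "\<And>i z. z \<in> {a..b} \<Longrightarrow> (x i has_vector_derivative (\<Sum>j\<in>UNIV. A i j z * x j z)) (at z within {a..b})"
    and y: "\<And>i z. z \<in> {a..b} \<Longrightarrow> (y i has_vector_derivative (\<Sum>j\<in>UNIV. A i j z * y j z)) (at z within {a..b})"
    and A: "\<And>i j z. z \<in> {a..b} \<Longrightarrow> norm (A i j z) \<le> M" and z: "z \<in> {a..b}"
    and init: "\<And>i. x i a = y i a"
  shows "x i z = y i z"
proof -
  have "norm (x i z - y i z) \<le> (\<Sum>j\<in>(UNIV::'n set). norm (x j a - y j a)) * exp ((real CARD('n) * (real CARD('n) * M) + 1/2) * (z - a))"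
  proof (rule linear_ode_bound[where y = "\<lambda>i z. x i z - y i z", OF _ A z])
    fix i z assume "z \<in> {a..b}"
    from has_vector_derivative_diff[OF x[OF this] y[OF this]]
    show "((\<lambda>z. x i z - y i z) has_vector_derivative (\<Sum>j\<in>UNIV. A i j z * (x j z - y j z))) (at z within {a..b})"
      by (simp add: right_diff_distrib sum_subtractf)
  qed auto
  then show ?thesis by (simp add: init)
qed

section \<open>Approximately invariant graphs\<close>

text \<open>Flatness means that the z-derivatives of orders 1 to k vanish at the lower end a; the
  value at a is free. The recursive form makes one differentiation lower k by one, which is the
  bookkeeping that the Riccati recursion needs.\<close>

primrec flat_symbol :: "real \<Rightarrow> real \<Rightarrow> nat \<Rightarrow> (real \<Rightarrow> complex \<Rightarrow> complex) \<Rightarrow> bool" where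
  "flat_symbol a b 0 f = jholo a b UNIV f"
| "flat_symbol a b (Suc k) f = (jholo a b UNIV f \<and>
     (\<exists>f'. flat_symbol a b k f' \<and> (\<forall>w. f' a w = 0) \<and>
       (\<forall>z\<in>{a..b}. \<forall>w. ((\<lambda>z. f z w) has_vector_derivative f' z w) (at z within {a..b}))))"

lemma flat_symbol_jholo: "flat_symbol a b k f \<Longrightarrow> jholo a b UNIV f"
  by (cases k) auto

lemma flat_symbol_SucI:
  assumes "jholo a b UNIV f" "flat_symbol a b k f'" "\<And>w. f' a w = 0"
    "\<And>z w. z \<in> {a..b} \<Longrightarrow> ((\<lambda>z. f z w) has_vector_derivative f' z w) (at z within {a..b})"
  shows "flat_symbol a b (Suc k) f"
  using assms by auto

lemma flat_symbol_SucE: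
  assumes "flat_symbol a b (Suc k) f"
  obtains f' where "jholo a b UNIV f" "flat_symbol a b k f'" "\<And>w. f' a w = 0"
    "\<And>z w. z \<in> {a..b} \<Longrightarrow> ((\<lambda>z. f z w) has_vector_derivative f' z w) (at z within {a..b})"
  using assms by auto

lemma flat_symbol_Suc: "flat_symbol a b (Suc k) f \<Longrightarrow> flat_symbol a b k f"
proof (induction k arbitrary: f)
  case 0 then show ?case by auto
next
  case (Suc k)
  from Suc.prems obtain f' where "jholo a b UNIV f" "flat_symbol a b (Suc k) f'" "\<And>w. f' a w = 0"
    "\<And>z w. z \<in> {a..b} \<Longrightarrow> ((\<lambda>z. f z w) has_vector_derivative f' z w) (at z within {a..b})"
    by (rule flat_symbol_SucE) blast
  with Suc.IH show ?case by (intro flat_symbol_SucI)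
qed

lemma flat_symbol_mono: "flat_symbol a b k f \<Longrightarrow> l \<le> k \<Longrightarrow> flat_symbol a b l f"
proof (induction k)
  case (Suc k)
  then show ?case using flat_symbol_Suc[of a b k f] by (cases "l = Suc k") auto
qed (simp del: flat_symbol.simps)

lemma flat_symbol_const: "flat_symbol a b k (\<lambda>z w. c)"
proof (induction k arbitrary: c)
  case (Suc k)
  show ?case by (rule flat_symbol_SucI[OF _ Suc[of 0]]) auto
qed simp

lemma flat_symbol_ident: "flat_symbol a b k (\<lambda>z w. w)"
proof (cases k)
  case (Suc l)
  show ?thesis unfolding Suc by (rule flat_symbol_SucI[OF _ flat_symbol_const[of a b l 0]]) auto
qed simp

lemma flat_symbol_add:
  "flat_symbol a b k f \<Longrightarrow> flat_symbol a b k g \<Longrightarrow> flat_symbol a b k (\<lambda>z w. f z w + g z w)"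
proof (induction k arbitrary: f g)
  case 0 then show ?case by (simp add: jholo_add)
next
  case (Suc k)
  obtain f' where f': "jholo a b UNIV f" "flat_symbol a b k f'" "\<And>w. f' a w = 0"
    "\<And>z w. z \<in> {a..b} \<Longrightarrow> ((\<lambda>z. f z w) has_vector_derivative f' z w) (at z within {a..b})"
    using Suc.prems(1) by (rule flat_symbol_SucE) blast
  obtain g' where g': "jholo a b UNIV g" "flat_symbol a b k g'" "\<And>w. g' a w = 0"
    "\<And>z w. z \<in> {a..b} \<Longrightarrow> ((\<lambda>z. g z w) has_vector_derivative g' z w) (at z within {a..b})"
    using Suc.prems(2) by (rule flat_symbol_SucE) blast
  show ?case
  proof (rule flat_symbol_SucI[OF jholo_add[OF f'(1) g'(1)] Suc.IH[OF f'(2) g'(2)]])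
    show "((\<lambda>z. f z w + g z w) has_vector_derivative f' z w + g' z w) (at z within {a..b})"
      if "z \<in> {a..b}" for z w
      by (rule has_vector_derivative_add[OF f'(4)[OF that] g'(4)[OF that]])
  qed (simp add: f'(3) g'(3))
qed

lemma flat_symbol_mult:
  "flat_symbol a b k f \<Longrightarrow> flat_symbol a b k g \<Longrightarrow> flat_symbol a b k (\<lambda>z w. f z w * g z w)"
proof (induction k arbitrary: f g)
  case 0 then show ?case by (simp add: jholo_mult)
next
  case (Suc k)
  obtain f' where f': "jholo a b UNIV f" "flat_symbol a b k f'" "\<And>w. f' a w = 0"
    "\<And>z w. z \<in> {a..b} \<Longrightarrow> ((\<lambda>z. f z w) has_vector_derivative f' z w) (at z within {a..b})"
    using Suc.prems(1) by (rule flat_symbol_SucE) blast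
  obtain g' where g': "jholo a b UNIV g" "flat_symbol a b k g'" "\<And>w. g' a w = 0"
    "\<And>z w. z \<in> {a..b} \<Longrightarrow> ((\<lambda>z. g z w) has_vector_derivative g' z w) (at z within {a..b})"
    using Suc.prems(2) by (rule flat_symbol_SucE) blast
  note fg = flat_symbol_Suc[OF Suc.prems(1)] flat_symbol_Suc[OF Suc.prems(2)]
  show ?case
  proof (rule flat_symbol_SucI[OF jholo_mult[OF f'(1) g'(1)]
        flat_symbol_add[OF Suc.IH[OF fg(1) g'(2)] Suc.IH[OF f'(2) fg(2)]]])
    show "((\<lambda>z. f z w * g z w) has_vector_derivative f z w * g' z w + f' z w * g z w) (at z within {a..b})"
      if "z \<in> {a..b}" for z w
      by (rule has_vector_derivative_mult[OF f'(4)[OF that] g'(4)[OF that]])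
  qed (simp add: f'(3) g'(3))
qed

lemma flat_symbol_minus: "flat_symbol a b k f \<Longrightarrow> flat_symbol a b k (\<lambda>z w. - f z w)"
  using flat_symbol_mult[OF flat_symbol_const[of a b k "-1"]] by simp

lemma flat_symbol_diff:
  "flat_symbol a b k f \<Longrightarrow> flat_symbol a b k g \<Longrightarrow> flat_symbol a b k (\<lambda>z w. f z w - g z w)"
  using flat_symbol_add[OF _ flat_symbol_minus] by fastforce

lemma flat_symbol_power: "flat_symbol a b k f \<Longrightarrow> flat_symbol a b k (\<lambda>z w. f z w ^ n)"
  by (induction n) (auto intro: flat_symbol_mult flat_symbol_const)

lemma flat_symbol_inverse:
  assumes "flat_symbol a b k f" "\<And>z w. z \<in> {a..b} \<Longrightarrow> f z w \<noteq> 0"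
  shows "flat_symbol a b k (\<lambda>z w. inverse (f z w))"
  using assms(1)
proof (induction k)
  case 0
  then have "jholo a b UNIV f" by simp
  from jholo_inverse[OF this assms(2)] show ?case by simp
next
  case (Suc k)
  obtain f' where f': "jholo a b UNIV f" "flat_symbol a b k f'" "\<And>w. f' a w = 0"
    "\<And>z w. z \<in> {a..b} \<Longrightarrow> ((\<lambda>z. f z w) has_vector_derivative f' z w) (at z within {a..b})"
    using Suc.prems(1) by (rule flat_symbol_SucE) blast
  note IH = Suc.IH[OF flat_symbol_Suc[OF Suc.prems]]
  show ?case
  proof (rule flat_symbol_SucI[OF jholo_inverse[OF f'(1) assms(2)] flat_symbol_minus[OF flat_symbol_mult[OF flat_symbol_mult[OF IH f'(2)] IH]]])
    fix z w assume z: "z \<in> {a..b}"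
    have "((\<lambda>z. inverse (f z w)) has_derivative (\<lambda>h. - (inverse (f z w) * (h *\<^sub>R f' z w) * inverse (f z w)))) (at z within {a..b})"
      by (rule Deriv.has_derivative_inverse[OF assms(2)[OF z] f'(4)[OF z, unfolded has_vector_derivative_def]])
    then show "((\<lambda>z. inverse (f z w)) has_vector_derivative - (inverse (f z w) * f' z w * inverse (f z w))) (at z within {a..b})"
      unfolding has_vector_derivative_def by simp
  qed (auto simp: f'(3))
qed

lemmas flat_symbol_intros =
  flat_symbol_const flat_symbol_ident flat_symbol_add flat_symbol_mult flat_symbol_minus
  flat_symbol_diff flat_symbol_power

section \<open>The Riccati recursion\<close>

type_synonym symbol = "real \<Rightarrow> complex \<Rightarrow> complex"

text \<open>With \<open>w = 1/\<xi>\<close>, the graph \<open>y = S x\<close> is invariant under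
  \<open>x' = \<xi> x + A x + B y\<close>, \<open>y' = - \<xi> y + C x + D y\<close> up to a relative error \<open>O(w\<^sup>k\<^sup>+\<^sup>1)\<close>.\<close>

definition approx_invariant_graph ::
  "real \<Rightarrow> real \<Rightarrow> (2 \<Rightarrow> 2 \<Rightarrow> symbol) \<Rightarrow> (2 \<Rightarrow> 2 \<Rightarrow> symbol) \<Rightarrow> (2 \<Rightarrow> 2 \<Rightarrow> symbol) \<Rightarrow> (2 \<Rightarrow> 2 \<Rightarrow> symbol) \<Rightarrow>
     (2 \<Rightarrow> 2 \<Rightarrow> symbol) \<Rightarrow> (2 \<Rightarrow> 2 \<Rightarrow> symbol) \<Rightarrow> (2 \<Rightarrow> 2 \<Rightarrow> symbol) \<Rightarrow> (2 \<Rightarrow> 2 \<Rightarrow> symbol) \<Rightarrow> nat \<Rightarrow> nat \<Rightarrow> bool" where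
  "approx_invariant_graph a b A B C D S S' R T n k \<longleftrightarrow> (\<forall>i j. flat_symbol a b (Suc n) (S i j) \<and> flat_symbol a b n (S' i j) \<and>
      flat_symbol a b n (R i j) \<and> flat_symbol a b n (T i j) \<and> (\<forall>w. S' i j a w = 0) \<and>
      (\<forall>z\<in>{a..b}. \<forall>w. ((\<lambda>z. S i j z w) has_vector_derivative S' i j z w) (at z within {a..b})) \<and>
      (\<forall>z w. S i j z w = w / 2 * C i j z w + w\<^sup>2 * T i j z w) \<and>
      (\<forall>z w. w * (C i j z w + (\<Sum>l\<in>UNIV. D i l z w * S l j z w) - S' i j z w - (\<Sum>l\<in>UNIV. S i l z w * A l j z w)
          - (\<Sum>l\<in>UNIV. \<Sum>m\<in>UNIV. S i l z w * B l m z w * S m j z w)) - 2 * S i j z w = w ^ Suc (Suc k) * R i j z w))"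

text \<open>Inserting y = S x gives the Riccati equation 2 \<xi> S = C + D S - S' - S A - S B S.
  Multiplied by w, its dominant term is 2 S, so S = w C / 2 is a first approximation. A remainder
  w^(k+2) R is removed by adding w^(k+2) R / 2 to S; every other change carries one more factor w.
  The new remainder contains the derivative of R, so each step costs one order of flatness.\<close>

lemma approx_invariant_graph_exists:
  fixes A B C D :: "2 \<Rightarrow> 2 \<Rightarrow> symbol"
  assumes "\<And>i j. flat_symbol a b (n + Suc k) (A i j)" "\<And>i j. flat_symbol a b (n + Suc k) (B i j)"
    "\<And>i j. flat_symbol a b (n + Suc k) (C i j)" "\<And>i j. flat_symbol a b (n + Suc k) (D i j)"
  shows "\<exists>S S' R T. approx_invariant_graph a b A B C D S S' R T n k"
  using assms
proof (induction k arbitrary: n)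
  case 0
  have "\<forall>p. \<exists>C'. flat_symbol a b n C' \<and> (\<forall>w. C' a w = 0) \<and>
      (\<forall>z\<in>{a..b}. \<forall>w. ((\<lambda>z. C (fst p) (snd p) z w) has_vector_derivative C' z w) (at z within {a..b}))"
    using "0.prems"(3) by simp
  then obtain C'' where C'': "\<And>p. flat_symbol a b n (C'' p)" "\<And>p w. C'' p a w = 0"
      "\<And>p z w. z \<in> {a..b} \<Longrightarrow> ((\<lambda>z. C (fst p) (snd p) z w) has_vector_derivative C'' p z w) (at z within {a..b})"
    by metis
  define C' where "C' i j = C'' (i, j)" for i j
  have C': "\<And>i j. flat_symbol a b n (C' i j)" "\<And>i j w. C' i j a w = 0"
      "\<And>i j z w. z \<in> {a..b} \<Longrightarrow> ((\<lambda>z. C i j z w) has_vector_derivative C' i j z w) (at z within {a..b})"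
    using C'' unfolding C'_def by (auto simp: C''(3)[of _ "(_, _)", simplified])
  have s: "\<And>i j. flat_symbol a b n (A i j)" "\<And>i j. flat_symbol a b n (B i j)" "\<And>i j. flat_symbol a b n (D i j)"
    "\<And>i j. flat_symbol a b n (C i j)" "\<And>i j. flat_symbol a b (Suc n) (C i j)"
    using "0.prems" by (auto intro: flat_symbol_Suc simp del: flat_symbol.simps)
  show ?case
    unfolding approx_invariant_graph_def
    apply (rule exI[of _ "\<lambda>i j z w. w / 2 * C i j z w"])
    apply (rule exI[of _ "\<lambda>i j z w. w / 2 * C' i j z w"])
    apply (rule exI[of _ "\<lambda>i j z w. 1 / 2 * ((D i 1 z w * C 1 j z w + D i 2 z w * C 2 j z w) - C' i j z w
        - (C i 1 z w * A 1 j z w + C i 2 z w * A 2 j z w)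
        - w * (1 / 2) * (C i 1 z w * B 1 1 z w * C 1 j z w + C i 1 z w * B 1 2 z w * C 2 j z w
         + C i 2 z w * B 2 1 z w * C 1 j z w + C i 2 z w * B 2 2 z w * C 2 j z w))"])
    apply (rule exI[of _ "\<lambda>i j z w. 0"])
    apply (intro allI conjI ballI)
    subgoal unfolding divide_inverse by (intro flat_symbol_intros s)
    subgoal unfolding divide_inverse by (intro flat_symbol_intros C')
    subgoal by (intro flat_symbol_intros s C')
    subgoal by (intro flat_symbol_intros)
    subgoal by (simp add: C')
    subgoal using has_vector_derivative_mult_right[OF C'(3)] .
    subgoal by simp
    subgoal by (simp add: sum_2 field_simps power2_eq_square)
    done
next
  case (Suc k)
  note ass = Suc.prems
  have ass': "\<And>i j. flat_symbol a b (Suc n + Suc k) (A i j)" "\<And>i j. flat_symbol a b (Suc n + Suc k) (B i j)"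
    "\<And>i j. flat_symbol a b (Suc n + Suc k) (C i j)" "\<And>i j. flat_symbol a b (Suc n + Suc k) (D i j)"
    using ass by (simp_all del: flat_symbol.simps)
  from Suc.IH[OF ass'] obtain S S' R T where "approx_invariant_graph a b A B C D S S' R T (Suc n) k"
    by blast
  then have S: "\<And>i j. flat_symbol a b (Suc (Suc n)) (S i j)" "\<And>i j. flat_symbol a b (Suc n) (S' i j)"
      "\<And>i j. flat_symbol a b (Suc n) (R i j)" "\<And>i j. flat_symbol a b (Suc n) (T i j)" "\<And>i j w. S' i j a w = 0"
      and dS: "\<And>i j z w. z \<in> {a..b} \<Longrightarrow> ((\<lambda>z. S i j z w) has_vector_derivative S' i j z w) (at z within {a..b})"
      and ST: "\<And>i j z w. S i j z w = w / 2 * C i j z w + w\<^sup>2 * T i j z w"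
      and res: "\<And>i j z w. w * (C i j z w + (\<Sum>l\<in>UNIV. D i l z w * S l j z w) - S' i j z w - (\<Sum>l\<in>UNIV. S i l z w * A l j z w)
          - (\<Sum>l\<in>UNIV. \<Sum>m\<in>UNIV. S i l z w * B l m z w * S m j z w)) - 2 * S i j z w = w ^ Suc (Suc k) * R i j z w"
    unfolding approx_invariant_graph_def by blast+
  have "\<forall>p. \<exists>R'. flat_symbol a b n R' \<and> (\<forall>w. R' a w = 0) \<and>
      (\<forall>z\<in>{a..b}. \<forall>w. ((\<lambda>z. R (fst p) (snd p) z w) has_vector_derivative R' z w) (at z within {a..b}))"
    using S(3) by simp
  then obtain R'' where R'': "\<And>p. flat_symbol a b n (R'' p)" "\<And>p w. R'' p a w = 0"
      "\<And>p z w. z \<in> {a..b} \<Longrightarrow> ((\<lambda>z. R (fst p) (snd p) z w) has_vector_derivative R'' p z w) (at z within {a..b})"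
    by metis
  define R' where "R' i j = R'' (i, j)" for i j
  have R': "\<And>i j. flat_symbol a b n (R' i j)" "\<And>i j w. R' i j a w = 0"
      "\<And>i j z w. z \<in> {a..b} \<Longrightarrow> ((\<lambda>z. R i j z w) has_vector_derivative R' i j z w) (at z within {a..b})"
    using R'' unfolding R'_def by (auto simp: R''(3)[of _ "(_, _)", simplified])
  have s: "\<And>i j. flat_symbol a b n (A i j)" "\<And>i j. flat_symbol a b n (B i j)" "\<And>i j. flat_symbol a b n (D i j)"
    "\<And>i j. flat_symbol a b n (C i j)" "\<And>i j. flat_symbol a b n (S i j)" "\<And>i j. flat_symbol a b n (R i j)"
    by (rule flat_symbol_mono[OF ass(1)] flat_symbol_mono[OF ass(2)] flat_symbol_mono[OF ass(3)]
      flat_symbol_mono[OF ass(4)] flat_symbol_mono[OF S(1)] flat_symbol_mono[OF S(3)], simp)+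
  have s': "\<And>i j. flat_symbol a b (Suc n) (S i j)" "\<And>i j. flat_symbol a b n (T i j)" "\<And>i j. flat_symbol a b n (S' i j)"
    using S(1,2,4) by (auto intro: flat_symbol_Suc simp del: flat_symbol.simps)
  show ?case
    unfolding approx_invariant_graph_def
    apply (rule exI[of _ "\<lambda>i j z w. S i j z w + w ^ Suc (Suc k) * (1 / 2) * R i j z w"])
    apply (rule exI[of _ "\<lambda>i j z w. S' i j z w + w ^ Suc (Suc k) * (1 / 2) * R' i j z w"])
    apply (rule exI[of _ "\<lambda>i j z w. 1 / 2 * ((D i 1 z w * R 1 j z w + D i 2 z w * R 2 j z w) - R' i j z w
        - (R i 1 z w * A 1 j z w + R i 2 z w * A 2 j z w)
        - (R i 1 z w * B 1 1 z w * S 1 j z w + R i 1 z w * B 1 2 z w * S 2 j z w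
         + R i 2 z w * B 2 1 z w * S 1 j z w + R i 2 z w * B 2 2 z w * S 2 j z w)
        - (S i 1 z w * B 1 1 z w * R 1 j z w + S i 1 z w * B 1 2 z w * R 2 j z w
         + S i 2 z w * B 2 1 z w * R 1 j z w + S i 2 z w * B 2 2 z w * R 2 j z w)
        - w ^ Suc (Suc k) * (1 / 2) * (R i 1 z w * B 1 1 z w * R 1 j z w + R i 1 z w * B 1 2 z w * R 2 j z w
         + R i 2 z w * B 2 1 z w * R 1 j z w + R i 2 z w * B 2 2 z w * R 2 j z w))"])
    \<comment> \<open>All corrections are O(w^2), so the first-order term w C / 2 of S survives the
      recursion; \<open>S12_lower\<close> reads it off.\<close>
    apply (rule exI[of _ "\<lambda>i j z w. T i j z w + w ^ k * (1 / 2) * R i j z w"])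
    apply (intro allI conjI ballI)
    subgoal by (intro flat_symbol_intros s' S)
    subgoal by (intro flat_symbol_intros s' R')
    subgoal by (intro flat_symbol_intros s R')
    subgoal by (intro flat_symbol_intros s s')
    subgoal by (simp add: S R')
    subgoal by (intro has_vector_derivative_add dS has_vector_derivative_mult_right[OF R'(3)])
    subgoal by (subst ST) (simp add: algebra_simps power2_eq_square)
    subgoal for i j z w
    proof -
      \<comment> \<open>With the power replaced by an indeterminate, the identity is polynomial and
        independent of k.\<close>
      define \<epsilon> where "\<epsilon> = w ^ Suc (Suc k)"
      show ?thesis
        using res[of w i j z] unfolding power_Suc[of w "Suc (Suc k)"] \<epsilon>_def[symmetric] sum_2
        by algebra
    qed
    done
qed

section \<open>From Lame functions to flat symbols\<close>

lemma flat_symbol_cong: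
  assumes "flat_symbol a b k f" "\<And>z w. z \<in> {a..b} \<Longrightarrow> f z w = g z w"
  shows "flat_symbol a b k g"
proof (cases k)
  case 0
  then show ?thesis using assms jholo_cong[of a b UNIV f g] by auto
next
  case (Suc l)
  with assms(1) obtain f' where f': "jholo a b UNIV f" "flat_symbol a b l f'" "\<And>w. f' a w = 0"
    "\<And>z w. z \<in> {a..b} \<Longrightarrow> ((\<lambda>z. f z w) has_vector_derivative f' z w) (at z within {a..b})"
    by (auto elim: flat_symbol_SucE)
  show ?thesis unfolding Suc
  proof (rule flat_symbol_SucI[OF _ f'(2,3)])
    show "jholo a b UNIV g" using jholo_cong[OF f'(1) open_UNIV assms(2)] by blast
    show "((\<lambda>z. g z w) has_vector_derivative f' z w) (at z within {a..b})" if "z \<in> {a..b}" for z w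
      by (rule has_vector_derivative_transform[OF that _ f'(4)[OF that]]) (simp add: assms(2))
  qed
qed

lemma Ck_on_mono: "Ck_on N S f \<Longrightarrow> k \<le> N \<Longrightarrow> Ck_on k S f"
proof -
  assume "Ck_on N S f" and k: "k \<le> N"
  then obtain D :: "nat \<Rightarrow> real \<Rightarrow> real" where "\<forall>x\<in>S. D 0 x = f x"
    "\<forall>j<N. \<forall>x\<in>S. (D j has_real_derivative D (Suc j) x) (at x within S)" "\<forall>j\<le>N. continuous_on S (D j)"
    unfolding Ck_on_def by blast
  with k show ?thesis unfolding Ck_on_def by (intro exI[of _ D]) auto
qed

lemma Ck_on_continuous: "Ck_on k S f \<Longrightarrow> continuous_on S f"
proof -
  assume "Ck_on k S f"
  then obtain D where "\<forall>x\<in>S. D 0 x = f x" "continuous_on S (D (0::nat))" unfolding Ck_on_def by blast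
  then show ?thesis by (simp cong: continuous_on_cong)
qed

text \<open>Below a the function is constant, so all its derivatives vanish there, and the
  continuity of the derivatives up to order k carries these zeros to the point a itself.\<close>

lemma Ck_on_flat_symbol:
  assumes f: "Ck_on k {..b} f" and ab: "a < b" and const: "\<And>z. z < a \<Longrightarrow> f z = c"
  shows "flat_symbol a b k (\<lambda>z w. complex_of_real (f z))"
proof -
  obtain D :: "nat \<Rightarrow> real \<Rightarrow> real" where D0: "\<And>x. x \<le> b \<Longrightarrow> D 0 x = f x"
    and D: "\<And>j x. j < k \<Longrightarrow> x \<le> b \<Longrightarrow> (D j has_real_derivative D (Suc j) x) (at x within {..b})"
    and cont: "\<And>j. j \<le> k \<Longrightarrow> continuous_on {..b} (D j)"
    using f unfolding Ck_on_def by auto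
  have zero: "j < k \<Longrightarrow> z < a \<Longrightarrow> D (Suc j) z = 0" for j z
  proof (induction j arbitrary: z)
    case (0 z)
    have "(D 0 has_real_derivative D 1 z) (at z)"
      using D[OF 0(1), of z] at_within_interior[of z "{..b}"] 0 ab by simp
    moreover have "(D 0 has_real_derivative 0) (at z)"
    proof (rule has_field_derivative_transform_within_open[of "\<lambda>_. c" _ _ "{..<a}"])
      show "c = D 0 x" if "x \<in> {..<a}" for x using D0[of x] const[of x] that ab by auto
    qed (use 0 in auto)
    ultimately show ?case using DERIV_unique by fastforce
  next
    case (Suc j z)
    have "(D (Suc j) has_real_derivative D (Suc (Suc j)) z) (at z)"
      using D[OF Suc.prems(1), of z] at_within_interior[of z "{..b}"] Suc.prems ab by simp
    moreover have "(D (Suc j) has_real_derivative 0) (at z)"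
    proof (rule has_field_derivative_transform_within_open[of "\<lambda>_. 0" _ _ "{..<a}"])
      show "0 = D (Suc j) x" if "x \<in> {..<a}" for x using Suc that by auto
    qed (use Suc.prems in auto)
    ultimately show ?case using DERIV_unique by blast
  qed
  have zero_a: "D (Suc j) a = 0" if j: "j < k" for j
  proof -
    have "continuous (at a within {..b}) (D (Suc j))"
      using cont[of "Suc j"] j ab by (auto simp: continuous_on_eq_continuous_within)
    then have "(D (Suc j) \<longlongrightarrow> D (Suc j) a) (at_left a)"
      unfolding continuous_within
      by (rule tendsto_within_subset) (use ab in auto)
    moreover have "(D (Suc j) \<longlongrightarrow> 0) (at_left a)"
      by (rule tendsto_eventually) (auto simp: eventually_at_filter zero[OF j])
    ultimately show ?thesis using tendsto_unique trivial_limit_at_left_real by blast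
  qed
  have "j + i \<le> k \<Longrightarrow> flat_symbol a b i (\<lambda>z w. complex_of_real (D j z))" for i j
  proof (induction i arbitrary: j)
    case 0
    then show ?case using continuous_on_subset[OF cont[of j]] by (auto intro: jholo_of_real)
  next
    case (Suc i)
    show ?case
    proof (rule flat_symbol_SucI[OF jholo_of_real Suc.IH[of "Suc j"]])
      show "continuous_on {a..b} (D j)"
        by (rule continuous_on_subset[OF cont]) (use Suc.prems in auto)
      show "((\<lambda>z. complex_of_real (D j z)) has_vector_derivative of_real (D (Suc j) z)) (at z within {a..b})"
        if "z \<in> {a..b}" for z w
      proof -
        have "(D j has_vector_derivative D (Suc j) z) (at z within {a..b})"
          unfolding has_real_derivative_iff_has_vector_derivative[symmetric]
          by (rule has_field_derivative_subset[OF D]) (use Suc.prems that in auto)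
        from bounded_linear.has_vector_derivative[OF bounded_linear_of_real this] show ?thesis .
      qed
    qed (use Suc.prems zero_a[of j] in auto)
  qed
  from this[of 0 k] show ?thesis
    by (rule flat_symbol_cong) (auto simp: D0)
qed

section \<open>The Rayleigh system at high wavenumber\<close>

text \<open>First-order form of the Rayleigh system for \<open>\<psi>\<^sub>1\<close>, \<open>\<psi>\<^sub>2\<close> and the horizontal and vertical traction; the complex
  argument is \<open>\<xi>\<close> here, whereas it is \<open>1/\<xi>\<close> in the block coefficients below.\<close>

definition ray_coeff :: "real \<Rightarrow> (real \<Rightarrow> real) \<Rightarrow> (real \<Rightarrow> real) \<Rightarrow> 4 \<Rightarrow> 4 \<Rightarrow> symbol" where
  "ray_coeff \<omega> lam mu i j z \<xi> =
     (let l = complex_of_real (lam z); m = complex_of_real (mu z) in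
      if i = 1 then (if j = 2 then \<xi> else if j = 3 then 1 / m else 0)
      else if i = 2 then (if j = 1 then - \<xi> * l / (l + 2 * m) else if j = 4 then 1 / (l + 2 * m) else 0)
      else if i = 3 then (if j = 1 then \<xi>\<^sup>2 * (l + 2 * m - l\<^sup>2 / (l + 2 * m)) - of_real (\<omega>\<^sup>2)
                          else if j = 4 then \<xi> * l / (l + 2 * m) else 0)
      else (if j = 2 then - of_real (\<omega>\<^sup>2) else if j = 3 then - \<xi> else 0))"

lemma two_neq [simp]: "(1::2) \<noteq> 2" "(2::2) \<noteq> 1"
  by simp_all

text \<open>Two of the 20 derivatives are spent on \<open>dm\<close> and \<open>ddm\<close>; the
  other 18 are the flatness of the blocks on which the recursion runs.\<close>

locale slab =
  fixes \<omega> H :: real and lam mu :: "real \<Rightarrow> real" and lam0 mu0 :: real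
  assumes medium: "slab_medium \<omega> H lam mu lam0 mu0"
    and smooth: "Ck_on 20 {..0} lam" "Ck_on 20 {..0} mu"
begin

abbreviation "rcoeff \<equiv> ray_coeff \<omega> lam mu"

lemma omega_pos: "\<omega> > 0" and H_pos: "H > 0"
  using medium by (auto simp: slab_medium_def)

lemma mu_pos: "Z \<le> 0 \<Longrightarrow> mu Z > 0"
  using medium unfolding slab_medium_def by fastforce

lemma lam_mu_pos: "Z \<le> 0 \<Longrightarrow> lam Z + mu Z > 0"
proof -
  assume Z: "Z \<le> 0"
  then have "2 * mu Z + 3 * lam Z > 0" using medium unfolding slab_medium_def by fastforce
  with mu_pos[OF Z] show ?thesis by linarith
qed

lemma lam_2mu_pos: "Z \<le> 0 \<Longrightarrow> lam Z + 2 * mu Z > 0"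
  using mu_pos[of Z] lam_mu_pos[of Z] by linarith

lemma lam_cont: "continuous_on {..0} lam" and mu_cont: "continuous_on {..0} mu"
  using smooth Ck_on_continuous by auto

lemma const_below: "Z < - H \<Longrightarrow> lam Z = lam0" "Z < - H \<Longrightarrow> mu Z = mu0"
  using medium by (auto simp: slab_medium_def)

lemma const_le: assumes "Z \<le> - H" shows "lam Z = lam0" "mu Z = mu0"
proof -
  have lim: "f (- H) = c" if "continuous_on {..0} f" "\<And>z. z < - H \<Longrightarrow> f z = c" for f :: "real \<Rightarrow> real" and c
  proof -
    have "continuous (at (- H) within {..0}) f"
      using that(1) H_pos by (auto simp: continuous_on_eq_continuous_within)
    then have "(f \<longlongrightarrow> f (- H)) (at_left (- H))"
      unfolding continuous_within by (rule tendsto_within_subset) (use H_pos in auto)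
    moreover have "(f \<longlongrightarrow> c) (at_left (- H))"
      by (rule tendsto_eventually) (auto simp: eventually_at_filter that(2))
    ultimately show ?thesis using tendsto_unique trivial_limit_at_left_real by blast
  qed
  show "lam Z = lam0" "mu Z = mu0"
    using lim[OF lam_cont const_below(1)] lim[OF mu_cont const_below(2)] const_below[of Z] assms
    by (cases "Z = - H"; simp)+
qed

text \<open>In the compliances m, n and k the system becomes polynomial: lam / (lam + 2 mu) = (m -
  n) k, 1 / (lam + 2 mu) = m n k, and lam + 2 mu - lam^2 / (lam + 2 mu) = 4 k. The only relation
  left is k (m + n) = 1, so \<open>algebra\<close> can settle the change of variables.\<close>

definition cm :: symbol where "cm z w = inverse (complex_of_real (mu z))"
definition cn :: symbol where "cn z w = inverse (complex_of_real (lam z) + complex_of_real (mu z))"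
definition ck :: symbol where "ck z w = inverse (cm z w + cn z w)"

lemma lame_nonzero: "Z \<le> 0 \<Longrightarrow> complex_of_real (mu Z) \<noteq> 0"
  "Z \<le> 0 \<Longrightarrow> complex_of_real (lam Z) + complex_of_real (mu Z) \<noteq> 0"
  "Z \<le> 0 \<Longrightarrow> complex_of_real (lam Z) + 2 * complex_of_real (mu Z) \<noteq> 0"
proof -
  assume Z: "Z \<le> 0"
  show "complex_of_real (mu Z) \<noteq> 0" using mu_pos[OF Z] by simp
  have "complex_of_real (lam Z + mu Z) \<noteq> 0" unfolding of_real_eq_0_iff using lam_mu_pos[OF Z] by linarith
  then show "complex_of_real (lam Z) + complex_of_real (mu Z) \<noteq> 0" by simp
  have "complex_of_real (lam Z + 2 * mu Z) \<noteq> 0" unfolding of_real_eq_0_iff using lam_2mu_pos[OF Z] by linarith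
  then show "complex_of_real (lam Z) + 2 * complex_of_real (mu Z) \<noteq> 0" by simp
qed

lemma cm_nz: "z \<le> 0 \<Longrightarrow> cm z w \<noteq> 0" and cn_nz: "z \<le> 0 \<Longrightarrow> cn z w \<noteq> 0"
  and cmn_nz: "z \<le> 0 \<Longrightarrow> cm z w + cn z w \<noteq> 0"
proof -
  assume z: "z \<le> 0"
  show "cm z w \<noteq> 0" "cn z w \<noteq> 0" using lame_nonzero[OF z] by (simp_all add: cm_def cn_def)
  have "complex_of_real (inverse (mu z) + inverse (lam z + mu z)) \<noteq> 0"
    unfolding of_real_eq_0_iff
    using add_pos_pos[OF positive_imp_inverse_positive[OF mu_pos[OF z]] positive_imp_inverse_positive[OF lam_mu_pos[OF z]]]
    by linarith
  then show "cm z w + cn z w \<noteq> 0" by (simp add: cm_def cn_def)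
qed

lemma flat_cm: "flat_symbol (- H) 0 20 cm" and flat_cn: "flat_symbol (- H) 0 20 cn"
  and flat_ck: "flat_symbol (- H) 0 20 ck"
proof -
  have mH: "- H < 0" using H_pos by simp
  have l: "flat_symbol (- H) 0 20 (\<lambda>z w. complex_of_real (lam z))"
    by (rule Ck_on_flat_symbol[OF smooth(1) mH const_below(1)])
  have m: "flat_symbol (- H) 0 20 (\<lambda>z w. complex_of_real (mu z))"
    by (rule Ck_on_flat_symbol[OF smooth(2) mH const_below(2)])
  show 1: "flat_symbol (- H) 0 20 cm"
    unfolding cm_def[abs_def] by (rule flat_symbol_inverse[OF m]) (use lame_nonzero in auto)
  show 2: "flat_symbol (- H) 0 20 cn"
    unfolding cn_def[abs_def] by (rule flat_symbol_inverse[OF flat_symbol_add[OF l m]]) (use lame_nonzero in auto)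
  show "flat_symbol (- H) 0 20 ck"
    unfolding ck_def[abs_def] by (rule flat_symbol_inverse[OF flat_symbol_add[OF 1 2]]) (use cmn_nz in auto)
qed

section \<open>Block form of the first-order system\<close>

definition is_deriv :: "nat \<Rightarrow> symbol \<Rightarrow> symbol \<Rightarrow> bool" where
  "is_deriv k f f' \<longleftrightarrow> flat_symbol (- H) 0 k f' \<and> (\<forall>w. f' (- H) w = 0) \<and>
     (\<forall>z\<in>{- H..0}. \<forall>w. ((\<lambda>z. f z w) has_vector_derivative f' z w) (at z within {- H..0}))"

text \<open>The first two depth derivatives of 1/mu, the only material function that the change of
  variables differentiates.\<close>

definition dm :: symbol where "dm = (SOME f'. is_deriv 19 cm f')"
definition ddm :: symbol where "ddm = (SOME f'. is_deriv 18 dm f')"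

lemma is_deriv_ex: "flat_symbol (- H) 0 (Suc k) f \<Longrightarrow> \<exists>f'. is_deriv k f f'"
  unfolding is_deriv_def by auto

lemma is_deriv_dm: "is_deriv 19 cm dm"
proof -
  have "flat_symbol (- H) 0 (Suc 19) cm" using flat_cm by simp
  from someI_ex[OF is_deriv_ex[OF this]] show ?thesis unfolding dm_def .
qed

lemma is_deriv_ddm: "is_deriv 18 dm ddm"
proof -
  have "flat_symbol (- H) 0 (Suc 18) dm" using is_deriv_dm unfolding is_deriv_def by simp
  from someI_ex[OF is_deriv_ex[OF this]] show ?thesis unfolding ddm_def .
qed

definition q :: complex where "q = of_real (\<omega>\<^sup>2 / 2)"

text \<open>The blocks are what remains of the system in the variables \<open>plus_part\<close> and
  \<open>minus_part\<close> once the diagonal \<xi> and - \<xi> are split off. No negative power of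
  w is left; h stands for half of \<open>dm\<close>.\<close>

definition blockA :: "2 \<Rightarrow> 2 \<Rightarrow> symbol" where
  "blockA i j z w = (let k = ck z w; m = cm z w; h = dm z w / 2 in
     if i = 1 then (if j = 1 then - k * h - q * w * (m - w * h) else k)
     else (if j = 1 then - h * h * k else h * k - q * h * w * w - q * m * w))"

definition blockB :: "2 \<Rightarrow> 2 \<Rightarrow> symbol" where
  "blockB i j z w = (let k = ck z w; m = cm z w; h = dm z w / 2; h' = ddm z w / 2 in
     if i = 1 then (if j = 1 then - k * h else - k + q * w * w)
     else (if j = 1 then h' - h * h * k + q * h * w * (w * h + m) + q * m * (w * h + m) else - h * k))"

definition blockC :: "2 \<Rightarrow> 2 \<Rightarrow> symbol" where
  "blockC i j z w = (let k = ck z w; m = cm z w; h = dm z w / 2; h' = ddm z w / 2 in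
     if i = 1 then (if j = 1 then - k * h else k - q * w * w)
     else (if j = 1 then - h' + h * h * k + q * h * w * (m - w * h) - q * m * (m - w * h) else - h * k))"

definition blockD :: "2 \<Rightarrow> 2 \<Rightarrow> symbol" where
  "blockD i j z w = (let k = ck z w; m = cm z w; h = dm z w / 2 in
     if i = 1 then (if j = 1 then - k * h + q * w * (w * h + m) else - k)
     else (if j = 1 then h * h * k else h * k - q * h * w * w + q * m * w))"

lemma flat_blocks: "flat_symbol (- H) 0 18 (blockA i j)" "flat_symbol (- H) 0 18 (blockB i j)"
  "flat_symbol (- H) 0 18 (blockC i j)" "flat_symbol (- H) 0 18 (blockD i j)"
proof -
  have f: "flat_symbol (- H) 0 18 cm" "flat_symbol (- H) 0 18 ck" "flat_symbol (- H) 0 18 dm" "flat_symbol (- H) 0 18 ddm"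
    using flat_symbol_mono[OF flat_cm, of 18] flat_symbol_mono[OF flat_ck, of 18]
      is_deriv_dm is_deriv_ddm flat_symbol_mono[of "- H" 0 19 dm 18] unfolding is_deriv_def by auto
  show "flat_symbol (- H) 0 18 (blockA i j)"
    unfolding blockA_def[abs_def] Let_def divide_inverse
    by (cases "i = 1"; cases "j = 1"; simp only: if_True if_False simp_thms; (intro flat_symbol_intros f)+)
  show "flat_symbol (- H) 0 18 (blockB i j)"
    unfolding blockB_def[abs_def] Let_def divide_inverse
    by (cases "i = 1"; cases "j = 1"; simp only: if_True if_False simp_thms; (intro flat_symbol_intros f)+)
  show "flat_symbol (- H) 0 18 (blockC i j)"
    unfolding blockC_def[abs_def] Let_def divide_inverse
    by (cases "i = 1"; cases "j = 1"; simp only: if_True if_False simp_thms; (intro flat_symbol_intros f)+)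
  show "flat_symbol (- H) 0 18 (blockD i j)"
    unfolding blockD_def[abs_def] Let_def divide_inverse
    by (cases "i = 1"; cases "j = 1"; simp only: if_True if_False simp_thms; (intro flat_symbol_intros f)+)
qed

lemma jholo_rcoeff: "jholo (- H) 0 W (rcoeff i j)"
proof -
  have l: "jholo (- H) 0 W (\<lambda>z w. complex_of_real (lam z))" "jholo (- H) 0 W (\<lambda>z w. complex_of_real (mu z))"
    by (intro jholo_of_real continuous_on_subset[OF lam_cont] continuous_on_subset[OF mu_cont]; auto)+
  have inv: "jholo (- H) 0 W (\<lambda>z w. inverse (complex_of_real (mu z)))"
    "jholo (- H) 0 W (\<lambda>z w. inverse (complex_of_real (lam z) + 2 * complex_of_real (mu z)))"
    by (intro jholo_inverse l jholo_add jholo_mult jholo_const; use lame_nonzero in auto)+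
  show ?thesis
    unfolding ray_coeff_def[abs_def] Let_def divide_inverse
    using exhaust_4[of i] exhaust_4[of j]
    by (elim disjE; simp; intro jholo_ident jholo_const jholo_add jholo_mult jholo_minus jholo_diff jholo_power l inv)
qed

definition ray_ode :: "complex \<Rightarrow> (4 \<Rightarrow> real \<Rightarrow> complex) \<Rightarrow> bool" where
  "ray_ode \<xi> y \<longleftrightarrow> (\<forall>z\<in>{- H..0}. \<forall>i. (y i has_vector_derivative (\<Sum>j\<in>UNIV. rcoeff i j z \<xi> * y j z)) (at z within {- H..0}))"

text \<open>In these variables the two exponents \<open>\<plusminus> \<xi>\<close>, each of which carries a Jordan block of the static
  elasticity system, are separated up to bounded coefficients; the first components are the
  tractions at the leading order.\<close>

definition plus_part :: "complex \<Rightarrow> (4 \<Rightarrow> real \<Rightarrow> complex) \<Rightarrow> 2 \<Rightarrow> real \<Rightarrow> complex" where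
  "plus_part \<xi> y i z = (if i = 1 then (y 3 z - y 4 z) / \<xi>
     else cm z (1/\<xi>) * (y 3 z + y 4 z) + 2 * \<xi> * (y 1 z + y 2 z) + dm z (1/\<xi>) / 2 * ((y 3 z + y 4 z) / \<xi>))"

definition minus_part :: "complex \<Rightarrow> (4 \<Rightarrow> real \<Rightarrow> complex) \<Rightarrow> 2 \<Rightarrow> real \<Rightarrow> complex" where
  "minus_part \<xi> y i z = (if i = 1 then (y 3 z + y 4 z) / \<xi>
     else cm z (1/\<xi>) * (y 3 z - y 4 z) - 2 * \<xi> * (y 1 z - y 2 z) - dm z (1/\<xi>) / 2 * ((y 3 z - y 4 z) / \<xi>))"

text \<open>Differentiating \<open>cm\<close> would couple the second components to the opposite
  first ones with the unbounded coefficient dm \<xi>. The correction by dm / 2 in the two parts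
  removes this: as the exponents differ by 2 \<xi>, a multiple c of the opposite component
  contributes 2 c \<xi> up to sign. The price is the bounded term with \<open>ddm\<close>.\<close>

lemma ray_ode_blocks:
  assumes y: "ray_ode \<xi> y" and \<xi>: "\<xi> \<noteq> 0" and z: "z \<in> {- H..0}"
  shows "(plus_part \<xi> y i has_vector_derivative (\<xi> * plus_part \<xi> y i z
      + (\<Sum>j\<in>UNIV. blockA i j z (1/\<xi>) * plus_part \<xi> y j z) + (\<Sum>j\<in>UNIV. blockB i j z (1/\<xi>) * minus_part \<xi> y j z)))
      (at z within {- H..0})"
    "(minus_part \<xi> y i has_vector_derivative (- \<xi> * minus_part \<xi> y i z
      + (\<Sum>j\<in>UNIV. blockC i j z (1/\<xi>) * plus_part \<xi> y j z) + (\<Sum>j\<in>UNIV. blockD i j z (1/\<xi>) * minus_part \<xi> y j z)))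
      (at z within {- H..0})"
proof -
  define w where "w = 1 / \<xi>"
  have \<xi>w: "\<xi> * w = 1" using \<xi> by (simp add: w_def)
  have div: "u / \<xi> = u * w" for u by (simp add: w_def)
  define m n k where "m = cm z w" and "n = cn z w" and "k = ck z w"
  have nz: "m \<noteq> 0" "n \<noteq> 0" "m + n \<noteq> 0" using cm_nz cn_nz cmn_nz z by (auto simp: m_def n_def)
  have k: "k * (m + n) = 1" using nz(3) by (simp add: k_def ck_def m_def n_def)
  have mu: "complex_of_real (mu z) = 1 / m" by (simp add: m_def cm_def divide_inverse)
  have lam: "complex_of_real (lam z) = 1 / n - 1 / m"
    by (simp add: n_def m_def cn_def cm_def divide_inverse)
  have kk: "k = 1 / (m + n)" using k nz(3) by (simp add: field_simps)
  have sg: "complex_of_real (lam z) + 2 * complex_of_real (mu z) = 1 / (m * n * k)"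
    using nz unfolding mu lam kk by (simp add: field_simps)
  have c1: "1 / complex_of_real (mu z) = m" by (simp add: mu)
  have c2: "1 / (complex_of_real (lam z) + 2 * complex_of_real (mu z)) = m * n * k" by (simp add: sg)
  have lmn: "complex_of_real (lam z) * (m * n) = m - n"
    unfolding lam using nz by (simp add: field_simps)
  have sgmn: "(complex_of_real (lam z) + 2 * complex_of_real (mu z)) * (m * n * k) = 1"
    using nz k by (cases "k = 0") (simp_all add: sg)
  have div_sg: "u / (complex_of_real (lam z) + 2 * complex_of_real (mu z)) = u * (m * n * k)" for u
    by (simp add: sg)
  have c3: "u * complex_of_real (lam z) / (complex_of_real (lam z) + 2 * complex_of_real (mu z)) = u * ((m - n) * k)" for u
    unfolding div_sg lmn[symmetric] by (simp add: mult_ac)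
  have c4: "complex_of_real (lam z) + 2 * complex_of_real (mu z)
      - (complex_of_real (lam z))\<^sup>2 / (complex_of_real (lam z) + 2 * complex_of_real (mu z)) = 4 * k" (is "?l = _")
  proof -
    have "?l * (m * n) = 4 * k * (m * n)"
      unfolding div_sg using lmn sgmn k by algebra
    then show ?thesis using nz(1,2) by simp
  qed
  have om: "complex_of_real (\<omega>\<^sup>2) = 2 * q" by (simp add: q_def)
  have dy: "(y i has_vector_derivative (\<Sum>j\<in>UNIV. rcoeff i j z \<xi> * y j z)) (at z within {- H..0})" for i
    using y z unfolding ray_ode_def by blast
  have d1: "(y 1 has_vector_derivative (\<xi> * y 2 z + m * y 3 z)) (at z within {- H..0})"
    using dy[of 1] by (simp add: sum_4 ray_coeff_def Let_def c1)
  have d2: "(y 2 has_vector_derivative (- \<xi> * ((m - n) * k) * y 1 z + m * n * k * y 4 z)) (at z within {- H..0})"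
    using dy[of 2] unfolding sum_4 ray_coeff_def Let_def c2 c3 by simp
  have d3: "(y 3 has_vector_derivative ((\<xi>\<^sup>2 * (4 * k) - 2 * q) * y 1 z + \<xi> * ((m - n) * k) * y 4 z)) (at z within {- H..0})"
    using dy[of 3] unfolding sum_4 ray_coeff_def Let_def c3 c4 om by simp
  have d4: "(y 4 has_vector_derivative (- (2 * q) * y 2 z - \<xi> * y 3 z)) (at z within {- H..0})"
    using dy[of 4] unfolding sum_4 ray_coeff_def Let_def om by simp
  have dcm: "((\<lambda>z. cm z w) has_vector_derivative dm z w) (at z within {- H..0})"
    using is_deriv_dm z unfolding is_deriv_def by blast
  have ddm: "((\<lambda>z. dm z w) has_vector_derivative ddm z w) (at z within {- H..0})"
    using is_deriv_ddm z unfolding is_deriv_def by blast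
  define h where "h = dm z w / 2"
  define h' where "h' = ddm z w / 2"
  have hh: "dm z w = 2 * h" "ddm z w = 2 * h'" by (simp_all add: h_def h'_def)
  have ddm2: "((\<lambda>z. dm z w / 2) has_vector_derivative ddm z w / 2) (at z within {- H..0})"
    using has_vector_derivative_mult_right[OF ddm, of "1 / 2"] by simp
  note d = d1 d2 d3 d4 dcm ddm2
  have p1: "(plus_part \<xi> y 1 has_vector_derivative (\<xi> * plus_part \<xi> y 1 z
      + (\<Sum>j\<in>UNIV. blockA 1 j z w * plus_part \<xi> y j z) + (\<Sum>j\<in>UNIV. blockB 1 j z w * minus_part \<xi> y j z))) (at z within {- H..0})"
    unfolding plus_part_def[abs_def] div w_def[symmetric]
    apply (simp only: two_neq if_True if_False simp_thms mult_1_left)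
    apply (rule has_vector_derivative_eq_rhs)
     apply (rule d has_vector_derivative_add has_vector_derivative_diff has_vector_derivative_mult has_vector_derivative_const)+
    apply (simp add: sum_2 blockA_def blockB_def minus_part_def plus_part_def div w_def[symmetric] Let_def hh m_def[symmetric] k_def[symmetric])
    using \<xi>w k by algebra
  have p2: "(plus_part \<xi> y 2 has_vector_derivative (\<xi> * plus_part \<xi> y 2 z
      + (\<Sum>j\<in>UNIV. blockA 2 j z w * plus_part \<xi> y j z) + (\<Sum>j\<in>UNIV. blockB 2 j z w * minus_part \<xi> y j z))) (at z within {- H..0})"
    unfolding plus_part_def[abs_def] div w_def[symmetric]
    apply (simp only: two_neq if_True if_False simp_thms mult_1_left)
    apply (rule has_vector_derivative_eq_rhs)
     apply (rule d has_vector_derivative_add has_vector_derivative_diff has_vector_derivative_mult has_vector_derivative_const)+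
    apply (simp add: sum_2 blockA_def blockB_def minus_part_def plus_part_def div w_def[symmetric] Let_def hh m_def[symmetric] k_def[symmetric])
    using \<xi>w k by algebra
  have m1: "(minus_part \<xi> y 1 has_vector_derivative (- \<xi> * minus_part \<xi> y 1 z
      + (\<Sum>j\<in>UNIV. blockC 1 j z w * plus_part \<xi> y j z) + (\<Sum>j\<in>UNIV. blockD 1 j z w * minus_part \<xi> y j z))) (at z within {- H..0})"
    unfolding minus_part_def[abs_def] div w_def[symmetric]
    apply (simp only: two_neq if_True if_False simp_thms mult_1_left)
    apply (rule has_vector_derivative_eq_rhs)
     apply (rule d has_vector_derivative_add has_vector_derivative_diff has_vector_derivative_mult has_vector_derivative_const)+
    apply (simp add: sum_2 blockC_def blockD_def minus_part_def plus_part_def div w_def[symmetric] Let_def hh m_def[symmetric] k_def[symmetric])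
    using \<xi>w k by algebra
  have m2: "(minus_part \<xi> y 2 has_vector_derivative (- \<xi> * minus_part \<xi> y 2 z
      + (\<Sum>j\<in>UNIV. blockC 2 j z w * plus_part \<xi> y j z) + (\<Sum>j\<in>UNIV. blockD 2 j z w * minus_part \<xi> y j z))) (at z within {- H..0})"
    unfolding minus_part_def[abs_def] div w_def[symmetric]
    apply (simp only: two_neq if_True if_False simp_thms mult_1_left)
    apply (rule has_vector_derivative_eq_rhs)
     apply (rule d has_vector_derivative_add has_vector_derivative_diff has_vector_derivative_mult has_vector_derivative_const)+
    apply (simp add: sum_2 blockC_def blockD_def minus_part_def plus_part_def div w_def[symmetric] Let_def hh m_def[symmetric] k_def[symmetric])
    using \<xi>w k by algebra
  show "(plus_part \<xi> y i has_vector_derivative (\<xi> * plus_part \<xi> y i z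
      + (\<Sum>j\<in>UNIV. blockA i j z (1/\<xi>) * plus_part \<xi> y j z) + (\<Sum>j\<in>UNIV. blockB i j z (1/\<xi>) * minus_part \<xi> y j z)))
      (at z within {- H..0})"
    "(minus_part \<xi> y i has_vector_derivative (- \<xi> * minus_part \<xi> y i z
      + (\<Sum>j\<in>UNIV. blockC i j z (1/\<xi>) * plus_part \<xi> y j z) + (\<Sum>j\<in>UNIV. blockD i j z (1/\<xi>) * minus_part \<xi> y j z)))
      (at z within {- H..0})"
    using p1 p2 m1 m2 exhaust_2[of i] unfolding w_def by (auto simp: w_def)
qed

end

section \<open>Comparison of solutions with the approximate graph\<close>

lemma jholo_family_bound:
  fixes f :: "'n::finite \<Rightarrow> 'n \<Rightarrow> symbol"
  assumes "\<And>i j. jholo a b UNIV (f i j)"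
  obtains M where "M > 0" "\<And>i j z w. z \<in> {a..b} \<Longrightarrow> norm w \<le> 1 \<Longrightarrow> norm (f i j z w) \<le> M"
proof -
  have "\<forall>p. \<exists>C>0. \<forall>z\<in>{a..b}. \<forall>w\<in>cball 0 1. norm (f (fst p) (snd p) z w) \<le> C"
    using jholo_bounded[OF assms compact_cball] by blast
  then obtain Mf where Mf: "\<And>p. Mf p > 0"
    "\<And>p z w. z \<in> {a..b} \<Longrightarrow> w \<in> cball 0 1 \<Longrightarrow> norm (f (fst p) (snd p) z w) \<le> Mf p" by metis
  define m where "m = (\<Sum>p\<in>UNIV. Mf p)"
  have mi: "Mf p \<le> m" for p unfolding m_def by (rule member_le_sum) (auto simp: Mf(1) less_imp_le)
  show thesis
  proof
    show "m > 0" using mi[of undefined] Mf(1)[of undefined] by linarith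
    show "norm (f i j z w) \<le> m" if "z \<in> {a..b}" "norm w \<le> 1" for i j z w
      using Mf(2)[of z w "(i, j)"] mi[of "(i, j)"] that by simp
  qed
qed

text \<open>Multiplication by i is skew for the real inner product, so only Re \<xi> causes growth,
  however large Im \<xi> is.\<close>

lemma inner_mult_add_le: "(a::complex) \<bullet> (\<xi> * a + t) \<le> \<bar>Re \<xi>\<bar> * (norm a)\<^sup>2 + norm a * norm t"
proof -
  have "a \<bullet> (\<xi> * a) = Re \<xi> * (norm a)\<^sup>2"
    unfolding cmod_power2 by (simp add: inner_complex_def power2_eq_square algebra_simps)
  also have "\<dots> \<le> \<bar>Re \<xi>\<bar> * (norm a)\<^sup>2" by (intro mult_right_mono) auto
  finally show ?thesis using norm_cauchy_schwarz[of a t] by (simp add: inner_add_right)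
qed

text \<open>The flatness 18 of the blocks splits as 4 + Suc 13: order 13 costs fourteen derivatives
  and leaves the residual w^15 R.\<close>

locale slab_graph = slab +
  fixes S S' R T :: "2 \<Rightarrow> 2 \<Rightarrow> symbol"
  assumes graph: "approx_invariant_graph (- H) 0 blockA blockB blockC blockD S S' R T 4 13"
begin

lemma S_deriv: "z \<in> {- H..0} \<Longrightarrow> ((\<lambda>z. S i j z w) has_vector_derivative S' i j z w) (at z within {- H..0})"
  and S'_init: "S' i j (- H) w = 0"
  and S_expand: "S i j z w = w / 2 * blockC i j z w + w\<^sup>2 * T i j z w"
  using graph unfolding approx_invariant_graph_def by blast+

lemma S_residual: "w * (blockC i j z w + (\<Sum>l\<in>UNIV. blockD i l z w * S l j z w) - S' i j z w - (\<Sum>l\<in>UNIV. S i l z w * blockA l j z w)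
          - (\<Sum>l\<in>UNIV. \<Sum>m\<in>UNIV. S i l z w * blockB l m z w * S m j z w)) - 2 * S i j z w = w ^ 15 * R i j z w"
proof -
  have "Suc (Suc 13) = 15" by simp
  from graph[unfolded approx_invariant_graph_def this] show ?thesis by blast
qed

lemma jholo_graph: "jholo (- H) 0 UNIV (S i j)" "jholo (- H) 0 UNIV (R i j)" "jholo (- H) 0 UNIV (T i j)"
  using graph unfolding approx_invariant_graph_def by (blast intro: flat_symbol_jholo)+

lemma jholo_blocks: "jholo (- H) 0 UNIV (blockA i j)" "jholo (- H) 0 UNIV (blockB i j)"
   "jholo (- H) 0 UNIV (blockC i j)" "jholo (- H) 0 UNIV (blockD i j)"
  using flat_blocks flat_symbol_jholo by blast+

lemma S_residual':
  assumes "\<xi> * w = 1"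
  shows "blockC i j z w + (\<Sum>l\<in>UNIV. blockD i l z w * S l j z w) - S' i j z w - (\<Sum>l\<in>UNIV. S i l z w * blockA l j z w)
          - (\<Sum>l\<in>UNIV. \<Sum>m\<in>UNIV. S i l z w * blockB l m z w * S m j z w) - 2 * \<xi> * S i j z w = w ^ 14 * R i j z w"
    (is "?r - _ = _")
proof -
  have "\<xi> * (w * ?r - 2 * S i j z w) = \<xi> * (w ^ 15 * R i j z w)" unfolding S_residual ..
  moreover have "\<xi> * (w * ?r - 2 * S i j z w) = ?r - 2 * \<xi> * S i j z w"
    using assms by (simp add: right_diff_distrib mult.assoc[symmetric] mult.commute[of \<xi> 2])
  moreover have "\<xi> * (w ^ 15 * R i j z w) = w ^ 14 * R i j z w"
    using assms by (simp add: mult.assoc[symmetric] power_Suc[of w 14, simplified])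
  ultimately show ?thesis by simp
qed

text \<open>The transport on the graph: insert y = S x in the equation for x and split off the
  exponent \<xi>.\<close>

definition reduced :: "2 \<Rightarrow> 2 \<Rightarrow> symbol" where
  "reduced i j z w = blockA i j z w + (\<Sum>l\<in>UNIV. blockB i l z w * S l j z w)"

lemma jholo_reduced: "jholo (- H) 0 UNIV (reduced i j)"
  unfolding reduced_def[abs_def] by (intro jholo_add jholo_sum jholo_mult jholo_blocks jholo_graph)

text \<open>The product rule turns the derivative of S X into the left side of the Riccati equation
  applied to X. All terms but the Riccati residual recombine into the second block equation.\<close>

lemma wkb_residual:
  assumes \<xi>w: "\<xi> * w = 1" and z: "z \<in> {- H..0}"
    and X: "\<And>j. (X j has_vector_derivative (\<xi> * X j z + (\<Sum>l\<in>UNIV. reduced j l z w * X l z))) (at z within {- H..0})"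
  shows "((\<lambda>z. \<Sum>j\<in>UNIV. S i j z w * X j z) has_vector_derivative
      (- \<xi> * (\<Sum>j\<in>UNIV. S i j z w * X j z) + (\<Sum>j\<in>UNIV. blockC i j z w * X j z)
       + (\<Sum>j\<in>UNIV. blockD i j z w * (\<Sum>l\<in>UNIV. S j l z w * X l z)) - w ^ 14 * (\<Sum>j\<in>UNIV. R i j z w * X j z))) (at z within {- H..0})"
proof -
  have "((\<lambda>z. \<Sum>j\<in>UNIV. S i j z w * X j z) has_vector_derivative
      (\<Sum>j\<in>UNIV. S i j z w * (\<xi> * X j z + (\<Sum>l\<in>UNIV. reduced j l z w * X l z)) + S' i j z w * X j z)) (at z within {- H..0})"
    by (intro has_vector_derivative_sum has_vector_derivative_mult S_deriv[OF z] X)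
  then show ?thesis
  proof (rule has_vector_derivative_eq_rhs)
    show "(\<Sum>j\<in>UNIV. S i j z w * (\<xi> * X j z + (\<Sum>l\<in>UNIV. reduced j l z w * X l z)) + S' i j z w * X j z)
      = - \<xi> * (\<Sum>j\<in>UNIV. S i j z w * X j z) + (\<Sum>j\<in>UNIV. blockC i j z w * X j z)
       + (\<Sum>j\<in>UNIV. blockD i j z w * (\<Sum>l\<in>UNIV. S j l z w * X l z)) - w ^ 14 * (\<Sum>j\<in>UNIV. R i j z w * X j z)"
      using S_residual'[OF \<xi>w, of i 1 z] S_residual'[OF \<xi>w, of i 2 z]
      unfolding reduced_def sum_2 by algebra
  qed
qed

text \<open>The solution is compared with (X, S X), where X = \<xi> exp (\<xi> (z + H)) U. The
  difference solves the block system with the forcing w^14 R X, of size |w|^13 exp (H |Re \<xi>|).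
  Gronwall adds a second factor exp (H |Re \<xi>|), hence the 2 H in the bound. It is not asked
  which exponential dominates, so the bound holds for every argument of \<xi>.\<close>

lemma wkb_error:
  assumes Ub: "\<And>i z. z \<in> {- H..0} \<Longrightarrow> norm (U i z) \<le> Ub"
    and U: "\<And>i z. z \<in> {- H..0} \<Longrightarrow> (U i has_vector_derivative (\<Sum>j\<in>UNIV. reduced i j z (1/\<xi>) * U j z)) (at z within {- H..0})"
    and M: "M > 0" "\<And>i j z w. z \<in> {- H..0} \<Longrightarrow> norm w \<le> 1 \<Longrightarrow> norm (blockA i j z w) \<le> M \<and> norm (blockB i j z w) \<le> M
        \<and> norm (blockC i j z w) \<le> M \<and> norm (blockD i j z w) \<le> M \<and> norm (R i j z w) \<le> M"
    and \<xi>: "norm \<xi> \<ge> 1" and y: "ray_ode \<xi> y"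
    and init1: "\<And>i. plus_part \<xi> y i (- H) = \<xi> * U i (- H)"
    and init2: "\<And>i. norm (minus_part \<xi> y i (- H) - (\<Sum>j\<in>UNIV. S i j (- H) (1/\<xi>) * plus_part \<xi> y j (- H))) \<le> N * norm (1/\<xi>) ^ 13"
    and N: "N \<ge> 0"
  shows "norm (plus_part \<xi> y i 0 - \<xi> * exp (\<xi> * of_real H) * U i 0)
      \<le> (2 * N + 8 * M * Ub) * exp ((16 * M + 1/2) * H) * norm (1/\<xi>) ^ 13 * exp (2 * H * \<bar>Re \<xi>\<bar>)" (is "_ \<le> ?B")
    "norm (minus_part \<xi> y i 0 - \<xi> * exp (\<xi> * of_real H) * (\<Sum>j\<in>UNIV. S i j 0 (1/\<xi>) * U j 0)) \<le> (2 * N + 8 * M * Ub) * exp ((16 * M + 1/2) * H) * norm (1/\<xi>) ^ 13 * exp (2 * H * \<bar>Re \<xi>\<bar>)"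
proof -
  define w where "w = 1 / \<xi>"
  have \<xi>0: "\<xi> \<noteq> 0" using \<xi> by auto
  then have \<xi>w: "\<xi> * w = 1" by (simp add: w_def)
  have w1: "norm w \<le> 1" using \<xi> \<xi>0 by (simp add: w_def norm_divide divide_le_eq_1)
  have nw: "norm \<xi> * norm w = 1" using \<xi>w by (metis norm_mult norm_one)
  have Ub0: "Ub \<ge> 0" using order_trans[OF norm_ge_zero Ub[of 0 undefined]] H_pos by simp
  define X where "X i z = \<xi> * exp (\<xi> * of_real (z + H)) * U i z" for i z
  define Y where "Y i z = (\<Sum>j\<in>UNIV. S i j z w * X j z)" for i z
  have dX: "(X i has_vector_derivative (\<xi> * X i z + (\<Sum>j\<in>UNIV. reduced i j z w * X j z))) (at z within {- H..0})"
    if z: "z \<in> {- H..0}" for i z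
  proof -
    have e: "((\<lambda>z. exp (\<xi> * of_real (z + H))) has_vector_derivative \<xi> * exp (\<xi> * of_real (z + H))) (at z within {- H..0})"
      unfolding of_real_add
      by (rule has_vector_derivative_real_field[where f = "\<lambda>u. exp (\<xi> * (u + of_real H))"])
        (auto intro!: derivative_eq_intros)
    show ?thesis
      unfolding X_def[abs_def]
      by (rule has_vector_derivative_eq_rhs[OF has_vector_derivative_mult[OF has_vector_derivative_mult_right[OF e] U[OF z]]])
        (simp add: w_def[symmetric] sum_distrib_left algebra_simps)
  qed
  have dY: "(Y i has_vector_derivative (- \<xi> * Y i z + (\<Sum>j\<in>UNIV. blockC i j z w * X j z)
       + (\<Sum>j\<in>UNIV. blockD i j z w * Y j z) - w ^ 14 * (\<Sum>j\<in>UNIV. R i j z w * X j z))) (at z within {- H..0})"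
    if z: "z \<in> {- H..0}" for i z
    unfolding Y_def[abs_def] by (rule wkb_residual[OF \<xi>w z dX[OF z]])
  define e1 where "e1 i z = plus_part \<xi> y i z - X i z" for i z
  define e2 where "e2 i z = minus_part \<xi> y i z - Y i z" for i z
  define t1 where "t1 i z = (\<Sum>j\<in>UNIV. blockA i j z w * e1 j z) + (\<Sum>j\<in>UNIV. blockB i j z w * e2 j z)" for i z
  define t2 where "t2 i z = (\<Sum>j\<in>UNIV. blockC i j z w * e1 j z) + (\<Sum>j\<in>UNIV. blockD i j z w * e2 j z)
      + w ^ 14 * (\<Sum>j\<in>UNIV. R i j z w * X j z)" for i z
  have de1: "(e1 i has_vector_derivative (\<xi> * e1 i z + t1 i z)) (at z within {- H..0})" if z: "z \<in> {- H..0}" for i z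
    unfolding e1_def[abs_def]
    by (rule has_vector_derivative_eq_rhs[OF has_vector_derivative_diff[OF ray_ode_blocks(1)[OF y \<xi>0 z] dX[OF z]]])
      (simp add: w_def[symmetric] t1_def e1_def e2_def Y_def reduced_def sum_2 algebra_simps)
  have de2: "(e2 i has_vector_derivative (- \<xi> * e2 i z + t2 i z)) (at z within {- H..0})" if z: "z \<in> {- H..0}" for i z
    unfolding e2_def[abs_def]
    by (rule has_vector_derivative_eq_rhs[OF has_vector_derivative_diff[OF ray_ode_blocks(2)[OF y \<xi>0 z] dY[OF z]]])
      (simp add: w_def[symmetric] t2_def e1_def e2_def sum_2 algebra_simps)
  define e where "e z = ((\<chi> i. e1 i z) :: complex ^ 2, (\<chi> i. e2 i z) :: complex ^ 2)" for z
  define e' where "e' z = ((\<chi> i. \<xi> * e1 i z + t1 i z) :: complex ^ 2, (\<chi> i. - \<xi> * e2 i z + t2 i z) :: complex ^ 2)" for z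
  \<comment> \<open>Of |w|^14 one power is spent on the factor \<xi> in X; the 2 counts the summands
    of R X.\<close>
  define r where "r = 2 * M * Ub * norm w ^ 13 * exp (\<bar>Re \<xi>\<bar> * H)"
  have comp: "norm (e1 i z) \<le> norm (e z)" "norm (e2 i z) \<le> norm (e z)" for i z
  proof -
    have "norm (e1 i z) \<le> norm (fst (e z))" "norm (e2 i z) \<le> norm (snd (e z))"
      using Finite_Cartesian_Product.norm_nth_le[of "fst (e z)" i] Finite_Cartesian_Product.norm_nth_le[of "snd (e z)" i]
      by (simp_all add: e_def)
    then show "norm (e1 i z) \<le> norm (e z)" "norm (e2 i z) \<le> norm (e z)"
      using norm_fst_le[of "fst (e z)" "snd (e z)"] norm_snd_le[of "snd (e z)" "fst (e z)"] by auto
  qed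
  \<comment> \<open>Each of the four components has four coefficients bounded by M and is allowed a
    forcing r, hence 16 M and 4 r.\<close>
  have gron: "norm (e 0) \<le> (norm (e (- H)) + 4 * r) * exp (((\<bar>Re \<xi>\<bar> + 16 * M) + 1/2) * (0 - (- H)))"
  proof (rule gronwall_norm)
    show "(e has_vector_derivative e' z) (at z within {- H..0})" if z: "z \<in> {- H..0}" for z
      unfolding e_def[abs_def] e'_def
      by (intro has_vector_derivative_Pair has_vector_derivative_vec_lambda de1[OF z] de2[OF z])
    show "e z \<bullet> e' z \<le> (\<bar>Re \<xi>\<bar> + 16 * M) * (norm (e z))\<^sup>2 + 4 * r * norm (e z)" if z: "z \<in> {- H..0}" for z
    proof -
      have Mz: "norm (blockA i j z w) \<le> M" "norm (blockB i j z w) \<le> M" "norm (blockC i j z w) \<le> M"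
        "norm (blockD i j z w) \<le> M" "norm (R i j z w) \<le> M" for i j using M(2)[OF z w1] by blast+
      have pr: "norm (a * b) \<le> M * norm (e z)" if "norm a \<le> M" "norm b \<le> norm (e z)" for a b :: complex
        unfolding norm_mult using that M(1) by (intro mult_mono) auto
      have t1b: "norm (t1 i z) \<le> 4 * M * norm (e z)" for i
        unfolding t1_def sum_2
        using norm_triangle_mono[OF norm_triangle_mono[OF pr[OF Mz(1)[of i 1] comp(1)[of 1 z]] pr[OF Mz(1)[of i 2] comp(1)[of 2 z]]]
          norm_triangle_mono[OF pr[OF Mz(2)[of i 1] comp(2)[of 1 z]] pr[OF Mz(2)[of i 2] comp(2)[of 2 z]]]]
        by simp
      have Xb: "norm (X i z) \<le> norm \<xi> * exp (\<bar>Re \<xi>\<bar> * H) * Ub" for i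
      proof -
        have "Re \<xi> * (z + H) \<le> \<bar>Re \<xi>\<bar> * H" using z by (intro mult_mono) auto
        then show ?thesis unfolding X_def norm_mult norm_exp_eq_Re
          by (intro mult_mono Ub[OF z]) (use Ub0 in auto)
      qed
      have "norm (R i j z w * X j z) \<le> M * (norm \<xi> * exp (\<bar>Re \<xi>\<bar> * H) * Ub)" for i j
        unfolding norm_mult by (rule mult_mono[OF Mz(5) Xb]) (use M(1) in auto)
      then have "norm (\<Sum>j\<in>UNIV. R i j z w * X j z) \<le> 2 * (M * (norm \<xi> * exp (\<bar>Re \<xi>\<bar> * H) * Ub))" for i
        unfolding sum_2 mult_2 by (intro norm_triangle_mono)
      then have "norm (w ^ 14 * (\<Sum>j\<in>UNIV. R i j z w * X j z)) \<le> norm w ^ 14 * (2 * (M * (norm \<xi> * exp (\<bar>Re \<xi>\<bar> * H) * Ub)))" for i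
        unfolding norm_mult norm_power by (intro mult_left_mono) auto
      also have "norm w ^ 14 * (2 * (M * (norm \<xi> * exp (\<bar>Re \<xi>\<bar> * H) * Ub))) = norm w ^ 13 * (norm \<xi> * norm w) * (2 * (M * (exp (\<bar>Re \<xi>\<bar> * H) * Ub)))"
        by (simp add: power_Suc[of "norm w" 13, simplified])
      also have "\<dots> = r" unfolding nw r_def by simp
      finally have rb: "norm (w ^ 14 * (\<Sum>j\<in>UNIV. R i j z w * X j z)) \<le> r" for i .
      have t2b: "norm (t2 i z) \<le> 4 * M * norm (e z) + r" for i
        unfolding t2_def sum_2[of "\<lambda>j. blockC i j z w * e1 j z"] sum_2[of "\<lambda>j. blockD i j z w * e2 j z"]
        using norm_triangle_mono[OF norm_triangle_mono[OF norm_triangle_mono[OF pr[OF Mz(3)[of i 1] comp(1)[of 1 z]] pr[OF Mz(3)[of i 2] comp(1)[of 2 z]]]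
          norm_triangle_mono[OF pr[OF Mz(4)[of i 1] comp(2)[of 1 z]] pr[OF Mz(4)[of i 2] comp(2)[of 2 z]]]] rb[of i]]
        by simp
      have r0: "0 \<le> r" using M(1) Ub0 by (simp add: r_def)
      have i1: "e1 i z \<bullet> (\<xi> * e1 i z + t1 i z) \<le> \<bar>Re \<xi>\<bar> * (norm (e1 i z))\<^sup>2 + norm (e z) * (4 * M * norm (e z) + r)" for i
        using inner_mult_add_le[of "e1 i z" \<xi> "t1 i z"] t1b[of i] r0
          mult_mono[OF comp(1)[of i z], of "norm (t1 i z)" "4 * M * norm (e z) + r"] by simp
      have i2: "e2 i z \<bullet> (- \<xi> * e2 i z + t2 i z) \<le> \<bar>Re \<xi>\<bar> * (norm (e2 i z))\<^sup>2 + norm (e z) * (4 * M * norm (e z) + r)" for i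
        using inner_mult_add_le[of "e2 i z" "- \<xi>" "t2 i z"]
          mult_mono[OF comp(2)[of i z] t2b[of i]] by simp
      have nn: "(norm (e z))\<^sup>2 = (norm (e1 1 z))\<^sup>2 + (norm (e1 2 z))\<^sup>2 + ((norm (e2 1 z))\<^sup>2 + (norm (e2 2 z))\<^sup>2)"
        by (simp add: e_def norm_Pair norm_vec_def L2_set_def sum_2)
      have "e z \<bullet> e' z = (e1 1 z \<bullet> (\<xi> * e1 1 z + t1 1 z) + e1 2 z \<bullet> (\<xi> * e1 2 z + t1 2 z))
          + (e2 1 z \<bullet> (- \<xi> * e2 1 z + t2 1 z) + e2 2 z \<bullet> (- \<xi> * e2 2 z + t2 2 z))"
        by (simp add: e_def e'_def inner_Pair inner_vec_def sum_2)
      also have "\<dots> \<le> \<bar>Re \<xi>\<bar> * (norm (e z))\<^sup>2 + 4 * (norm (e z) * (4 * M * norm (e z) + r))"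
        using i1[of 1] i1[of 2] i2[of 1] i2[of 2] unfolding nn distrib_left by linarith
      also have "\<dots> = (\<bar>Re \<xi>\<bar> + 16 * M) * (norm (e z))\<^sup>2 + 4 * r * norm (e z)"
        by (simp add: power2_eq_square algebra_simps)
      finally show ?thesis .
    qed
  qed (use H_pos M(1) Ub0 in \<open>auto simp: r_def\<close>)
  have "norm (e (- H)) \<le> 2 * N * norm w ^ 13"
  proof -
    have "e1 i (- H) = 0" for i by (simp add: e1_def X_def init1)
    moreover have "norm (e2 i (- H)) \<le> N * norm w ^ 13" for i
      using init2[of i] by (simp add: e2_def Y_def X_def init1 w_def)
    ultimately have "norm (snd (e (- H))) \<le> N * norm w ^ 13 + N * norm w ^ 13"
      using L2_set_le_sum[of UNIV "\<lambda>i::2. norm (e2 i (- H))"] add_mono[of "norm (e2 1 (- H))" "N * norm w ^ 13" "norm (e2 2 (- H))" "N * norm w ^ 13"]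
      by (simp add: e_def norm_vec_def sum_2)
    moreover have "fst (e (- H)) = 0" using \<open>\<And>i. e1 i (- H) = 0\<close> by (simp add: e_def vec_eq_iff)
    ultimately show ?thesis by (cases "e (- H)") (simp add: norm_Pair)
  qed
  note n0 = this
  have "norm (e 0) \<le> (norm (e (- H)) + 4 * r) * exp (((\<bar>Re \<xi>\<bar> + 16 * M) + 1/2) * H)"
    using gron by simp
  also have "\<dots> \<le> (2 * N * norm w ^ 13 + 4 * r) * exp (((\<bar>Re \<xi>\<bar> + 16 * M) + 1/2) * H)"
    by (intro mult_right_mono add_right_mono n0) simp
  also have "2 * N * norm w ^ 13 + 4 * r \<le> (2 * N + 8 * M * Ub) * norm w ^ 13 * exp (\<bar>Re \<xi>\<bar> * H)"
  proof -
    have "2 * N * norm w ^ 13 * 1 \<le> 2 * N * norm w ^ 13 * exp (\<bar>Re \<xi>\<bar> * H)"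
      using N H_pos by (intro mult_left_mono) auto
    then show ?thesis by (simp add: r_def algebra_simps)
  qed
  also have "(2 * N + 8 * M * Ub) * norm w ^ 13 * exp (\<bar>Re \<xi>\<bar> * H) * exp (((\<bar>Re \<xi>\<bar> + 16 * M) + 1/2) * H)
      = (2 * N + 8 * M * Ub) * exp ((16 * M + 1/2) * H) * norm w ^ 13 * exp (2 * H * \<bar>Re \<xi>\<bar>)"
  proof -
    have "exp (\<bar>Re \<xi>\<bar> * H) * exp (((\<bar>Re \<xi>\<bar> + 16 * M) + 1/2) * H) = exp ((16 * M + 1/2) * H) * exp (2 * H * \<bar>Re \<xi>\<bar>)"
      unfolding exp_add[symmetric] by (simp add: algebra_simps)
    then show ?thesis by (simp add: mult.assoc mult.left_commute)
  qed
  finally have B: "norm (e 0) \<le> ?B" by (simp add: mult_right_mono w_def)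
  show "norm (plus_part \<xi> y i 0 - \<xi> * exp (\<xi> * of_real H) * U i 0) \<le> ?B"
    using order_trans[OF comp(1)[of i 0] B] by (simp add: e1_def X_def)
  show "norm (minus_part \<xi> y i 0 - \<xi> * exp (\<xi> * of_real H) * (\<Sum>j\<in>UNIV. S i j 0 (1/\<xi>) * U j 0)) \<le> ?B"
    using order_trans[OF comp(2)[of i 0] B] by (simp add: e2_def Y_def X_def sum_distrib_left mult_ac w_def)
qed

end

section \<open>Fundamental solution, the reflection of \<xi> into - \<xi>, and the Jost data\<close>

context slab
begin

text \<open>One family of columns is fixed for all \<xi>, normalised at the bottom of the slab.
  Solutions are then linear in their data with coefficients entire in \<xi>; the proof that F is
  entire rests on this.\<close>

definition fund :: "4 \<Rightarrow> 4 \<Rightarrow> symbol" where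
  "fund = (SOME Y. \<forall>k. (\<forall>i w. Y k i (- H) w = (if i = k then 1 else 0)) \<and>
    (\<forall>i. \<forall>z\<in>{- H..0}. \<forall>w. ((\<lambda>z. Y k i z w) has_vector_derivative (\<Sum>j\<in>UNIV. rcoeff i j z w * Y k j z w)) (at z within {- H..0})) \<and>
    (\<forall>i. \<forall>z\<in>{- H..0}. Y k i z holomorphic_on UNIV))"

lemma fund: "fund k i (- H) w = (if i = k then 1 else 0)"
  "z \<in> {- H..0} \<Longrightarrow> ((\<lambda>z. fund k i z w) has_vector_derivative (\<Sum>j\<in>UNIV. rcoeff i j z w * fund k j z w)) (at z within {- H..0})"
  "z \<in> {- H..0} \<Longrightarrow> fund k i z holomorphic_on UNIV"
proof -
  have "\<forall>k. \<exists>Y. (\<forall>i w. Y i (- H) w = (if i = k then 1 else 0)) \<and>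
    (\<forall>i. \<forall>z\<in>{- H..0}. \<forall>w. ((\<lambda>z. Y i z w) has_vector_derivative (\<Sum>j\<in>UNIV. rcoeff i j z w * Y j z w)) (at z within {- H..0})) \<and>
    (\<forall>i. \<forall>z\<in>{- H..0}. Y i z holomorphic_on UNIV)"
  proof
    fix k :: 4
    have H: "- H \<le> 0" using H_pos by simp
    show "\<exists>Y. (\<forall>i w. Y i (- H) w = (if i = k then 1 else 0)) \<and>
    (\<forall>i. \<forall>z\<in>{- H..0}. \<forall>w. ((\<lambda>z. Y i z w) has_vector_derivative (\<Sum>j\<in>UNIV. rcoeff i j z w * Y j z w)) (at z within {- H..0})) \<and>
    (\<forall>i. \<forall>z\<in>{- H..0}. Y i z holomorphic_on UNIV)"
    proof (rule linear_ode_holomorphic[where A = rcoeff and v = "\<lambda>i w. if i = k then 1 else 0", OF H open_UNIV jholo_rcoeff], goal_cases)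
      case (1 i)
      show ?case by (rule holomorphic_on_const)
    next
      case (2 Y)
      then show ?case by (intro exI[of _ Y]) blast
    qed
  qed
  from choice[OF this] have "\<exists>Y. \<forall>k. (\<forall>i w. Y k i (- H) w = (if i = k then 1 else 0)) \<and>
    (\<forall>i. \<forall>z\<in>{- H..0}. \<forall>w. ((\<lambda>z. Y k i z w) has_vector_derivative (\<Sum>j\<in>UNIV. rcoeff i j z w * Y k j z w)) (at z within {- H..0})) \<and>
    (\<forall>i. \<forall>z\<in>{- H..0}. Y k i z holomorphic_on UNIV)" .
  note f = someI_ex[OF this, folded fund_def]
  show "fund k i (- H) w = (if i = k then 1 else 0)"
  "z \<in> {- H..0} \<Longrightarrow> ((\<lambda>z. fund k i z w) has_vector_derivative (\<Sum>j\<in>UNIV. rcoeff i j z w * fund k j z w)) (at z within {- H..0})"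
  "z \<in> {- H..0} \<Longrightarrow> fund k i z holomorphic_on UNIV"
    using f by blast+
qed

definition sol :: "complex \<Rightarrow> (4 \<Rightarrow> complex) \<Rightarrow> 4 \<Rightarrow> real \<Rightarrow> complex" where
  "sol \<xi> v i z = (\<Sum>k\<in>UNIV. v k * fund k i z \<xi>)"

lemma sol_init: "sol \<xi> v i (- H) = v i"
  by (simp add: sol_def fund(1) if_distrib[of "\<lambda>x. _ * x"] cong: if_cong)

lemma sol_ode: "ray_ode \<xi> (sol \<xi> v)"
  unfolding ray_ode_def
proof (intro ballI allI)
  fix z i assume z: "z \<in> {- H..0}"
  have "((\<lambda>z. \<Sum>k\<in>UNIV. v k * fund k i z \<xi>) has_vector_derivative
      (\<Sum>k\<in>UNIV. v k * (\<Sum>j\<in>UNIV. rcoeff i j z \<xi> * fund k j z \<xi>))) (at z within {- H..0})"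
    by (intro has_vector_derivative_sum has_vector_derivative_mult_right fund z)
  also have "(\<Sum>k\<in>UNIV. v k * (\<Sum>j\<in>UNIV. rcoeff i j z \<xi> * fund k j z \<xi>)) = (\<Sum>j\<in>UNIV. rcoeff i j z \<xi> * sol \<xi> v j z)"
    unfolding sol_def sum_distrib_left by (subst sum.swap) (simp add: mult_ac)
  finally show "(sol \<xi> v i has_vector_derivative (\<Sum>j\<in>UNIV. rcoeff i j z \<xi> * sol \<xi> v j z)) (at z within {- H..0})"
    unfolding sol_def[abs_def] .
qed

lemma sol_linear: "sol \<xi> (\<lambda>k. a * u k + b * v k) i z = a * sol \<xi> u i z + b * sol \<xi> v i z"
  by (simp add: sol_def sum.distrib sum_distrib_left algebra_simps)

text \<open>The end point b is variable because the Rayleigh system is imposed only for Z < 0: for a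
  Jost solution, uniqueness can be applied on {- H..b} with b < 0 but not up to the surface.\<close>

lemma ray_ode_unique_upto:
  assumes b: "b \<le> 0" and z: "z \<in> {- H..b}"
    and x: "\<And>i z. z \<in> {- H..b} \<Longrightarrow> (x i has_vector_derivative (\<Sum>j\<in>UNIV. rcoeff i j z \<xi> * x j z)) (at z within {- H..b})"
    and init: "\<And>i. x i (- H) = v i"
  shows "x i z = sol \<xi> v i z"
proof -
  have "\<forall>p. \<exists>C>0. \<forall>z\<in>{- H..0}. \<forall>w\<in>{\<xi>}. norm (rcoeff (fst p) (snd p) z w) \<le> C"
    using jholo_bounded[OF jholo_rcoeff[of UNIV], of "{\<xi>}"] by auto
  then obtain Mf where Mf: "\<And>p. Mf p > 0"
    "\<And>p z. z \<in> {- H..0} \<Longrightarrow> norm (rcoeff (fst p) (snd p) z \<xi>) \<le> Mf p" by (metis singletonI)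
  define m where "m = (\<Sum>p\<in>UNIV. Mf p)"
  have mi: "Mf p \<le> m" for p unfolding m_def by (rule member_le_sum) (auto simp: Mf(1) less_imp_le)
  have m: "norm (rcoeff i j z \<xi>) \<le> m" if "z \<in> {- H..b}" for i j z
    using Mf(2)[of z "(i, j)"] mi[of "(i, j)"] that b by simp
  show ?thesis
  proof (rule linear_ode_unique[where A = "\<lambda>i j z. rcoeff i j z \<xi>", OF x _ m z])
    show "(sol \<xi> v i has_vector_derivative (\<Sum>j\<in>UNIV. rcoeff i j z \<xi> * sol \<xi> v j z)) (at z within {- H..b})"
      if "z \<in> {- H..b}" for i z
      by (rule has_vector_derivative_within_subset[where S = "{- H..0}"])
        (use sol_ode[of \<xi> v] that b in \<open>auto simp: ray_ode_def\<close>)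
  qed (auto simp: init sol_init)
qed

lemma ray_ode_unique:
  assumes "ray_ode \<xi> x" "z \<in> {- H..0}"
  shows "x i z = sol \<xi> (\<lambda>i. x i (- H)) i z"
  by (rule ray_ode_unique_upto[OF order_refl assms(2)]) (use assms(1) in \<open>auto simp: ray_ode_def\<close>)

text \<open>Conjugation with diag (1, -1, 1, -1) carries the system at \<xi> into the system at -
  \<xi>.\<close>

definition flip :: "4 \<Rightarrow> complex" where
  "flip i = (if i = 1 \<or> i = 3 then 1 else - 1)"

lemma sol_uminus:
  assumes z: "z \<in> {- H..0}"
  shows "sol (- \<xi>) (\<lambda>i. flip i * v i) i z = flip i * sol \<xi> v i z"
proof -
  have "ray_ode (- \<xi>) (\<lambda>i z. flip i * sol \<xi> v i z)"
    unfolding ray_ode_def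
  proof (intro ballI allI)
    fix z i assume z: "z \<in> {- H..0}"
    have "((\<lambda>z. flip i * sol \<xi> v i z) has_vector_derivative flip i * (\<Sum>j\<in>UNIV. rcoeff i j z \<xi> * sol \<xi> v j z)) (at z within {- H..0})"
      by (rule has_vector_derivative_mult_right) (use sol_ode z in \<open>auto simp: ray_ode_def\<close>)
    moreover have "rcoeff i j z (- \<xi>) * flip j = flip i * rcoeff i j z \<xi>" for j
      using exhaust_4[of i] exhaust_4[of j] by (auto simp: ray_coeff_def flip_def Let_def)
    then have "flip i * (\<Sum>j\<in>UNIV. rcoeff i j z \<xi> * sol \<xi> v j z) = (\<Sum>j\<in>UNIV. rcoeff i j z (- \<xi>) * (flip j * sol \<xi> v j z))"
      unfolding sum_distrib_left by (intro sum.cong refl) (metis mult.assoc)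
    ultimately show "((\<lambda>z. flip i * sol \<xi> v i z) has_vector_derivative
        (\<Sum>j\<in>UNIV. rcoeff i j z (- \<xi>) * (flip j * sol \<xi> v j z))) (at z within {- H..0})" by simp
  qed
  from ray_ode_unique[OF this z, of i] show ?thesis by (simp add: sol_init)
qed

text \<open>Polarization and traction at depth \<open>- H\<close> of the Jost solution with exponential \<open>exp (l Z)\<close>,
  \<open>l\<^sup>2 = \<xi>\<^sup>2 - \<omega>\<^sup>2 / \<sigma>\<^sub>0\<close> resp. \<open>l\<^sup>2 = \<xi>\<^sup>2 - \<omega>\<^sup>2 / \<mu>\<^sub>0\<close>, up to the scalar \<open>exp (- l H)\<close>.\<close>

definition data_P :: "complex \<Rightarrow> complex \<Rightarrow> 4 \<Rightarrow> complex" where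
  "data_P \<xi> l i = (if i = 1 then - \<xi> else if i = 2 then l else if i = 3 then - 2 * of_real mu0 * \<xi> * l
     else 2 * of_real mu0 * \<xi>\<^sup>2 - of_real (\<omega>\<^sup>2))"

definition data_S :: "complex \<Rightarrow> complex \<Rightarrow> 4 \<Rightarrow> complex" where
  "data_S \<xi> l i = (if i = 1 then l else if i = 2 then - \<xi> else if i = 3 then 2 * of_real mu0 * \<xi>\<^sup>2 - of_real (\<omega>\<^sup>2)
     else - 2 * of_real mu0 * \<xi> * l)"

lemma data_P_uminus: "data_P (- \<xi>) l = (\<lambda>i. - (flip i * data_P \<xi> l i))"
  and data_S_uminus: "data_S (- \<xi>) l = (\<lambda>i. flip i * data_S \<xi> l i)"
  by (auto simp: fun_eq_iff data_P_def data_S_def flip_def forall_4)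

text \<open>The determinant of the two traction columns at the surface. Up to a factor without zeros
  it is the Rayleigh determinant, see \<open>rayleigh_det_tdet\<close>.\<close>

definition tdet :: "complex \<Rightarrow> (4 \<Rightarrow> complex) \<Rightarrow> (4 \<Rightarrow> complex) \<Rightarrow> complex" where
  "tdet \<xi> u v = sol \<xi> u 3 0 * sol \<xi> v 4 0 - sol \<xi> v 3 0 * sol \<xi> u 4 0"

lemma sol_data_uminus:
  "sol (- \<xi>) (data_P (- \<xi>) l) i 0 = - flip i * sol \<xi> (data_P \<xi> l) i 0"
  "sol (- \<xi>) (data_S (- \<xi>) l) i 0 = flip i * sol \<xi> (data_S \<xi> l) i 0"
proof -
  have 0: "0 \<in> {- H..0}" using H_pos by simp
  have "sol (- \<xi>) (\<lambda>i. - (flip i * data_P \<xi> l i)) i 0 = - sol (- \<xi>) (\<lambda>i. flip i * data_P \<xi> l i) i 0"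
    using sol_linear[of "- \<xi>" "-1" "\<lambda>i. flip i * data_P \<xi> l i" 0 "\<lambda>i. 0" i 0] by simp
  then show "sol (- \<xi>) (data_P (- \<xi>) l) i 0 = - flip i * sol \<xi> (data_P \<xi> l) i 0"
    unfolding data_P_uminus by (simp add: sol_uminus[OF 0])
  show "sol (- \<xi>) (data_S (- \<xi>) l) i 0 = flip i * sol \<xi> (data_S \<xi> l) i 0"
    unfolding data_S_uminus by (simp add: sol_uminus[OF 0])
qed

lemma tdet_uminus: "tdet (- \<xi>) (data_P (- \<xi>) l) (data_S (- \<xi>) l') = tdet \<xi> (data_P \<xi> l) (data_S \<xi> l')"
  unfolding tdet_def sol_data_uminus by (simp add: flip_def)

lemma tdet_parts:
  assumes "\<xi> \<noteq> 0"
  shows "tdet \<xi> u v = \<xi>\<^sup>2 / 2 * (plus_part \<xi> (sol \<xi> u) 1 0 * minus_part \<xi> (sol \<xi> v) 1 0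
     - plus_part \<xi> (sol \<xi> v) 1 0 * minus_part \<xi> (sol \<xi> u) 1 0)"
  using assms by (simp add: tdet_def plus_part_def minus_part_def power2_eq_square field_simps)

text \<open>The plus and minus parts of the Jost data with exponent \<open>\<xi> r\<close>, divided by \<open>\<xi>\<close>; here \<open>t = - 1\<close> stands for a
  P wave and \<open>t = 1\<close> for an S wave.\<close>

definition hplus :: "real \<Rightarrow> complex \<Rightarrow> 2 \<Rightarrow> complex \<Rightarrow> complex" where
  "hplus t r i w = (if i = 1 then of_real t * (2 * of_real mu0 * (1 + r) - of_real (\<omega>\<^sup>2) * w\<^sup>2)
     else - of_real (\<omega>\<^sup>2) / of_real mu0 * w)"

definition hminus :: "real \<Rightarrow> complex \<Rightarrow> 2 \<Rightarrow> complex \<Rightarrow> complex" where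
  "hminus t r i w = (if i = 1 then 2 * of_real mu0 * (1 - r) - of_real (\<omega>\<^sup>2) * w\<^sup>2
     else - of_real t * of_real (\<omega>\<^sup>2) / of_real mu0 * w)"

lemma mu0_pos: "mu0 > 0" and lam0_mu0_pos: "lam0 + mu0 > 0" and sg0_pos: "lam0 + 2 * mu0 > 0"
  using mu_pos[of "- H"] lam_mu_pos[of "- H"] lam_2mu_pos[of "- H"] const_le[of "- H"] H_pos by auto

lemma dm_init: "dm (- H) w = 0" "ddm (- H) w = 0"
  using is_deriv_dm is_deriv_ddm unfolding is_deriv_def by blast+

lemma cm_init: "cm (- H) w = 1 / of_real mu0"
  using const_le[of "- H"] by (simp add: cm_def divide_inverse)

lemma data_parts:
  assumes \<xi>: "\<xi> \<noteq> 0"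
    and y: "(\<forall>i. y i (- H) = data_P \<xi> (\<xi> * r) i) \<and> t = - 1 \<or> (\<forall>i. y i (- H) = data_S \<xi> (\<xi> * r) i) \<and> t = 1"
  shows "plus_part \<xi> y i (- H) = \<xi> * hplus t r i (1 / \<xi>)" "minus_part \<xi> y i (- H) = \<xi> * hminus t r i (1 / \<xi>)"
proof -
  have mu0: "complex_of_real mu0 \<noteq> 0" using mu0_pos by simp
  note s = plus_part_def minus_part_def hplus_def hminus_def cm_init dm_init data_P_def data_S_def
  have i: "i = 1 \<or> i = 2" using exhaust_2 by blast
  from y have "plus_part \<xi> y i (- H) = \<xi> * hplus t r i (1 / \<xi>) \<and> minus_part \<xi> y i (- H) = \<xi> * hminus t r i (1 / \<xi>)"
  proof
    assume "(\<forall>i. y i (- H) = data_P \<xi> (\<xi> * r) i) \<and> t = - 1"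
    then show ?thesis using i \<xi> mu0 by (auto simp: s field_simps power2_eq_square)
  next
    assume "(\<forall>i. y i (- H) = data_S \<xi> (\<xi> * r) i) \<and> t = 1"
    then show ?thesis using i \<xi> mu0 by (auto simp: s field_simps power2_eq_square)
  qed
  then show "plus_part \<xi> y i (- H) = \<xi> * hplus t r i (1 / \<xi>)" "minus_part \<xi> y i (- H) = \<xi> * hminus t r i (1 / \<xi>)"
    by auto
qed

text \<open>Below - H a Jost solution is a pure exponential, so its data are an eigenvector of the
  constant system with eigenvalue \<xi> r. At - H the terms with \<open>dm\<close> and
  \<open>ddm\<close> vanish, and the eigenvalue equation keeps its form in the block
  variables.\<close>

lemma data_eigen:
  assumes \<xi>w: "\<xi> * w = 1"
    and r: "t = - 1 \<and> r\<^sup>2 = 1 - of_real (\<omega>\<^sup>2 / (lam0 + 2 * mu0)) * w\<^sup>2 \<or> t = 1 \<and> r\<^sup>2 = 1 - of_real (\<omega>\<^sup>2 / mu0) * w\<^sup>2"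
  shows "\<xi> * r * hplus t r i w = \<xi> * hplus t r i w + (\<Sum>j\<in>UNIV. blockA i j (- H) w * hplus t r j w)
       + (\<Sum>j\<in>UNIV. blockB i j (- H) w * hminus t r j w)"
    "\<xi> * r * hminus t r i w = - \<xi> * hminus t r i w + (\<Sum>j\<in>UNIV. blockC i j (- H) w * hplus t r j w)
       + (\<Sum>j\<in>UNIV. blockD i j (- H) w * hminus t r j w)"
proof -
  define m n k \<mu> where "m = cm (- H) w" and "n = cn (- H) w" and "k = ck (- H) w" and "\<mu> = complex_of_real mu0"
  have mu0: "\<mu> \<noteq> 0" using mu0_pos by (simp add: \<mu>_def)
  have mm: "m = 1 / \<mu>" by (simp add: m_def \<mu>_def cm_init)
  have m\<mu>: "m * \<mu> = 1" using mu0 by (simp add: mm)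
  have nz: "m \<noteq> 0" "n \<noteq> 0" "m + n \<noteq> 0" using cm_nz cn_nz cmn_nz H_pos by (auto simp: m_def n_def)
  have k: "k * (m + n) = 1" using nz(3) by (simp add: k_def ck_def m_def n_def)
  have nl: "n * (complex_of_real lam0 + \<mu>) = 1"
    using const_le[of "- H"] lame_nonzero(2)[of "- H"] H_pos by (simp add: n_def cn_def \<mu>_def)
  have om: "of_real (\<omega>\<^sup>2) = 2 * q" by (simp add: q_def)
  have sg: "1 / (complex_of_real lam0 + 2 * \<mu>) = m * n * k"
  proof -
    have "(complex_of_real lam0 + 2 * \<mu>) * (m * n * k) = 1" using m\<mu> nl k by algebra
    then show ?thesis by (metis divide_eq_eq mult.commute mult_zero_left zero_neq_one)
  qed
  have r': "t = - 1 \<and> r\<^sup>2 = 1 - 2 * q * (m * n * k) * w\<^sup>2 \<or> t = 1 \<and> r\<^sup>2 = 1 - 2 * q * m * w\<^sup>2"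
  proof -
    have "complex_of_real (\<omega>\<^sup>2 / (lam0 + 2 * mu0)) = 2 * q * (1 / (complex_of_real lam0 + 2 * \<mu>))"
      "complex_of_real (\<omega>\<^sup>2 / mu0) = 2 * q * m"
      by (simp_all add: om[symmetric] mm \<mu>_def)
    then show ?thesis using r unfolding sg by simp
  qed
  have bl: "blockA 1 1 (- H) w = - q * w * m" "blockA 1 2 (- H) w = k" "blockA 2 1 (- H) w = 0" "blockA 2 2 (- H) w = - q * m * w"
    "blockB 1 1 (- H) w = 0" "blockB 1 2 (- H) w = - k + q * w * w" "blockB 2 1 (- H) w = q * m * m" "blockB 2 2 (- H) w = 0"
    "blockC 1 1 (- H) w = 0" "blockC 1 2 (- H) w = k - q * w * w" "blockC 2 1 (- H) w = - q * m * m" "blockC 2 2 (- H) w = 0"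
    "blockD 1 1 (- H) w = q * w * m" "blockD 1 2 (- H) w = - k" "blockD 2 1 (- H) w = 0" "blockD 2 2 (- H) w = q * m * w"
    by (simp_all add: blockA_def blockB_def blockC_def blockD_def Let_def dm_init m_def k_def)
  have hh: "hplus t r 1 w = of_real t * (2 * \<mu> * (1 + r) - 2 * q * w\<^sup>2)" "hplus t r 2 w = - 2 * q * m * w"
    "hminus t r 1 w = 2 * \<mu> * (1 - r) - 2 * q * w\<^sup>2" "hminus t r 2 w = - of_real t * (2 * q * m) * w"
    unfolding hplus_def hminus_def om mm \<mu>_def by simp_all
  have \<xi>w2: "\<xi> * w\<^sup>2 = w" using \<xi>w by (simp add: power2_eq_square mult.assoc[symmetric])
  have nk: "n * k = 1 - k * m" using k by (simp add: algebra_simps)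
  \<comment> \<open>F1 and F2 are the dispersion relations of P and S waves times \<mu> \<xi>. The
    eight identities below are explicit combinations of them and of \<xi> w = 1, \<xi> w^2 = w and m
    \<mu> = 1.\<close>
  have F1: "\<mu> * \<xi> * r\<^sup>2 - \<mu> * \<xi> + 2 * q * (1 - k * m) * w = 0" if r2: "r\<^sup>2 = 1 - 2 * q * (m * n * k) * w\<^sup>2"
  proof -
    have "\<mu> * \<xi> * (r\<^sup>2 - 1) = - 2 * q * (m * \<mu>) * (n * k) * (\<xi> * w) * w"
      unfolding r2 by (simp add: power2_eq_square)
    then show ?thesis unfolding m\<mu> \<xi>w nk by (simp add: algebra_simps)
  qed
  have F2: "\<mu> * \<xi> * r\<^sup>2 - \<mu> * \<xi> + 2 * q * w = 0" if r2: "r\<^sup>2 = 1 - 2 * q * m * w\<^sup>2"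
  proof -
    have "\<mu> * \<xi> * (r\<^sup>2 - 1) = - 2 * q * (m * \<mu>) * (\<xi> * w) * w"
      unfolding r2 by (simp add: power2_eq_square)
    then show ?thesis unfolding m\<mu> \<xi>w by (simp add: algebra_simps)
  qed
  have e1: "\<xi> * r * hplus t r 1 w = \<xi> * hplus t r 1 w + (\<Sum>j\<in>UNIV. blockA 1 j (- H) w * hplus t r j w)
       + (\<Sum>j\<in>UNIV. blockB 1 j (- H) w * hminus t r j w)"
    using r'
  proof
    assume "t = - 1 \<and> r\<^sup>2 = 1 - 2 * q * (m * n * k) * w\<^sup>2"
    then have t: "complex_of_real t = - 1" and r2: "r\<^sup>2 = 1 - 2 * q * (m * n * k) * w\<^sup>2" by auto
    have "(\<xi> * r * hplus t r 1 w) - (\<xi> * hplus t r 1 w + (\<Sum>j\<in>UNIV. blockA 1 j (- H) w * hplus t r j w)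
       + (\<Sum>j\<in>UNIV. blockB 1 j (- H) w * hminus t r j w))
       = - 2 * (\<mu> * \<xi> * r\<^sup>2 - \<mu> * \<xi> + 2 * q * (1 - k * m) * w) + 2 * q * (r - 1) * (\<xi> * w\<^sup>2 - w) - 2 * q * w * (1 + r) * (m * \<mu> - 1)"
      unfolding sum_2 bl hh t by (simp add: algebra_simps power2_eq_square)
    then show ?thesis unfolding F1[OF r2] \<xi>w2 \<xi>w m\<mu> by simp
  next
    assume "t = 1 \<and> r\<^sup>2 = 1 - 2 * q * m * w\<^sup>2"
    then have t: "complex_of_real t = 1" and r2: "r\<^sup>2 = 1 - 2 * q * m * w\<^sup>2" by auto
    have "(\<xi> * r * hplus t r 1 w) - (\<xi> * hplus t r 1 w + (\<Sum>j\<in>UNIV. blockA 1 j (- H) w * hplus t r j w)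
       + (\<Sum>j\<in>UNIV. blockB 1 j (- H) w * hminus t r j w))
       = 2 * (\<mu> * \<xi> * r\<^sup>2 - \<mu> * \<xi> + 2 * q * w) - 2 * q * (r - 1) * (\<xi> * w\<^sup>2 - w) + 2 * q * w * (1 + r) * (m * \<mu> - 1)"
      unfolding sum_2 bl hh t by (simp add: algebra_simps power2_eq_square)
    then show ?thesis unfolding F2[OF r2] \<xi>w2 \<xi>w m\<mu> by simp
  qed
  have e2: "\<xi> * r * hplus t r 2 w = \<xi> * hplus t r 2 w + (\<Sum>j\<in>UNIV. blockA 2 j (- H) w * hplus t r j w)
       + (\<Sum>j\<in>UNIV. blockB 2 j (- H) w * hminus t r j w)"
    using r'
  proof
    assume "t = - 1 \<and> r\<^sup>2 = 1 - 2 * q * (m * n * k) * w\<^sup>2"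
    then have t: "complex_of_real t = - 1" and r2: "r\<^sup>2 = 1 - 2 * q * (m * n * k) * w\<^sup>2" by auto
    have "(\<xi> * r * hplus t r 2 w) - (\<xi> * hplus t r 2 w + (\<Sum>j\<in>UNIV. blockA 2 j (- H) w * hplus t r j w)
       + (\<Sum>j\<in>UNIV. blockB 2 j (- H) w * hminus t r j w))
       = - 2 * q * m * (r - 1) * (\<xi> * w - 1) - 2 * q * m * (1 - r) * (m * \<mu> - 1)"
      unfolding sum_2 bl hh t by (simp add: algebra_simps power2_eq_square)
    then show ?thesis unfolding F1[OF r2] \<xi>w2 \<xi>w m\<mu> by simp
  next
    assume "t = 1 \<and> r\<^sup>2 = 1 - 2 * q * m * w\<^sup>2"
    then have t: "complex_of_real t = 1" and r2: "r\<^sup>2 = 1 - 2 * q * m * w\<^sup>2" by auto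
    have "(\<xi> * r * hplus t r 2 w) - (\<xi> * hplus t r 2 w + (\<Sum>j\<in>UNIV. blockA 2 j (- H) w * hplus t r j w)
       + (\<Sum>j\<in>UNIV. blockB 2 j (- H) w * hminus t r j w))
       = - 2 * q * m * (r - 1) * (\<xi> * w - 1) - 2 * q * m * (1 - r) * (m * \<mu> - 1)"
      unfolding sum_2 bl hh t by (simp add: algebra_simps power2_eq_square)
    then show ?thesis unfolding F2[OF r2] \<xi>w2 \<xi>w m\<mu> by simp
  qed
  have e3: "\<xi> * r * hminus t r 1 w = - \<xi> * hminus t r 1 w + (\<Sum>j\<in>UNIV. blockC 1 j (- H) w * hplus t r j w)
       + (\<Sum>j\<in>UNIV. blockD 1 j (- H) w * hminus t r j w)"
    using r'
  proof
    assume "t = - 1 \<and> r\<^sup>2 = 1 - 2 * q * (m * n * k) * w\<^sup>2"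
    then have t: "complex_of_real t = - 1" and r2: "r\<^sup>2 = 1 - 2 * q * (m * n * k) * w\<^sup>2" by auto
    have "(\<xi> * r * hminus t r 1 w) - (- \<xi> * hminus t r 1 w + (\<Sum>j\<in>UNIV. blockC 1 j (- H) w * hplus t r j w)
       + (\<Sum>j\<in>UNIV. blockD 1 j (- H) w * hminus t r j w))
       = - 2 * (\<mu> * \<xi> * r\<^sup>2 - \<mu> * \<xi> + 2 * q * (1 - k * m) * w) - 2 * q * (1 + r) * (\<xi> * w\<^sup>2 - w) - 2 * q * w * (1 - r) * (m * \<mu> - 1)"
      unfolding sum_2 bl hh t by (simp add: algebra_simps power2_eq_square)
    then show ?thesis unfolding F1[OF r2] \<xi>w2 \<xi>w m\<mu> by simp
  next
    assume "t = 1 \<and> r\<^sup>2 = 1 - 2 * q * m * w\<^sup>2"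
    then have t: "complex_of_real t = 1" and r2: "r\<^sup>2 = 1 - 2 * q * m * w\<^sup>2" by auto
    have "(\<xi> * r * hminus t r 1 w) - (- \<xi> * hminus t r 1 w + (\<Sum>j\<in>UNIV. blockC 1 j (- H) w * hplus t r j w)
       + (\<Sum>j\<in>UNIV. blockD 1 j (- H) w * hminus t r j w))
       = - 2 * (\<mu> * \<xi> * r\<^sup>2 - \<mu> * \<xi> + 2 * q * w) - 2 * q * (1 + r) * (\<xi> * w\<^sup>2 - w) - 2 * q * w * (1 - r) * (m * \<mu> - 1)"
      unfolding sum_2 bl hh t by (simp add: algebra_simps power2_eq_square)
    then show ?thesis unfolding F2[OF r2] \<xi>w2 \<xi>w m\<mu> by simp
  qed
  have e4: "\<xi> * r * hminus t r 2 w = - \<xi> * hminus t r 2 w + (\<Sum>j\<in>UNIV. blockC 2 j (- H) w * hplus t r j w)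
       + (\<Sum>j\<in>UNIV. blockD 2 j (- H) w * hminus t r j w)"
    using r'
  proof
    assume "t = - 1 \<and> r\<^sup>2 = 1 - 2 * q * (m * n * k) * w\<^sup>2"
    then have t: "complex_of_real t = - 1" and r2: "r\<^sup>2 = 1 - 2 * q * (m * n * k) * w\<^sup>2" by auto
    have "(\<xi> * r * hminus t r 2 w) - (- \<xi> * hminus t r 2 w + (\<Sum>j\<in>UNIV. blockC 2 j (- H) w * hplus t r j w)
       + (\<Sum>j\<in>UNIV. blockD 2 j (- H) w * hminus t r j w))
       = 2 * q * m * (1 + r) * (\<xi> * w - 1) - 2 * q * m * (1 + r) * (m * \<mu> - 1)"
      unfolding sum_2 bl hh t by (simp add: algebra_simps power2_eq_square)
    then show ?thesis unfolding F1[OF r2] \<xi>w2 \<xi>w m\<mu> by simp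
  next
    assume "t = 1 \<and> r\<^sup>2 = 1 - 2 * q * m * w\<^sup>2"
    then have t: "complex_of_real t = 1" and r2: "r\<^sup>2 = 1 - 2 * q * m * w\<^sup>2" by auto
    have "(\<xi> * r * hminus t r 2 w) - (- \<xi> * hminus t r 2 w + (\<Sum>j\<in>UNIV. blockC 2 j (- H) w * hplus t r j w)
       + (\<Sum>j\<in>UNIV. blockD 2 j (- H) w * hminus t r j w))
       = - 2 * q * m * (1 + r) * (\<xi> * w - 1) + 2 * q * m * (1 + r) * (m * \<mu> - 1)"
      unfolding sum_2 bl hh t by (simp add: algebra_simps power2_eq_square)
    then show ?thesis unfolding F2[OF r2] \<xi>w2 \<xi>w m\<mu> by simp
  qed
  show "\<xi> * r * hplus t r i w = \<xi> * hplus t r i w + (\<Sum>j\<in>UNIV. blockA i j (- H) w * hplus t r j w)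
       + (\<Sum>j\<in>UNIV. blockB i j (- H) w * hminus t r j w)"
    "\<xi> * r * hminus t r i w = - \<xi> * hminus t r i w + (\<Sum>j\<in>UNIV. blockC i j (- H) w * hplus t r j w)
       + (\<Sum>j\<in>UNIV. blockD i j (- H) w * hminus t r j w)"
    using e1 e2 e3 e4 exhaust_2[of i] by auto
qed

end

section \<open>Lower bounds for scalar equations and for holomorphic functions\<close>

lemma gronwall_lower:
  fixes g :: "real \<Rightarrow> complex"
  assumes ab: "a \<le> b"
    and g: "\<And>z. z \<in> {a..b} \<Longrightarrow> (g has_vector_derivative \<tau> z * g z) (at z within {a..b})"
    and \<tau>: "\<And>z. z \<in> {a..b} \<Longrightarrow> norm (\<tau> z) \<le> M" and M: "M \<ge> 0"
  shows "norm (g a) \<le> norm (g b) * exp ((M + 1/2) * (b - a))"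
proof -
  \<comment> \<open>Gronwall in the reversed variable: a solution that is large at a cannot have
    become small at b.\<close>
  have "norm (g (- (- a))) \<le> (norm (g (- (- b))) + 0) * exp ((M + 1/2) * (- a - - b))"
  proof (rule gronwall_norm[where e = "\<lambda>z. g (- z)" and e' = "\<lambda>z. - (\<tau> (- z) * g (- z))"])
    show "((\<lambda>z. g (- z)) has_vector_derivative - (\<tau> (- z) * g (- z))) (at z within {- b..- a})" if z: "z \<in> {- b..- a}" for z
    proof -
      have im: "uminus ` {- b..- a} = {a..b}" by force
      have "(uminus has_vector_derivative (- 1 :: real)) (at z within {- b..- a})"
        by (auto intro!: derivative_eq_intros simp: has_vector_derivative_def)
      moreover have "(g has_vector_derivative \<tau> (- z) * g (- z)) (at (- z) within uminus ` {- b..- a})"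
        unfolding im by (rule g) (use z in auto)
      ultimately have "(g \<circ> uminus has_vector_derivative (- 1) *\<^sub>R (\<tau> (- z) * g (- z))) (at z within {- b..- a})"
        by (rule vector_diff_chain_within)
      then show ?thesis by (simp add: o_def)
    qed
    show "g (- z) \<bullet> - (\<tau> (- z) * g (- z)) \<le> M * (norm (g (- z)))\<^sup>2 + 0 * norm (g (- z))" if z: "z \<in> {- b..- a}" for z
    proof -
      have "g (- z) \<bullet> - (\<tau> (- z) * g (- z)) \<le> norm (g (- z)) * norm (- (\<tau> (- z) * g (- z)))"
        by (rule norm_cauchy_schwarz)
      also have "\<dots> = norm (\<tau> (- z)) * (norm (g (- z)))\<^sup>2"
        by (simp add: norm_mult power2_eq_square)
      also have "\<dots> \<le> M * (norm (g (- z)))\<^sup>2" by (intro mult_right_mono \<tau>) (use z in auto)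
      finally show ?thesis by simp
    qed
  qed (use ab M in auto)
  then show ?thesis by simp
qed

lemma cross_product_error:
  fixes a b a' b' x y x' y' :: complex
  assumes "norm (a - x) \<le> e" "norm (b - y) \<le> e" "norm (a' - x') \<le> e" "norm (b' - y') \<le> e"
    and "norm x \<le> K" "norm y \<le> K" "norm x' \<le> K" "norm y' \<le> K" and e: "0 \<le> e"
  shows "norm ((a * b' - a' * b) - (x * y' - x' * y)) \<le> 4 * K * e + 2 * e\<^sup>2"
proof -
  have K: "0 \<le> K" using assms(5) norm_ge_zero order_trans by blast
  have p: "norm (u * v - s * t) \<le> 2 * K * e + e\<^sup>2"
    if "norm (u - s) \<le> e" "norm (v - t) \<le> e" "norm s \<le> K" "norm t \<le> K" for u v s t :: complex
  proof -
    have "u * v - s * t = s * (v - t) + (u - s) * t + (u - s) * (v - t)" by (simp add: algebra_simps)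
    moreover have "norm (s * (v - t)) \<le> K * e" "norm ((u - s) * t) \<le> e * K" "norm ((u - s) * (v - t)) \<le> e * e"
      unfolding norm_mult using that e K by (intro mult_mono; simp)+
    ultimately show ?thesis
      using norm_triangle_mono[OF norm_triangle_mono[of "s * (v - t)" "K * e" "(u - s) * t" "e * K"], of "(u - s) * (v - t)" "e * e"]
      by (simp add: power2_eq_square algebra_simps)
  qed
  have "norm ((a * b' - a' * b) - (x * y' - x' * y)) = norm ((a * b' - x * y') - (a' * b - x' * y))"
    by (simp add: algebra_simps)
  also have "\<dots> \<le> norm (a * b' - x * y') + norm (a' * b - x' * y)" by (rule norm_triangle_ineq4)
  also have "\<dots> \<le> (2 * K * e + e\<^sup>2) + (2 * K * e + e\<^sup>2)"
    by (intro add_mono p assms)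
  finally show ?thesis by simp
qed

text \<open>Near 0 either d is bounded away from 0 or d w = w^n g w with g 0 nonzero. The bound on
  the ray forces n \<le> N, and the factorisation then gives the bound in every direction.\<close>

lemma holomorphic_lower_bound_from_ray:
  assumes hol: "d holomorphic_on ball 0 \<epsilon>" and \<epsilon>: "\<epsilon> > 0" and c: "c > 0"
    and ray: "\<And>t. t \<ge> t0 \<Longrightarrow> norm (d (1 / (\<i> * of_real t))) \<ge> c * (1 / t) ^ N"
  obtains c' \<epsilon>' where "c' > 0" "\<epsilon>' > 0" "\<And>w. norm w < \<epsilon>' \<Longrightarrow> norm (d w) \<ge> c' * norm w ^ N"
proof -
  define t1 where "t1 = max (max t0 1) (2 / \<epsilon>)"
  have t1: "t1 \<ge> t0" "t1 \<ge> 1" "t1 \<ge> 2 / \<epsilon>" by (auto simp: t1_def)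
  have nw: "norm (1 / (\<i> * complex_of_real t)) = 1 / t" if "t \<ge> 1" for t
    using that by (simp add: norm_divide norm_mult)
  have inb: "1 / (\<i> * complex_of_real t) \<in> ball 0 \<epsilon>" if "t \<ge> t1" for t
  proof -
    have t: "t \<ge> 1" "t \<ge> 2 / \<epsilon>" using t1 that by linarith+
    then have "1 / t < \<epsilon>" using \<epsilon> by (simp add: field_simps)
    with nw[OF t(1)] show ?thesis by simp
  qed
  show thesis
  proof (cases "d 0 = 0")
    case False
    have "continuous (at 0) d"
      using holomorphic_on_imp_continuous_on[OF hol] \<epsilon>
      by (simp add: continuous_on_eq_continuous_at)
    then obtain r where r: "r > 0" "\<And>w. norm w < r \<Longrightarrow> norm (d w - d 0) < norm (d 0) / 2"
      using False unfolding continuous_at_eps_delta dist_norm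
      by (metis diff_zero half_gt_zero zero_less_norm_iff)
    show thesis
    proof (rule that[of "norm (d 0) / 2" "min r 1"])
      fix w :: complex assume w: "norm w < min r 1"
      have "norm (d 0) / 2 \<le> norm (d w)"
        using r(2)[of w] w norm_triangle_ineq2[of "d 0" "d w"] by (simp add: norm_minus_commute)
      moreover have "norm w ^ N \<le> 1" using w by (intro power_le_one) auto
      then have "norm (d 0) / 2 * norm w ^ N \<le> norm (d 0) / 2 * 1" by (intro mult_left_mono) auto
      ultimately show "norm (d 0) / 2 * norm w ^ N \<le> norm (d w)" by linarith
    qed (use False r in auto)
  next
    case True
    have nonconst: "\<not> d constant_on ball 0 \<epsilon>"
    proof
      assume "d constant_on ball 0 \<epsilon>"
      then have "d (1 / (\<i> * of_real t1)) = d 0" using inb[of t1] \<epsilon> unfolding constant_on_def by auto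
      with True ray[OF t1(1)] have "c * (1 / t1) ^ N \<le> 0" by simp
      moreover have "c * (1 / t1) ^ N > 0" using c t1(2) by (intro mult_pos_pos zero_less_power) auto
      ultimately show False by linarith
    qed
    obtain g r n where g: "0 < n" "0 < r" "ball (0::complex) r \<subseteq> ball 0 \<epsilon>" "g holomorphic_on ball 0 r"
      "\<And>w. w \<in> ball 0 r \<Longrightarrow> d w = (w - 0) ^ n * g w" "\<And>w. w \<in> ball 0 r \<Longrightarrow> g w \<noteq> 0"
    proof (rule holomorphic_factor_zero_nonconstant[OF hol open_ball connected_ball _ True nonconst])
      show "0 \<in> ball (0::complex) \<epsilon>" using \<epsilon> by simp
    qed (rule that)
    have g0: "g 0 \<noteq> 0" using g by auto
    have "continuous (at 0) g"
      using holomorphic_on_imp_continuous_on[OF g(4)] g(2)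
      by (simp add: continuous_on_eq_continuous_at)
    then obtain s where s: "s > 0" "\<And>w. norm w < s \<Longrightarrow> norm (g w - g 0) < norm (g 0) / 2"
      using g0 unfolding continuous_at_eps_delta dist_norm
      by (metis diff_zero half_gt_zero zero_less_norm_iff)
    define \<epsilon>' where "\<epsilon>' = min (min r s) 1"
    have \<epsilon>': "\<epsilon>' > 0" "\<epsilon>' \<le> r" "\<epsilon>' \<le> s" "\<epsilon>' \<le> 1" using g s by (auto simp: \<epsilon>'_def)
    have gb: "norm (g 0) / 2 \<le> norm (g w)" "norm (g w) \<le> 2 * norm (g 0)" if "norm w < \<epsilon>'" for w
      using s(2)[of w] that \<epsilon>' norm_triangle_ineq2[of "g 0" "g w"] norm_triangle_ineq2[of "g w" "g 0"] norm_ge_zero[of "g 0"]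
      by (auto simp: norm_minus_commute simp del: norm_ge_zero)
    have "n \<le> N"
    proof (rule ccontr)
      assume "\<not> n \<le> N"
      then obtain l where l: "n = N + Suc l" by (metis add_Suc_right less_imp_Suc_add not_le)
      \<comment> \<open>At this t an order n > N would give c t \<le> 2 |g 0|, whereas c t \<ge> 4
        |g 0| > 0.\<close>
      define t where "t = max (max t1 (2 / \<epsilon>')) (4 * norm (g 0) / c)"
      have t: "t \<ge> t1" "t \<ge> 2 / \<epsilon>'" "t \<ge> 4 * norm (g 0) / c" by (auto simp: t_def)
      have tp: "t \<ge> 1" using t t1 by linarith
      define w where "w = 1 / (\<i> * complex_of_real t)"
      have nwt: "norm w = 1 / t" using nw[OF tp] by (simp add: w_def)
      have we: "norm w < \<epsilon>'" unfolding nwt using t(2) \<epsilon>'(1) tp by (simp add: field_simps)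
      have "c * (1 / t) ^ N \<le> norm (d w)" using ray[of t] t(1) t1(1) by (simp add: w_def)
      also have "norm (d w) = (1 / t) ^ n * norm (g w)"
        using g(5)[of w] we \<epsilon>'(2) by (simp add: norm_mult norm_power nwt)
      also have "\<dots> \<le> (1 / t) ^ n * (2 * norm (g 0))"
        using gb(2)[OF we] tp by (intro mult_left_mono) auto
      also have "\<dots> = (1 / t) ^ N * ((1 / t) ^ Suc l * (2 * norm (g 0)))" by (simp add: l power_add)
      also have "\<dots> \<le> (1 / t) ^ N * ((1 / t) * (2 * norm (g 0)))"
      proof (intro mult_left_mono mult_right_mono)
        show "(1 / t) ^ Suc l \<le> 1 / t" using power_decreasing[of 1 "Suc l" "1 / t"] tp by simp
      qed (use tp in auto)
      finally have "(1 / t) ^ N * c \<le> (1 / t) ^ N * ((1 / t) * (2 * norm (g 0)))" by (simp only: mult.commute)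
      moreover have "(1 / t) ^ N > 0" using tp by simp
      ultimately have "c \<le> (1 / t) * (2 * norm (g 0))" by (simp only: mult_le_cancel_left_pos)
      then have "c * t \<le> 2 * norm (g 0)" using tp by (simp add: field_simps)
      moreover have "4 * norm (g 0) \<le> c * t" using t(3) c by (simp add: field_simps)
      moreover have "norm (g 0) > 0" using g0 by simp
      ultimately show False by linarith
    qed
    show thesis
    proof (rule that[of "norm (g 0) / 2" \<epsilon>'])
      fix w :: complex assume w: "norm w < \<epsilon>'"
      have "norm w ^ N \<le> norm w ^ n" using w \<epsilon>' \<open>n \<le> N\<close> by (intro power_decreasing) auto
      then have "norm (g 0) / 2 * norm w ^ N \<le> norm (g w) * norm w ^ n"
        using gb(1)[OF w] by (intro mult_mono) auto
      also have "\<dots> = norm (d w)" using g(5)[of w] w \<epsilon>'(2) by (simp add: norm_mult norm_power)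
      finally show "norm (g 0) / 2 * norm w ^ N \<le> norm (d w)" .
    qed (use g0 \<epsilon>' in auto)
  qed
qed

section \<open>Energy flux on the imaginary axis\<close>

context slab
begin

text \<open>On the imaginary axis \<xi>^2 is real and cnj \<xi> = - \<xi>. The first makes the
  self-couplings real; the second dictates the minus sign between the horizontal and the vertical
  term, since with this sign the mixed terms have no imaginary part.\<close>

lemma flux_conserved:
  assumes t: "t \<noteq> 0" and y: "ray_ode (\<i> * of_real t) y"
  shows "Im (y 1 0 * cnj (y 3 0) - y 2 0 * cnj (y 4 0)) = Im (y 1 (- H) * cnj (y 3 (- H)) - y 2 (- H) * cnj (y 4 (- H)))"
proof -
  define \<xi> where "\<xi> = \<i> * complex_of_real t"
  define f where "f z = Im (y 1 z * cnj (y 3 z) - y 2 z * cnj (y 4 z))" for z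
  have df: "(f has_vector_derivative 0) (at z within {- H..0})" if z: "z \<in> {- H..0}" for z
  proof -
    have dy: "(y i has_vector_derivative (\<Sum>j\<in>UNIV. rcoeff i j z \<xi> * y j z)) (at z within {- H..0})" for i
      using y z unfolding ray_ode_def \<xi>_def by blast
    note d = bounded_linear.has_vector_derivative[OF bounded_linear_cnj dy]
    define D where "D i = (\<Sum>j\<in>UNIV. rcoeff i j z \<xi> * y j z)" for i
    have "((\<lambda>z. y 1 z * cnj (y 3 z) - y 2 z * cnj (y 4 z)) has_vector_derivative
        (y 1 z * cnj (D 3) + D 1 * cnj (y 3 z)) - (y 2 z * cnj (D 4) + D 2 * cnj (y 4 z))) (at z within {- H..0})"
      unfolding D_def by (intro has_vector_derivative_diff has_vector_derivative_mult dy d)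
    from bounded_linear.has_vector_derivative[OF bounded_linear_Im this]
    have "(f has_vector_derivative Im ((y 1 z * cnj (D 3) + D 1 * cnj (y 3 z)) - (y 2 z * cnj (D 4) + D 2 * cnj (y 4 z)))) (at z within {- H..0})"
      unfolding f_def[abs_def] .
    moreover have "Im ((y 1 z * cnj (D 3) + D 1 * cnj (y 3 z)) - (y 2 z * cnj (D 4) + D 2 * cnj (y 4 z))) = 0"
    proof -
      define m where "m = 1 / mu z"
      define s where "s = 1 / (lam z + 2 * mu z)"
      define l where "l = lam z * s"
      define \<gamma> where "\<gamma> = - (t\<^sup>2 * (lam z + 2 * mu z - lam z * l)) - \<omega>\<^sup>2"
      have e1: "1 / complex_of_real (mu z) = of_real m" by (simp add: m_def)
      have e2: "u / (complex_of_real (lam z) + 2 * complex_of_real (mu z)) = u * of_real s" for u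
        by (simp add: s_def)
      have "\<xi>\<^sup>2 = - of_real (t\<^sup>2)" by (simp add: \<xi>_def power_mult_distrib)
      then have e3: "\<xi>\<^sup>2 * (complex_of_real (lam z) + 2 * complex_of_real (mu z) - (complex_of_real (lam z))\<^sup>2 * of_real s) - of_real (\<omega>\<^sup>2)
          = of_real \<gamma>"
        by (simp add: \<gamma>_def l_def power2_eq_square)
      have e4: "x * complex_of_real (lam z) * of_real s = x * of_real l" for x by (simp add: l_def)
      have D1: "D 1 = \<xi> * y 2 z + of_real m * y 3 z"
        unfolding D_def sum_4 ray_coeff_def Let_def e1 by simp
      have D2: "D 2 = - \<xi> * of_real l * y 1 z + of_real s * y 4 z"
        unfolding D_def sum_4 ray_coeff_def Let_def e2 e4 by simp
      have D3: "D 3 = of_real \<gamma> * y 1 z + \<xi> * of_real l * y 4 z"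
        unfolding D_def sum_4 ray_coeff_def Let_def e2 e3 e4 by simp
      have D4: "D 4 = - of_real (\<omega>\<^sup>2) * y 2 z - \<xi> * y 3 z"
        unfolding D_def sum_4 ray_coeff_def Let_def by simp
      show ?thesis unfolding D1 D2 D3 D4 \<xi>_def by (simp add: algebra_simps)
    qed
    ultimately show ?thesis by simp
  qed
  have "f 0 = f (- H)"
    by (rule has_derivative_zero_unique[of "{- H..0}"])
      (use df H_pos in \<open>auto simp: has_vector_derivative_def\<close>)
  then show ?thesis by (simp add: f_def)
qed

text \<open>The mixed terms in c1 and c2 cancel and the flux is diagonal. The formula also holds
  with - rS for rS, where it is indefinite; so the flux separates the sheets with opposite exponents
  from those with equal ones.\<close>

lemma flux_initial:
  fixes t rP rS :: real
  assumes v: "\<And>i. v i = c1 * data_P (\<i> * of_real t) (\<i> * of_real t * of_real rP) i + c2 * data_S (\<i> * of_real t) (- (\<i> * of_real t * of_real rS)) i"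
  shows "Im (v 1 * cnj (v 3) - v 2 * cnj (v 4)) = t * \<omega>\<^sup>2 * (rP * (norm c1)\<^sup>2 + rS * (norm c2)\<^sup>2)"
proof -
  define D where "D = 2 * mu0 * t\<^sup>2 + \<omega>\<^sup>2"
  define E where "E = 2 * mu0 * t\<^sup>2"
  have v1: "v 1 = - \<i> * of_real t * (c1 + of_real rS * c2)"
    unfolding v by (simp add: data_P_def data_S_def algebra_simps)
  have v2: "v 2 = \<i> * of_real t * (of_real rP * c1 - c2)"
    unfolding v by (simp add: data_P_def data_S_def algebra_simps)
  have v3: "v 3 = of_real (E * rP) * c1 - of_real D * c2"
    unfolding v by (simp add: data_P_def data_S_def D_def E_def power2_eq_square algebra_simps)
  have v4: "v 4 = - of_real D * c1 - of_real (E * rS) * c2"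
    unfolding v by (simp add: data_P_def data_S_def D_def E_def power2_eq_square algebra_simps)
  have om: "\<omega>\<^sup>2 = D - E" by (simp add: D_def E_def)
  show ?thesis
    unfolding v1 v2 v3 v4 cmod_power2 om by (simp add: power2_eq_square algebra_simps)
qed

end

section \<open>Expansion of the Jost columns\<close>

lemma jholo_bounded_cball_1:
  assumes "jholo a b UNIV f" shows "\<exists>C>0. \<forall>z\<in>{a..b}. \<forall>w. norm w \<le> 1 \<longrightarrow> norm (f z w) \<le> C"
  using jholo_bounded[OF assms compact_cball[of 0 1]] by auto

context slab_graph
begin

text \<open>S' vanishes at - H, so there the graph is an approximately invariant subspace of a
  constant matrix. For an eigenvector (p, m), the deviation \<delta> = m - S p satisfies \<xi> (1 +
  r) \<delta> = (D - S B) \<delta> + w^14 R p. Since Re r \<ge> 0, the factor |1 + r| is at least 1,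
  and for large \<xi> the bounded coefficients are absorbed on the left.\<close>

lemma init_graph:
  assumes \<xi>w: "\<xi> * w = 1" and \<xi>: "norm \<xi> \<ge> 1" "norm \<xi> \<ge> 4 * (M + 2 * M * M)" and r: "Re r \<ge> 0"
    and e1: "\<And>i. \<xi> * r * p i = \<xi> * p i + (\<Sum>j\<in>UNIV. blockA i j (- H) w * p j) + (\<Sum>j\<in>UNIV. blockB i j (- H) w * m j)"
    and e2: "\<And>i. \<xi> * r * m i = - \<xi> * m i + (\<Sum>j\<in>UNIV. blockC i j (- H) w * p j) + (\<Sum>j\<in>UNIV. blockD i j (- H) w * m j)"
    and M: "\<And>i j. norm (blockB i j (- H) w) \<le> M" "\<And>i j. norm (blockD i j (- H) w) \<le> M"
      "\<And>i j. norm (S i j (- H) w) \<le> M" "\<And>i j. norm (R i j (- H) w) \<le> M"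
    and p: "\<And>i. norm (p i) \<le> norm \<xi> * P"
  shows "norm (m i - (\<Sum>j\<in>UNIV. S i j (- H) w * p j)) \<le> 8 * M * P * norm w ^ 13"
proof -
  define \<delta> where "\<delta> i = m i - (\<Sum>j\<in>UNIV. S i j (- H) w * p j)" for i
  define s where "s = norm (\<delta> 1) + norm (\<delta> 2)"
  have nw: "norm \<xi> * norm w = 1" using \<xi>w by (metis norm_mult norm_one)
  have M0: "0 \<le> M" using M(1) norm_ge_zero order_trans by blast
  have P0: "0 \<le> P"
  proof -
    have "0 \<le> norm \<xi> * P" using p norm_ge_zero order_trans by blast
    moreover have "norm \<xi> > 0" using \<xi>(1) by linarith
    ultimately show ?thesis by (simp add: zero_le_mult_iff)
  qed
  have eq: "\<xi> * (1 + r) * \<delta> i = (blockD i 1 (- H) w * \<delta> 1 + blockD i 2 (- H) w * \<delta> 2)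
      - ((S i 1 (- H) w * (blockB 1 1 (- H) w * \<delta> 1) + S i 1 (- H) w * (blockB 1 2 (- H) w * \<delta> 2))
       + (S i 2 (- H) w * (blockB 2 1 (- H) w * \<delta> 1) + S i 2 (- H) w * (blockB 2 2 (- H) w * \<delta> 2)))
      + (w ^ 14 * R i 1 (- H) w * p 1 + w ^ 14 * R i 2 (- H) w * p 2)" for i
    using S_residual'[OF \<xi>w, of i 1 "- H"] S_residual'[OF \<xi>w, of i 2 "- H"] e1[of 1] e1[of 2] e2[of i]
    unfolding \<delta>_def S'_init sum_2 by algebra
  have r1: "1 \<le> norm (1 + r)"
    using abs_Re_le_cmod[of "1 + r"] r by simp
  have b1: "norm (a * \<delta> j) \<le> M * norm (\<delta> j)" if "norm a \<le> M" for a j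
    unfolding norm_mult by (intro mult_right_mono that) simp
  have b2: "norm (c * (a * \<delta> j)) \<le> M * (M * norm (\<delta> j))" if "norm a \<le> M" "norm c \<le> M" for a c j
    unfolding norm_mult[of c] by (intro mult_mono that b1 M0) simp
  have b3: "norm (w ^ 14 * R i j (- H) w * p j) \<le> M * P * norm w ^ 13" for i j
  proof -
    have "norm (w ^ 14 * R i j (- H) w * p j) \<le> norm w ^ 14 * M * (norm \<xi> * P)"
      unfolding norm_mult norm_power by (intro mult_mono M p) (auto simp: M0)
    also have "\<dots> = M * P * norm w ^ 13 * (norm \<xi> * norm w)" by (simp add: power_Suc[of "norm w" 13, simplified])
    finally show ?thesis by (simp add: nw)
  qed
  have main: "norm \<xi> * norm (\<delta> i) \<le> (M + 2 * M * M) * s + 2 * M * P * norm w ^ 13" for i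
  proof -
    have "norm \<xi> * norm (\<delta> i) * 1 \<le> norm \<xi> * norm (\<delta> i) * norm (1 + r)"
      by (intro mult_left_mono r1) auto
    also have "\<dots> = norm (\<xi> * (1 + r) * \<delta> i)" by (simp add: norm_mult)
    also have "\<dots> \<le> ((M * norm (\<delta> 1) + M * norm (\<delta> 2)) + ((M * (M * norm (\<delta> 1)) + M * (M * norm (\<delta> 2))) + (M * (M * norm (\<delta> 1)) + M * (M * norm (\<delta> 2)))))
        + (M * P * norm w ^ 13 + M * P * norm w ^ 13)"
      unfolding eq
      by (intro norm_triangle_mono order_trans[OF norm_triangle_ineq4] add_mono b1 b2 b3 M)
    finally show ?thesis by (simp add: s_def algebra_simps)
  qed
  have "norm \<xi> * s \<le> 2 * (M + 2 * M * M) * s + 4 * M * P * norm w ^ 13"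
    using main[of 1] main[of 2] unfolding s_def[of] by (simp add: s_def algebra_simps)
  \<comment> \<open>The second lower bound on |\<xi>| is chosen so that the homogeneous terms take
    at most half of the left side.\<close>
  moreover have "2 * (M + 2 * M * M) * s \<le> norm \<xi> / 2 * s"
    using \<xi>(2) by (intro mult_right_mono) (auto simp: s_def)
  ultimately have "norm \<xi> / 2 * s \<le> 4 * M * P * norm w ^ 13" by simp
  moreover have "1 / 2 * s \<le> norm \<xi> / 2 * s" using \<xi>(1) by (intro mult_right_mono) (auto simp: s_def)
  ultimately have "s \<le> 8 * M * P * norm w ^ 13" by simp
  moreover have "norm (\<delta> i) \<le> s" using exhaust_2[of i] by (auto simp: s_def)
  ultimately show ?thesis by (simp add: \<delta>_def)
qed

definition jost_data :: "real \<Rightarrow> complex \<Rightarrow> complex \<Rightarrow> 4 \<Rightarrow> complex" where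
  "jost_data t = (if t = 1 then data_S else data_P)"

text \<open>The branch with nonnegative real part tends to 1 as w tends to 0, so \<xi> r is close to
  \<xi> relative to its size for every argument of \<xi>. The exponents on the other sheets are the
  negatives.\<close>

definition jost_root :: "real \<Rightarrow> complex \<Rightarrow> complex" where
  "jost_root t w = csqrt (1 - of_real (\<omega>\<^sup>2 / (if t = 1 then mu0 else lam0 + 2 * mu0)) * w\<^sup>2)"

lemma jost_root_uminus: "jost_root t (- w) = jost_root t w"
  by (simp add: jost_root_def)

text \<open>U is the amplitude on the graph with the factor \<xi> exp (\<xi> (z + H)) removed,
  started from the Jost data; S U is the companion minus part. B bounds both at the surface, Q is
  the error constant.\<close>

definition wkb_column :: "real \<Rightarrow> real \<Rightarrow> real \<Rightarrow> real \<Rightarrow> (2 \<Rightarrow> symbol) \<Rightarrow> bool" where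
  "wkb_column t \<epsilon> Q B U \<longleftrightarrow>
     (\<forall>i w. norm w < \<epsilon> \<longrightarrow> U i (- H) w = hplus t (jost_root t w) i w) \<and>
     (\<forall>i w. \<forall>z\<in>{- H..0}. norm w < \<epsilon> \<longrightarrow>
       ((\<lambda>z. U i z w) has_vector_derivative (\<Sum>j\<in>UNIV. reduced i j z w * U j z w)) (at z within {- H..0})) \<and>
     (\<forall>i. U i 0 holomorphic_on ball 0 \<epsilon>) \<and>
     (\<forall>i w. norm w < \<epsilon> \<longrightarrow> norm (U i 0 w) \<le> B \<and> norm (\<Sum>j\<in>UNIV. S i j 0 w * U j 0 w) \<le> B) \<and>
     (\<forall>\<xi> i. \<xi> \<noteq> 0 \<longrightarrow> norm (1/\<xi>) < \<epsilon> \<longrightarrow>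
       (let y = sol \<xi> (jost_data t \<xi> (\<xi> * jost_root t (1/\<xi>))); e = Q * norm (1/\<xi>) ^ 13 * exp (2 * H * \<bar>Re \<xi>\<bar>) in
        norm (plus_part \<xi> y i 0 - \<xi> * exp (\<xi> * of_real H) * U i 0 (1/\<xi>)) \<le> e \<and>
        norm (minus_part \<xi> y i 0 - \<xi> * exp (\<xi> * of_real H) * (\<Sum>j\<in>UNIV. S i j 0 (1/\<xi>) * U j 0 (1/\<xi>))) \<le> e))"

lemma wkb_column_exists:
  assumes t: "t = - 1 \<or> t = 1"
  obtains \<epsilon> Q B U where "0 < \<epsilon>" "\<epsilon> \<le> 1" "Q > 0" "B > 0" "wkb_column t \<epsilon> Q B U"
proof -
  define sp where "sp = (if t = 1 then mu0 else lam0 + 2 * mu0)"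
  have sp: "sp > 0" using mu0_pos sg0_pos by (simp add: sp_def)
  have H: "- H \<le> 0" "- H \<in> {- H..0}" "0 \<in> {- H..0}" using H_pos by auto
  \<comment> \<open>For |w| < \<epsilon>0 one has |w|^2 \<le> |w| < sp / \<omega>^2, so the radicand
    stays in the right half plane and the root is holomorphic.\<close>
  define \<epsilon>0 where "\<epsilon>0 = min 1 (sp / \<omega>\<^sup>2)"
  have \<epsilon>0: "\<epsilon>0 > 0" "\<epsilon>0 \<le> 1" "\<epsilon>0 \<le> sp / \<omega>\<^sup>2" using sp omega_pos by (auto simp: \<epsilon>0_def)
  have small: "norm (of_real (\<omega>\<^sup>2 / sp) * w\<^sup>2) < 1" if "norm w < \<epsilon>0" for w :: complex
  proof -
    have "norm w * norm w \<le> norm w * 1" using that \<epsilon>0 by (intro mult_left_mono) auto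
    also have "\<dots> < sp / \<omega>\<^sup>2" using that \<epsilon>0 by simp
    finally have "norm w * norm w < sp / \<omega>\<^sup>2" .
    then show ?thesis using sp omega_pos by (simp add: norm_mult norm_power norm_divide power2_eq_square field_simps)
  qed
  have root_hol: "jost_root t holomorphic_on ball 0 \<epsilon>0"
    unfolding jost_root_def[abs_def] sp_def[symmetric]
  proof (intro holomorphic_intros)
    fix w :: complex assume "w \<in> ball 0 \<epsilon>0"
    then have "norm (of_real (\<omega>\<^sup>2 / sp) * w\<^sup>2) < 1" using small by simp
    then have "Re (1 - of_real (\<omega>\<^sup>2 / sp) * w\<^sup>2) > 0"
      using complex_Re_le_cmod[of "of_real (\<omega>\<^sup>2 / sp) * w\<^sup>2"] by simp
    then show "1 - of_real (\<omega>\<^sup>2 / sp) * w\<^sup>2 \<notin> \<real>\<^sub>\<le>\<^sub>0"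
      by (auto simp: complex_nonpos_Reals_iff)
  qed
  have root_sq: "(jost_root t w)\<^sup>2 = 1 - of_real (\<omega>\<^sup>2 / sp) * w\<^sup>2" for w
    by (simp add: jost_root_def sp_def)
  have root_re: "Re (jost_root t w) \<ge> 0" for w unfolding jost_root_def by (rule Re_csqrt)
  have root_bd: "norm (jost_root t w) \<le> 2" if "norm w < \<epsilon>0" for w
  proof -
    have "norm ((jost_root t w)\<^sup>2) \<le> 1 + 1"
      unfolding root_sq using small[OF that] by (intro order_trans[OF norm_triangle_ineq4]) auto
    then have "(norm (jost_root t w))\<^sup>2 \<le> 2\<^sup>2" by (simp add: norm_power)
    then show ?thesis by (rule power2_le_imp_le) simp
  qed
  define Hb where "Hb = 2 * mu0 * 3 + \<omega>\<^sup>2 + \<omega>\<^sup>2 / mu0"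
  have Hb: "norm (hplus t (jost_root t w) i w) \<le> Hb" "Hb > 0" if "norm w < \<epsilon>0" for i w
  proof -
    have w1: "norm w \<le> 1" using that \<epsilon>0 by simp
    have nt: "norm (complex_of_real t) = 1" using t by auto
    have "norm (1 + jost_root t w) \<le> 3" using norm_triangle_ineq[of 1 "jost_root t w"] root_bd[OF that] by simp
    then have "norm (2 * complex_of_real mu0 * (1 + jost_root t w)) \<le> 2 * mu0 * 3"
      unfolding norm_mult using mu0_pos by (intro mult_mono) auto
    moreover have "norm (of_real (\<omega>\<^sup>2) * w\<^sup>2) \<le> \<omega>\<^sup>2 * 1"
      unfolding norm_mult using w1 by (intro mult_mono) (auto simp: norm_power power_le_one)
    ultimately have 1: "norm (2 * complex_of_real mu0 * (1 + jost_root t w) - of_real (\<omega>\<^sup>2) * w\<^sup>2) \<le> 2 * mu0 * 3 + \<omega>\<^sup>2"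
      by (intro order_trans[OF norm_triangle_ineq4]) simp
    have 2: "norm (- of_real (\<omega>\<^sup>2) / complex_of_real mu0 * w) \<le> \<omega>\<^sup>2 / mu0 * 1"
      unfolding norm_mult using w1 mu0_pos by (intro mult_mono) (auto simp: norm_divide norm_power)
    have 3: "\<omega>\<^sup>2 / mu0 \<ge> 0" "mu0 \<ge> 0" "\<omega>\<^sup>2 \<ge> 0" using mu0_pos by auto
    show "norm (hplus t (jost_root t w) i w) \<le> Hb"
    proof (cases "i = 1")
      case True
      then have "norm (hplus t (jost_root t w) i w) = norm (2 * complex_of_real mu0 * (1 + jost_root t w) - of_real (\<omega>\<^sup>2) * w\<^sup>2)"
        unfolding hplus_def by (simp only: if_True norm_mult nt mult_1_left simp_thms)
      with 1 3 show ?thesis unfolding Hb_def by linarith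
    next
      case False
      then have "norm (hplus t (jost_root t w) i w) = norm (- of_real (\<omega>\<^sup>2) / complex_of_real mu0 * w)"
        unfolding hplus_def by (simp only: if_False)
      with 2 3 show ?thesis unfolding Hb_def by linarith
    qed
    show "Hb > 0" using mu0_pos omega_pos by (simp add: Hb_def add_pos_pos)
  qed
  have hol: "(\<lambda>w. hplus t (jost_root t w) i w) holomorphic_on ball 0 \<epsilon>0" for i
    unfolding hplus_def by (cases "i = 1") (auto intro!: holomorphic_intros root_hol)
  obtain U where U: "\<And>i w. w \<in> ball 0 \<epsilon>0 \<Longrightarrow> U i (- H) w = hplus t (jost_root t w) i w"
    "\<And>i z w. z \<in> {- H..0} \<Longrightarrow> w \<in> ball 0 \<epsilon>0 \<Longrightarrow>
       ((\<lambda>z. U i z w) has_vector_derivative (\<Sum>j\<in>UNIV. reduced i j z w * U j z w)) (at z within {- H..0})"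
    "\<And>i z. z \<in> {- H..0} \<Longrightarrow> U i z holomorphic_on ball 0 \<epsilon>0"
  proof (rule linear_ode_holomorphic[where A = reduced and v = "\<lambda>i w. hplus t (jost_root t w) i w" and a = "- H" and b = 0 and W = "ball 0 \<epsilon>0", OF H(1) open_ball], goal_cases)
    case (1 i j) show ?case using jholo_subset[OF jholo_reduced] by blast
  next
    case (2 i) show ?case by (rule hol)
  next
    case (3 Y) show ?case by (rule 3(1)[OF 3(2,3,4)])
  qed
  obtain MG where MG: "MG > 0" "\<And>i j z w. z \<in> {- H..0} \<Longrightarrow> norm w \<le> 1 \<Longrightarrow> norm (reduced i j z w) \<le> MG"
    using jholo_family_bound[of "- H" 0 reduced] jholo_reduced by metis
  define Ub where "Ub = (Hb + Hb) * exp ((2 * (2 * MG) + 1/2) * H)"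
  have Ub: "norm (U i z w) \<le> Ub" if z: "z \<in> {- H..0}" and w: "norm w < \<epsilon>0" for i z w
  proof -
    have w1: "norm w \<le> 1" "w \<in> ball 0 \<epsilon>0" using w \<epsilon>0 by auto
    have "norm (U i z w) \<le> (\<Sum>j\<in>UNIV. norm (U j (- H) w)) * exp ((real CARD(2) * (real CARD(2) * MG) + 1/2) * (z - - H))"
      by (rule linear_ode_bound[where y = "\<lambda>i z. U i z w" and A = "\<lambda>i j z. reduced i j z w", OF U(2)[OF _ w1(2)] MG(2)[OF _ w1(1)] z])
    also have "\<dots> \<le> (Hb + Hb) * exp ((2 * (2 * MG) + 1/2) * H)"
    proof (rule mult_mono)
      show "(\<Sum>j\<in>UNIV. norm (U j (- H) w)) \<le> Hb + Hb"
        unfolding sum_2 U(1)[OF w1(2)] by (intro add_mono Hb w)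
      have "(2 * (2 * MG) + 1/2) * (z + H) \<le> (2 * (2 * MG) + 1/2) * H"
        using z MG(1) by (intro mult_left_mono) auto
      then show "exp ((real CARD(2) * (real CARD(2) * MG) + 1/2) * (z - - H)) \<le> exp ((2 * (2 * MG) + 1/2) * H)" by simp
    qed (use Hb[OF w] in auto)
    finally show ?thesis by (simp add: Ub_def)
  qed
  obtain MA where MA: "MA > 0" "\<And>i j z w. z \<in> {- H..0} \<Longrightarrow> norm w \<le> 1 \<Longrightarrow> norm (blockA i j z w) \<le> MA"
    using jholo_family_bound[of "- H" 0 blockA] jholo_blocks(1) by metis
  obtain MB where MB: "MB > 0" "\<And>i j z w. z \<in> {- H..0} \<Longrightarrow> norm w \<le> 1 \<Longrightarrow> norm (blockB i j z w) \<le> MB"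
    using jholo_family_bound[of "- H" 0 blockB] jholo_blocks(2) by metis
  obtain MC where MC: "MC > 0" "\<And>i j z w. z \<in> {- H..0} \<Longrightarrow> norm w \<le> 1 \<Longrightarrow> norm (blockC i j z w) \<le> MC"
    using jholo_family_bound[of "- H" 0 blockC] jholo_blocks(3) by metis
  obtain MD where MD: "MD > 0" "\<And>i j z w. z \<in> {- H..0} \<Longrightarrow> norm w \<le> 1 \<Longrightarrow> norm (blockD i j z w) \<le> MD"
    using jholo_family_bound[of "- H" 0 blockD] jholo_blocks(4) by metis
  obtain MR where MR: "MR > 0" "\<And>i j z w. z \<in> {- H..0} \<Longrightarrow> norm w \<le> 1 \<Longrightarrow> norm (R i j z w) \<le> MR"
    using jholo_family_bound[of "- H" 0 R] jholo_graph(2) by metis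
  obtain MS where MS: "MS > 0" "\<And>i j z w. z \<in> {- H..0} \<Longrightarrow> norm w \<le> 1 \<Longrightarrow> norm (S i j z w) \<le> MS"
    using jholo_family_bound[of "- H" 0 S] jholo_graph(1) by metis
  define M where "M = MA + MB + MC + MD + MR + MS"
  have M: "M > 0" "\<And>i j z w. z \<in> {- H..0} \<Longrightarrow> norm w \<le> 1 \<Longrightarrow> norm (blockA i j z w) \<le> M \<and> norm (blockB i j z w) \<le> M
        \<and> norm (blockC i j z w) \<le> M \<and> norm (blockD i j z w) \<le> M \<and> norm (R i j z w) \<le> M"
    "\<And>i j z w. z \<in> {- H..0} \<Longrightarrow> norm w \<le> 1 \<Longrightarrow> norm (S i j z w) \<le> M"
  proof -
    show "M > 0" using MA MB MC MD MR MS by (simp add: M_def)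
    fix i j z and w :: complex assume zw: "z \<in> {- H..0}" "norm w \<le> 1"
    show "norm (blockA i j z w) \<le> M \<and> norm (blockB i j z w) \<le> M
        \<and> norm (blockC i j z w) \<le> M \<and> norm (blockD i j z w) \<le> M \<and> norm (R i j z w) \<le> M"
      using MA(2)[OF zw, of i j] MB(2)[OF zw, of i j] MC(2)[OF zw, of i j] MD(2)[OF zw, of i j] MR(2)[OF zw, of i j]
        MA(1) MB(1) MC(1) MD(1) MR(1) MS(1) by (simp add: M_def)
    show "norm (S i j z w) \<le> M"
      using MS(2)[OF zw, of i j] MA(1) MB(1) MC(1) MD(1) MR(1) MS(1) by (simp add: M_def)
  qed
  \<comment> \<open>The second term is the threshold on |\<xi>| in \<open>init_graph\<close>,
    expressed in w.\<close>
  define \<epsilon> where "\<epsilon> = min \<epsilon>0 (1 / (4 * (M + 2 * M * M)))"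
  have \<epsilon>: "\<epsilon> > 0" "\<epsilon> \<le> \<epsilon>0" "\<epsilon> \<le> 1 / (4 * (M + 2 * M * M))"
    using \<epsilon>0 M(1) by (auto simp: \<epsilon>_def add_pos_pos)
  define N where "N = 8 * M * Hb"
  define Q where "Q = (2 * N + 8 * M * Ub) * exp ((16 * M + 1/2) * H)"
  have Hb0: "Hb > 0" using Hb(2)[of 0] \<epsilon>0 by simp
  have Ub0: "Ub > 0" using Hb0 by (simp add: Ub_def)
  have N0: "N > 0" using Hb0 M(1) by (simp add: N_def)
  have Q0: "Q > 0" using N0 M(1) Ub0 by (simp add: Q_def add_pos_pos)
  have err: "norm (plus_part \<xi> (sol \<xi> (jost_data t \<xi> (\<xi> * jost_root t (1/\<xi>)))) i 0 - \<xi> * exp (\<xi> * of_real H) * U i 0 (1/\<xi>))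
         \<le> Q * norm (1/\<xi>) ^ 13 * exp (2 * H * \<bar>Re \<xi>\<bar>)"
       "norm (minus_part \<xi> (sol \<xi> (jost_data t \<xi> (\<xi> * jost_root t (1/\<xi>)))) i 0
           - \<xi> * exp (\<xi> * of_real H) * (\<Sum>j\<in>UNIV. S i j 0 (1/\<xi>) * U j 0 (1/\<xi>)))
         \<le> Q * norm (1/\<xi>) ^ 13 * exp (2 * H * \<bar>Re \<xi>\<bar>)"
    if \<xi>: "\<xi> \<noteq> 0" "norm (1/\<xi>) < \<epsilon>" for i \<xi>
  proof -
    define w where "w = 1 / \<xi>"
    have \<xi>w: "\<xi> * w = 1" using \<xi> by (simp add: w_def)
    have w: "norm w < \<epsilon>0" "norm w \<le> 1" "w \<in> ball 0 \<epsilon>0" using \<xi>(2) \<epsilon> \<epsilon>0 by (auto simp: w_def)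
    have n\<xi>: "norm \<xi> = 1 / norm w" by (simp add: w_def norm_divide)
    have w0: "norm w > 0" using \<xi> by (simp add: w_def)
    have \<xi>1: "norm \<xi> \<ge> 1" unfolding n\<xi> using w w0 by (simp add: le_divide_eq)
    have "norm w < 1 / (4 * (M + 2 * M * M))" using \<xi>(2) \<epsilon>(3) by (simp add: w_def)
    then have \<xi>2: "norm \<xi> \<ge> 4 * (M + 2 * M * M)"
      unfolding n\<xi> using w0 M(1) by (simp add: field_simps add_pos_pos)
    define y where "y = sol \<xi> (jost_data t \<xi> (\<xi> * jost_root t w))"
    have ray: "ray_ode \<xi> y" unfolding y_def by (rule sol_ode)
    have dat: "(\<forall>i. y i (- H) = data_P \<xi> (\<xi> * jost_root t w) i) \<and> t = - 1 \<or> (\<forall>i. y i (- H) = data_S \<xi> (\<xi> * jost_root t w) i) \<and> t = 1"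
      using t by (auto simp: y_def sol_init jost_data_def)
    note init = data_parts[where y = y and r = "jost_root t w" and t = t, OF \<xi>(1) dat, folded w_def]
    have rr: "t = - 1 \<and> (jost_root t w)\<^sup>2 = 1 - of_real (\<omega>\<^sup>2 / (lam0 + 2 * mu0)) * w\<^sup>2 \<or> t = 1 \<and> (jost_root t w)\<^sup>2 = 1 - of_real (\<omega>\<^sup>2 / mu0) * w\<^sup>2"
      using t root_sq[of w] by (auto simp: sp_def)
    note eig = data_eigen[OF \<xi>w rr]
    have i1: "plus_part \<xi> y i (- H) = \<xi> * U i (- H) w" for i using init(1) U(1)[OF w(3)] by simp
    have i2: "norm (minus_part \<xi> y i (- H) - (\<Sum>j\<in>UNIV. S i j (- H) w * plus_part \<xi> y j (- H))) \<le> N * norm w ^ 13" for i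
      unfolding N_def
    proof (rule init_graph[OF \<xi>w \<xi>1 \<xi>2 root_re])
      show "\<xi> * jost_root t w * plus_part \<xi> y i (- H) = \<xi> * plus_part \<xi> y i (- H)
          + (\<Sum>j\<in>UNIV. blockA i j (- H) w * plus_part \<xi> y j (- H)) + (\<Sum>j\<in>UNIV. blockB i j (- H) w * minus_part \<xi> y j (- H))" for i
      proof -
        have "\<xi> * (\<xi> * jost_root t w * hplus t (jost_root t w) i w) = \<xi> * (\<xi> * hplus t (jost_root t w) i w
            + (\<Sum>j\<in>UNIV. blockA i j (- H) w * hplus t (jost_root t w) j w) + (\<Sum>j\<in>UNIV. blockB i j (- H) w * hminus t (jost_root t w) j w))"
          using eig(1)[of i] by simp
        then show ?thesis unfolding init by (simp add: sum_2 algebra_simps)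
      qed
      show "\<xi> * jost_root t w * minus_part \<xi> y i (- H) = - \<xi> * minus_part \<xi> y i (- H)
          + (\<Sum>j\<in>UNIV. blockC i j (- H) w * plus_part \<xi> y j (- H)) + (\<Sum>j\<in>UNIV. blockD i j (- H) w * minus_part \<xi> y j (- H))" for i
      proof -
        have "\<xi> * (\<xi> * jost_root t w * hminus t (jost_root t w) i w) = \<xi> * (- \<xi> * hminus t (jost_root t w) i w
            + (\<Sum>j\<in>UNIV. blockC i j (- H) w * hplus t (jost_root t w) j w) + (\<Sum>j\<in>UNIV. blockD i j (- H) w * hminus t (jost_root t w) j w))"
          using eig(2)[of i] by simp
        then show ?thesis unfolding init by (simp add: sum_2 algebra_simps)
      qed
      show "norm (plus_part \<xi> y i (- H)) \<le> norm \<xi> * Hb" for i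
        unfolding init norm_mult by (intro mult_left_mono Hb w) auto
    qed (use M H w in auto)
    have a1: "norm (U i z w) \<le> Ub" if "z \<in> {- H..0}" for i z by (rule Ub[OF that w(1)])
    have a2: "((\<lambda>z. U i z w) has_vector_derivative (\<Sum>j\<in>UNIV. reduced i j z (1/\<xi>) * U j z w)) (at z within {- H..0})"
      if "z \<in> {- H..0}" for i z using U(2)[OF that w(3)] by (simp add: w_def)
    have i2': "norm (minus_part \<xi> y i (- H) - (\<Sum>j\<in>UNIV. S i j (- H) (1/\<xi>) * plus_part \<xi> y j (- H))) \<le> N * norm (1/\<xi>) ^ 13" for i
      using i2[of i] by (simp only: w_def)
    have "norm (plus_part \<xi> y i 0 - \<xi> * exp (\<xi> * of_real H) * U i 0 w) \<le> Q * norm (1/\<xi>) ^ 13 * exp (2 * H * \<bar>Re \<xi>\<bar>)"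
      "norm (minus_part \<xi> y i 0 - \<xi> * exp (\<xi> * of_real H) * (\<Sum>j\<in>UNIV. S i j 0 (1/\<xi>) * U j 0 w)) \<le> Q * norm (1/\<xi>) ^ 13 * exp (2 * H * \<bar>Re \<xi>\<bar>)"
      using wkb_error[where U = "\<lambda>i z. U i z w" and \<xi> = \<xi> and y = y and M = M and N = N and Ub = Ub,
          OF a1 a2 M(1) M(2) \<xi>1 ray i1 i2' less_imp_le[OF N0], of i]
      unfolding Q_def by simp_all
    then show "norm (plus_part \<xi> (sol \<xi> (jost_data t \<xi> (\<xi> * jost_root t (1/\<xi>)))) i 0 - \<xi> * exp (\<xi> * of_real H) * U i 0 (1/\<xi>))
         \<le> Q * norm (1/\<xi>) ^ 13 * exp (2 * H * \<bar>Re \<xi>\<bar>)"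
       "norm (minus_part \<xi> (sol \<xi> (jost_data t \<xi> (\<xi> * jost_root t (1/\<xi>)))) i 0
           - \<xi> * exp (\<xi> * of_real H) * (\<Sum>j\<in>UNIV. S i j 0 (1/\<xi>) * U j 0 (1/\<xi>)))
         \<le> Q * norm (1/\<xi>) ^ 13 * exp (2 * H * \<bar>Re \<xi>\<bar>)"
      unfolding y_def w_def by simp_all
  qed
  define B where "B = Ub + 2 * (M * Ub)"
  have B1: "norm (U i 0 w) \<le> B" if "norm w < \<epsilon>" for i w
  proof -
    have "norm (U i 0 w) \<le> Ub" using Ub[OF H(3), of w i] that \<epsilon>(2) by simp
    then show ?thesis using M(1) Ub0 by (simp add: B_def add_increasing2)
  qed
  have B2: "norm (\<Sum>j\<in>UNIV. S i j 0 w * U j 0 w) \<le> B" if "norm w < \<epsilon>" for i w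
  proof -
    have w: "norm w < \<epsilon>0" "norm w \<le> 1" using that \<epsilon> \<epsilon>0 by auto
    have "norm (S i j 0 w * U j 0 w) \<le> M * Ub" for j
      unfolding norm_mult using M(1) by (intro mult_mono M(3) Ub H w) auto
    from norm_triangle_mono[OF this[of 1] this[of 2]] show ?thesis
      using Ub0 by (simp add: sum_2 B_def)
  qed
  have f2: "\<epsilon> \<le> 1" and f4: "B > 0" using \<epsilon> \<epsilon>0 Ub0 M(1) by (auto simp: B_def add_pos_pos)
  have f5: "U i (- H) w = hplus t (jost_root t w) i w" if "norm w < \<epsilon>" for i w
    using U(1)[of w i] that \<epsilon>(2) by simp
  have f6: "((\<lambda>z. U i z w) has_vector_derivative (\<Sum>j\<in>UNIV. reduced i j z w * U j z w)) (at z within {- H..0})"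
    if "z \<in> {- H..0}" "norm w < \<epsilon>" for i z w
    using U(2)[OF that(1), of w i] that(2) \<epsilon>(2) by simp
  have f7: "U i 0 holomorphic_on ball 0 \<epsilon>" for i
    by (rule holomorphic_on_subset[OF U(3)[OF H(3)]]) (use \<epsilon> in auto)
  have "wkb_column t \<epsilon> Q B U"
    unfolding wkb_column_def Let_def using f5 f6 f7 B1 B2 err by blast
  with \<epsilon>(1) f2 Q0 f4 show thesis by (rule that)
qed

end

section \<open>Nonvanishing of the boundary determinant\<close>

text \<open>Here \<open>x = \<bar>\<xi>\<bar>\<close> and \<open>G = exp (H \<bar>Re \<xi>\<bar>)\<close>; this estimate fixes the order 13 of the expansion.\<close>

lemma wkb_error_negligible:
  fixes B Q C c0 :: real
  assumes pos: "B > 0" "Q > 0" "C > 0" "c0 > 0"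
  obtains Rr where "Rr \<ge> 1"
    "\<And>x G. x \<ge> Rr \<Longrightarrow> 1 \<le> G \<Longrightarrow> G \<le> C * x\<^sup>2 \<Longrightarrow>
       G\<^sup>2 * (4 * (x * G * B) * (Q * (1/x) ^ 13 * G\<^sup>2) + 2 * (Q * (1/x) ^ 13 * G\<^sup>2)\<^sup>2) < c0 \<and>
       x\<^sup>2 * (4 * (x * G * B) * (Q * (1/x) ^ 13 * G\<^sup>2) + 2 * (Q * (1/x) ^ 13 * G\<^sup>2)\<^sup>2) < c0"
proof -
  define K1 where "K1 = 4 * B * Q * C ^ 5 + 2 * Q\<^sup>2 * C ^ 6"
  define K2 where "K2 = 4 * B * Q * C ^ 3 + 2 * Q\<^sup>2 * C ^ 4"
  have K: "K1 > 0" "K2 > 0" using pos by (auto simp: K1_def K2_def add_pos_pos)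
  define Rr where "Rr = 1 + (K1 + K2) / c0"
  have Rr: "Rr \<ge> 1" using K pos by (simp add: Rr_def)
  show thesis
  proof (rule that[OF Rr])
    fix x G :: real assume x: "x \<ge> Rr" and G: "1 \<le> G" "G \<le> C * x\<^sup>2"
    \<comment> \<open>With p = 1/x and G = g x^2, 0 \<le> g \<le> C, all powers of x pair with
      powers of p. What is left over is a positive power of p, at least p^2, times a polynomial in
      g, hence O(1/x).\<close>
    define p where "p = 1 / x"
    define g where "g = G * p\<^sup>2"
    have x1: "x \<ge> 1" using x Rr by linarith
    then have xp: "x * p = 1" and p: "0 < p" "p \<le> 1" by (auto simp: p_def)
    have Gg: "G = g * x\<^sup>2"
    proof -
      have "g * x\<^sup>2 = G * (x * p)\<^sup>2" by (simp add: g_def power_mult_distrib)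
      then show ?thesis by (simp add: xp)
    qed
    have g0: "0 \<le> g" using G(1) by (simp add: g_def)
    have gC: "g \<le> C"
    proof -
      have "g \<le> C * x\<^sup>2 * p\<^sup>2" unfolding g_def by (intro mult_right_mono G) auto
      also have "\<dots> = C * (x * p)\<^sup>2" by (simp add: power_mult_distrib)
      finally show ?thesis by (simp add: xp)
    qed
    have X1: "G\<^sup>2 * (4 * (x * G * B) * (Q * p ^ 13 * G\<^sup>2) + 2 * (Q * p ^ 13 * G\<^sup>2)\<^sup>2)
        = 4 * B * Q * g ^ 5 * (x * p) ^ 11 * p ^ 2 + 2 * Q\<^sup>2 * g ^ 6 * (x * p) ^ 12 * p ^ 14"
      unfolding Gg by algebra
    have X2: "x\<^sup>2 * (4 * (x * G * B) * (Q * p ^ 13 * G\<^sup>2) + 2 * (Q * p ^ 13 * G\<^sup>2)\<^sup>2)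
        = 4 * B * Q * g ^ 3 * (x * p) ^ 9 * p ^ 4 + 2 * Q\<^sup>2 * g ^ 4 * (x * p) ^ 10 * p ^ 16"
      unfolding Gg by algebra
    have pp: "p ^ Suc n \<le> p" for n using power_decreasing[of 1 "Suc n" p] p by simp
    have gp: "g ^ n \<le> C ^ n" for n using g0 gC by (rule power_mono[rotated])
    have t: "a * g ^ n * p ^ Suc k \<le> a * C ^ n * p" if "a \<ge> 0" for a n k
      using that g0 p gp pp pos by (intro mult_mono mult_left_mono) auto
    have small: "(K1 + K2) * p < c0"
    proof -
      have "(K1 + K2) / c0 < x" using x by (simp add: Rr_def)
      then have "K1 + K2 < c0 * x" using pos by (simp add: field_simps)
      then show ?thesis using x1 by (simp add: p_def field_simps)
    qed
    have "4 * B * Q * g ^ 5 * p ^ Suc 1 + 2 * Q\<^sup>2 * g ^ 6 * p ^ Suc 13 \<le> 4 * B * Q * C ^ 5 * p + 2 * Q\<^sup>2 * C ^ 6 * p"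
      by (intro add_mono t) (use pos in auto)
    also have "\<dots> = K1 * p" by (simp add: K1_def algebra_simps)
    also have "\<dots> \<le> (K1 + K2) * p" using K p by simp
    finally have 1: "4 * B * Q * g ^ 5 * p ^ Suc 1 + 2 * Q\<^sup>2 * g ^ 6 * p ^ Suc 13 < c0" using small by linarith
    have "4 * B * Q * g ^ 3 * p ^ Suc 3 + 2 * Q\<^sup>2 * g ^ 4 * p ^ Suc 15 \<le> 4 * B * Q * C ^ 3 * p + 2 * Q\<^sup>2 * C ^ 4 * p"
      by (intro add_mono t) (use pos in auto)
    also have "\<dots> = K2 * p" by (simp add: K2_def algebra_simps)
    also have "\<dots> \<le> (K1 + K2) * p" using K p by simp
    finally have 2: "4 * B * Q * g ^ 3 * p ^ Suc 3 + 2 * Q\<^sup>2 * g ^ 4 * p ^ Suc 15 < c0" using small by linarith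
    have n: "Suc 1 = 2" "Suc 13 = 14" "Suc 3 = 4" "Suc 15 = 16" by simp_all
    show "G\<^sup>2 * (4 * (x * G * B) * (Q * (1/x) ^ 13 * G\<^sup>2) + 2 * (Q * (1/x) ^ 13 * G\<^sup>2)\<^sup>2) < c0 \<and>
       x\<^sup>2 * (4 * (x * G * B) * (Q * (1/x) ^ 13 * G\<^sup>2) + 2 * (Q * (1/x) ^ 13 * G\<^sup>2)\<^sup>2) < c0"
      unfolding p_def[symmetric] X1 X2 xp power_one mult_1_right using 1 2 unfolding n by blast
  qed
qed

section \<open>Sheets whose exponents have the same sign\<close>

context slab_graph
begin

lemma exp_bounds:
  "norm (exp (\<xi> * of_real H)) \<le> exp (H * \<bar>Re \<xi>\<bar>)" "norm (exp (- \<xi> * of_real H)) \<le> exp (H * \<bar>Re \<xi>\<bar>)"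
  "exp (2 * H * \<bar>Re \<xi>\<bar>) = (exp (H * \<bar>Re \<xi>\<bar>))\<^sup>2" "1 \<le> exp (H * \<bar>Re \<xi>\<bar>)"
proof -
  have "Re \<xi> * H \<le> \<bar>Re \<xi>\<bar> * H" "- Re \<xi> * H \<le> \<bar>Re \<xi>\<bar> * H" using H_pos by (intro mult_right_mono; simp)+
  then have "Re (\<xi> * of_real H) \<le> H * \<bar>Re \<xi>\<bar>" "Re (- \<xi> * of_real H) \<le> H * \<bar>Re \<xi>\<bar>"
    by (simp_all add: mult.commute[of H])
  then show "norm (exp (\<xi> * of_real H)) \<le> exp (H * \<bar>Re \<xi>\<bar>)" "norm (exp (- \<xi> * of_real H)) \<le> exp (H * \<bar>Re \<xi>\<bar>)"
    unfolding norm_exp_eq_Re by simp_all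
  show "exp (2 * H * \<bar>Re \<xi>\<bar>) = (exp (H * \<bar>Re \<xi>\<bar>))\<^sup>2"
    by (simp add: exp_double[symmetric] mult.assoc)
  show "1 \<le> exp (H * \<bar>Re \<xi>\<bar>)" using H_pos by simp
qed

text \<open>By \<open>S_expand\<close>, S 1 2 = \<kappa> w / 2 + O(w^2) at the surface, where
  \<kappa> is the nonzero value of \<open>ck\<close> there. The radius keeps the remainder below
  half of the first term.\<close>

lemma S12_lower:
  obtains c \<epsilon> where "c > 0" "\<epsilon> > 0" "\<And>w. norm w < \<epsilon> \<Longrightarrow> c * norm w \<le> norm (S 1 2 0 w)"
proof -
  define \<kappa> where "\<kappa> = ck 0 0"
  have \<kappa>: "norm \<kappa> > 0" using cmn_nz[of 0 0] by (simp add: \<kappa>_def ck_def)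
  have ck: "ck 0 w = \<kappa>" for w by (simp add: \<kappa>_def ck_def cm_def cn_def)
  obtain MT where MT: "MT > 0" "\<And>i j z w. z \<in> {- H..0} \<Longrightarrow> norm w \<le> 1 \<Longrightarrow> norm (T i j z w) \<le> MT"
    using jholo_family_bound[of "- H" 0 T] jholo_graph(3) by metis
  define L where "L = norm q / 2 + MT"
  have L: "L > 0" using MT(1) by (simp add: L_def add_nonneg_pos)
  define \<epsilon> where "\<epsilon> = min 1 (norm \<kappa> / (4 * L))"
  show thesis
  proof (rule that[of "norm \<kappa> / 4" \<epsilon>])
    fix w :: complex assume w: "norm w < \<epsilon>"
    then have w1: "norm w \<le> 1" and w2: "norm w * L \<le> norm \<kappa> / 4" using L by (auto simp: \<epsilon>_def field_simps)
    have "S 1 2 0 w = w * (\<kappa> / 2 - w * (w * q / 2 - T 1 2 0 w))"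
      unfolding S_expand by (simp add: blockC_def Let_def ck power2_eq_square algebra_simps)
    moreover have "norm (w * (w * q / 2 - T 1 2 0 w)) \<le> norm w * L"
      unfolding norm_mult
    proof (intro mult_left_mono)
      have "norm (w * q / 2) \<le> norm q / 2" using w1 by (simp add: norm_mult norm_divide mult_left_le_one_le)
      then show "norm (w * q / 2 - T 1 2 0 w) \<le> L"
        using MT(2)[of 0 w 1 2] w1 H_pos unfolding L_def
        by (intro order_trans[OF norm_triangle_ineq4]) auto
    qed simp
    then have "norm (\<kappa> / 2 - w * (w * q / 2 - T 1 2 0 w)) \<ge> norm \<kappa> / 2 - norm \<kappa> / 4"
      using norm_triangle_ineq2[of "\<kappa> / 2" "w * (w * q / 2 - T 1 2 0 w)"] w2 by (simp add: norm_divide)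
    then have "norm w * (norm \<kappa> / 4) \<le> norm w * norm (\<kappa> / 2 - w * (w * q / 2 - T 1 2 0 w))"
      by (intro mult_left_mono) auto
    ultimately show "norm \<kappa> / 4 * norm w \<le> norm (S 1 2 0 w)" by (simp add: norm_mult mult.commute)
  qed (use \<kappa> L in \<open>auto simp: \<epsilon>_def\<close>)
qed

lemma jost_root_Re: "Re (jost_root t w) \<ge> 0"
  unfolding jost_root_def by (rule Re_csqrt)

lemma wkb_column_mono:
  assumes "wkb_column t \<epsilon> Q B U" "\<epsilon>' \<le> \<epsilon>" "Q \<le> Q'" "B \<le> B'"
  shows "wkb_column t \<epsilon>' Q' B' U"
proof -
  have e: "Q * norm (1/\<xi>) ^ 13 * exp (2 * H * \<bar>Re \<xi>\<bar>) \<le> Q' * norm (1/\<xi>) ^ 13 * exp (2 * H * \<bar>Re \<xi>\<bar>)" for \<xi>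
    using assms(3) by (intro mult_right_mono) auto
  show ?thesis
    unfolding wkb_column_def Let_def
  proof (intro conjI allI impI ballI)
    fix i show "U i 0 holomorphic_on ball 0 \<epsilon>'"
      using assms(1,2) unfolding wkb_column_def by (meson holomorphic_on_subset subset_ball)
  qed (use assms e in \<open>unfold wkb_column_def Let_def; meson less_le_trans order_trans\<close>)+
qed

lemma wkb_columns:
  obtains \<epsilon> Q B U V where "0 < \<epsilon>" "\<epsilon> \<le> 1" "Q > 0" "B > 0"
    "wkb_column (- 1) \<epsilon> Q B U" "wkb_column 1 \<epsilon> Q B V"
proof -
  have tm: "(- 1 :: real) = - 1 \<or> (- 1 :: real) = 1" "(1 :: real) = - 1 \<or> (1 :: real) = 1" by simp_all
  obtain \<epsilon>P QP BP U where P: "0 < \<epsilon>P" "\<epsilon>P \<le> 1" "QP > 0" "BP > 0" "wkb_column (- 1) \<epsilon>P QP BP U"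
    by (rule wkb_column_exists[OF tm(1)])
  obtain \<epsilon>S QS BS V where S: "0 < \<epsilon>S" "\<epsilon>S \<le> 1" "QS > 0" "BS > 0" "wkb_column 1 \<epsilon>S QS BS V"
    by (rule wkb_column_exists[OF tm(2)])
  show thesis
    by (rule that[of "min \<epsilon>P \<epsilon>S" "max QP QS" "max BP BS" U V])
      (use P S in \<open>auto intro: wkb_column_mono\<close>)
qed

lemma wkb_columnD:
  assumes "wkb_column t \<epsilon> Q B U"
  shows "norm w < \<epsilon> \<Longrightarrow> U i (- H) w = hplus t (jost_root t w) i w"
    "z \<in> {- H..0} \<Longrightarrow> norm w < \<epsilon> \<Longrightarrow>
       ((\<lambda>z. U i z w) has_vector_derivative (\<Sum>j\<in>UNIV. reduced i j z w * U j z w)) (at z within {- H..0})"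
    "U i 0 holomorphic_on ball 0 \<epsilon>"
    "norm w < \<epsilon> \<Longrightarrow> norm (U i 0 w) \<le> B"
    "norm w < \<epsilon> \<Longrightarrow> norm (\<Sum>j\<in>UNIV. S i j 0 w * U j 0 w) \<le> B"
    "\<xi> \<noteq> 0 \<Longrightarrow> norm (1/\<xi>) < \<epsilon> \<Longrightarrow>
       norm (plus_part \<xi> (sol \<xi> (jost_data t \<xi> (\<xi> * jost_root t (1/\<xi>)))) i 0 - \<xi> * exp (\<xi> * of_real H) * U i 0 (1/\<xi>))
         \<le> Q * norm (1/\<xi>) ^ 13 * exp (2 * H * \<bar>Re \<xi>\<bar>)"
    "\<xi> \<noteq> 0 \<Longrightarrow> norm (1/\<xi>) < \<epsilon> \<Longrightarrow>
       norm (minus_part \<xi> (sol \<xi> (jost_data t \<xi> (\<xi> * jost_root t (1/\<xi>)))) i 0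
           - \<xi> * exp (\<xi> * of_real H) * (\<Sum>j\<in>UNIV. S i j 0 (1/\<xi>) * U j 0 (1/\<xi>)))
         \<le> Q * norm (1/\<xi>) ^ 13 * exp (2 * H * \<bar>Re \<xi>\<bar>)"
  using assms unfolding wkb_column_def Let_def by blast+

text \<open>Both roots have nonnegative real part, so the two leading terms add up and cannot
  cancel. The right side is the bracket in the Wronskian of the two columns at - H.\<close>

lemma jost_root_norm_Re: "4 * mu0 - 2 * \<omega>\<^sup>2 * (norm w)\<^sup>2
    \<le> norm (2 * of_real mu0 * (1 + jost_root (- 1) w) - of_real (\<omega>\<^sup>2) * w\<^sup>2 + (2 * of_real mu0 * (1 + jost_root 1 w) - of_real (\<omega>\<^sup>2) * w\<^sup>2))"
proof -
  define z where "z = 2 * complex_of_real mu0 * (1 + jost_root (- 1) w) + 2 * of_real mu0 * (1 + jost_root 1 w)"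
  have "4 * mu0 \<le> Re z" using mu0_pos jost_root_Re[of "- 1" w] jost_root_Re[of 1 w] by (simp add: z_def algebra_simps)
  also have "\<dots> \<le> norm z" by (rule complex_Re_le_cmod)
  finally have "4 * mu0 - norm (2 * of_real (\<omega>\<^sup>2) * w\<^sup>2) \<le> norm (z - 2 * of_real (\<omega>\<^sup>2) * w\<^sup>2)"
    using norm_triangle_ineq2[of z "2 * of_real (\<omega>\<^sup>2) * w\<^sup>2"] by linarith
  moreover have "norm (2 * complex_of_real (\<omega>\<^sup>2) * w\<^sup>2) = 2 * \<omega>\<^sup>2 * (norm w)\<^sup>2" by (simp add: norm_mult norm_power)
  ultimately show ?thesis by (simp add: z_def algebra_simps)
qed

text \<open>By Liouville's formula the Wronskian solves a scalar equation driven by the trace of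
  \<open>reduced\<close>, so \<open>gronwall_lower\<close> carries its size from - H to the surface.
  At - H it is \<omega>^2 w / mu0 times the bracket of \<open>jost_root_norm_Re\<close>; the
  opposite signs t of the two wave types turn the difference into a sum.\<close>

lemma wronskian_lower:
  assumes U: "wkb_column (- 1) \<epsilon> Q B U" and V: "wkb_column 1 \<epsilon> Q B V" and \<epsilon>: "\<epsilon> > 0" "\<epsilon> \<le> 1"
  obtains c \<delta> where "c > 0" "0 < \<delta>" "\<delta> \<le> \<epsilon>"
    "\<And>w. norm w < \<delta> \<Longrightarrow> c * norm w \<le> norm (U 1 0 w * V 2 0 w - V 1 0 w * U 2 0 w)"
proof -
  obtain M where M: "M > 0" "\<And>i j z w. z \<in> {- H..0} \<Longrightarrow> norm w \<le> 1 \<Longrightarrow> norm (reduced i j z w) \<le> M"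
    using jholo_family_bound[of "- H" 0 reduced] jholo_reduced by metis
  define K where "K = exp ((2 * M + 1/2) * H)"
  \<comment> \<open>The second term gives \<omega>^2 |w|^2 \<le> mu0, so that 2 mu0 of the 4 mu0 in
    \<open>jost_root_norm_Re\<close> survive.\<close>
  define \<delta> where "\<delta> = min \<epsilon> (mu0 / \<omega>\<^sup>2)"
  have \<delta>: "0 < \<delta>" "\<delta> \<le> \<epsilon>" "\<delta> \<le> mu0 / \<omega>\<^sup>2" using \<epsilon> mu0_pos omega_pos by (auto simp: \<delta>_def)
  show thesis
  proof (rule that[of "2 * \<omega>\<^sup>2 / K" \<delta>])
    fix w :: complex assume w: "norm w < \<delta>"
    then have we: "norm w < \<epsilon>" and w1: "norm w \<le> 1" using \<delta> \<epsilon> by auto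
    define W where "W z = U 1 z w * V 2 z w - V 1 z w * U 2 z w" for z
    have "norm (W (- H)) \<le> norm (W 0) * exp ((2 * M + 1/2) * (0 - (- H)))"
    proof (rule gronwall_lower[where \<tau> = "\<lambda>z. reduced 1 1 z w + reduced 2 2 z w"])
      show "(W has_vector_derivative (reduced 1 1 z w + reduced 2 2 z w) * W z) (at z within {- H..0})" if z: "z \<in> {- H..0}" for z
        unfolding W_def[abs_def]
        by (rule has_vector_derivative_eq_rhs[OF has_vector_derivative_diff[OF
              has_vector_derivative_mult[OF wkb_columnD(2)[OF U z we] wkb_columnD(2)[OF V z we]]
              has_vector_derivative_mult[OF wkb_columnD(2)[OF V z we] wkb_columnD(2)[OF U z we]]]])
          (simp add: sum_2 algebra_simps)
      show "norm (reduced 1 1 z w + reduced 2 2 z w) \<le> 2 * M" if z: "z \<in> {- H..0}" for z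
        using norm_triangle_mono[OF M(2)[OF z w1] M(2)[OF z w1]] by simp
    qed (use H_pos M in auto)
    then have "norm (W (- H)) \<le> norm (W 0) * K" by (simp add: K_def)
    moreover have "2 * \<omega>\<^sup>2 * norm w \<le> norm (W (- H))"
    proof -
      have "norm w * norm w \<le> norm w * 1" using w1 by (intro mult_left_mono) auto
      also have "\<dots> \<le> mu0 / \<omega>\<^sup>2" using w \<delta> by simp
      finally have "\<omega>\<^sup>2 * (norm w)\<^sup>2 \<le> mu0" using omega_pos by (simp add: field_simps power2_eq_square)
      then have 1: "2 * mu0 \<le> norm (2 * of_real mu0 * (1 + jost_root (- 1) w) - of_real (\<omega>\<^sup>2) * w\<^sup>2 + (2 * of_real mu0 * (1 + jost_root 1 w) - of_real (\<omega>\<^sup>2) * w\<^sup>2))"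
        (is "_ \<le> norm ?a") using jost_root_norm_Re[of w] by simp
      have "W (- H) = of_real (\<omega>\<^sup>2) / of_real mu0 * w * ?a"
        unfolding W_def wkb_columnD(1)[OF U we] wkb_columnD(1)[OF V we] hplus_def
        by (simp add: algebra_simps)
      then have "norm (W (- H)) = \<omega>\<^sup>2 / mu0 * norm w * norm ?a"
        using mu0_pos by (simp add: norm_mult norm_divide norm_power)
      moreover have "\<omega>\<^sup>2 / mu0 * norm w * (2 * mu0) \<le> \<omega>\<^sup>2 / mu0 * norm w * norm ?a"
        using 1 mu0_pos by (intro mult_left_mono) auto
      ultimately show ?thesis using mu0_pos by simp
    qed
    ultimately have "2 * \<omega>\<^sup>2 * norm w \<le> norm (W 0) * K" by linarith
    then show "2 * \<omega>\<^sup>2 / K * norm w \<le> norm (U 1 0 w * V 2 0 w - V 1 0 w * U 2 0 w)"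
      by (simp add: W_def K_def field_simps)
  qed (use \<delta> omega_pos in \<open>auto simp: K_def\<close>)
qed

text \<open>In the cross product of two vectors (x, S x) the contribution of S 1 1 is symmetric and
  cancels; S 1 2 times the Wronskian remains. Each factor is at least a multiple of |w|, which
  exactly balances the prefactor \<xi>^2.\<close>

lemma same_sheet_nonzero:
  assumes C: "C > 0"
  obtains Rr where "Rr \<ge> 1" "\<And>\<xi>. norm \<xi> \<ge> Rr \<Longrightarrow> exp (H * \<bar>Re \<xi>\<bar>) \<le> C * (norm \<xi>)\<^sup>2 \<Longrightarrow>
    tdet \<xi> (data_P \<xi> (\<xi> * jost_root (- 1) (1/\<xi>))) (data_S \<xi> (\<xi> * jost_root 1 (1/\<xi>))) \<noteq> 0"
proof -
  obtain \<epsilon> Q B U V where UV: "0 < \<epsilon>" "\<epsilon> \<le> 1" "Q > 0" "B > 0" "wkb_column (- 1) \<epsilon> Q B U" "wkb_column 1 \<epsilon> Q B V"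
    by (rule wkb_columns)
  obtain c1 \<delta>1 where 1: "c1 > 0" "0 < \<delta>1" "\<delta>1 \<le> \<epsilon>"
    "\<And>w. norm w < \<delta>1 \<Longrightarrow> c1 * norm w \<le> norm (U 1 0 w * V 2 0 w - V 1 0 w * U 2 0 w)"
    by (rule wronskian_lower[OF UV(5,6,1,2)]) (rule that)
  obtain c2 \<delta>2 where 2: "c2 > 0" "0 < \<delta>2" "\<And>w. norm w < \<delta>2 \<Longrightarrow> c2 * norm w \<le> norm (S 1 2 0 w)"
    by (rule S12_lower) (rule that)
  have c12: "c1 * c2 > 0" using 1 2 by simp
  obtain R0 where R0: "R0 \<ge> 1"
    "\<And>x G. x \<ge> R0 \<Longrightarrow> 1 \<le> G \<Longrightarrow> G \<le> C * x\<^sup>2 \<Longrightarrow>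
       G\<^sup>2 * (4 * (x * G * B) * (Q * (1/x) ^ 13 * G\<^sup>2) + 2 * (Q * (1/x) ^ 13 * G\<^sup>2)\<^sup>2) < c1 * c2 \<and>
       x\<^sup>2 * (4 * (x * G * B) * (Q * (1/x) ^ 13 * G\<^sup>2) + 2 * (Q * (1/x) ^ 13 * G\<^sup>2)\<^sup>2) < c1 * c2"
    by (rule wkb_error_negligible[OF UV(4,3) C c12]) (rule that)
  define Rr where "Rr = max R0 (max (2 / \<delta>1) (2 / \<delta>2))"
  show thesis
  proof (rule that[of Rr])
    show "Rr \<ge> 1" using R0(1) by (simp add: Rr_def)
    fix \<xi> assume \<xi>: "norm \<xi> \<ge> Rr" and G: "exp (H * \<bar>Re \<xi>\<bar>) \<le> C * (norm \<xi>)\<^sup>2"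
    define G where "G = exp (H * \<bar>Re \<xi>\<bar>)"
    define w where "w = 1 / \<xi>"
    have x: "norm \<xi> \<ge> R0" "norm \<xi> \<ge> 2 / \<delta>1" "norm \<xi> \<ge> 2 / \<delta>2" "norm \<xi> \<ge> 1" using \<xi> R0(1) by (auto simp: Rr_def)
    then have \<xi>0: "\<xi> \<noteq> 0" by auto
    have nw: "norm w = 1 / norm \<xi>" by (simp add: w_def norm_divide)
    have "2 \<le> norm \<xi> * \<delta>1" "2 \<le> norm \<xi> * \<delta>2" using x(2,3) 1(2) 2(2) by (simp_all add: pos_divide_le_eq)
    then have w: "norm w < \<delta>1" "norm w < \<delta>2" unfolding nw using \<xi>0 by (simp_all add: divide_less_eq mult.commute)
    have we: "norm (1 / \<xi>) < \<epsilon>" using w 1(3) by (simp add: w_def)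
    define u where "u = data_P \<xi> (\<xi> * jost_root (- 1) (1/\<xi>))"
    define v where "v = data_S \<xi> (\<xi> * jost_root 1 (1/\<xi>))"
    have du: "jost_data (- 1) \<xi> (\<xi> * jost_root (- 1) (1/\<xi>)) = u" and dv: "jost_data 1 \<xi> (\<xi> * jost_root 1 (1/\<xi>)) = v"
      by (simp_all add: jost_data_def u_def v_def)
    define e where "e = exp (\<xi> * of_real H)"
    define K where "K = norm \<xi> * G * B"
    define er where "er = Q * (1 / norm \<xi>) ^ 13 * G\<^sup>2"
    have er_eq: "Q * norm (1/\<xi>) ^ 13 * exp (2 * H * \<bar>Re \<xi>\<bar>) = er"
      by (simp add: er_def norm_divide G_def exp_bounds(3))
    have Kb: "norm (\<xi> * e * s) \<le> K" if "norm s \<le> B" for s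
      unfolding norm_mult K_def e_def G_def using exp_bounds(1)[of \<xi>] that by (intro mult_mono) auto
    define x1 y1 x2 y2 where "x1 = \<xi> * e * U 1 0 w" and "y1 = \<xi> * e * (\<Sum>j\<in>UNIV. S 1 j 0 w * U j 0 w)"
      and "x2 = \<xi> * e * V 1 0 w" and "y2 = \<xi> * e * (\<Sum>j\<in>UNIV. S 1 j 0 w * V j 0 w)"
    note U = wkb_columnD[OF UV(5)] and V = wkb_columnD[OF UV(6)]
    have err: "norm ((plus_part \<xi> (sol \<xi> u) 1 0 * minus_part \<xi> (sol \<xi> v) 1 0 - plus_part \<xi> (sol \<xi> v) 1 0 * minus_part \<xi> (sol \<xi> u) 1 0)
        - (x1 * y2 - x2 * y1)) \<le> 4 * K * er + 2 * er\<^sup>2"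
    proof (rule cross_product_error)
      show "norm (plus_part \<xi> (sol \<xi> u) 1 0 - x1) \<le> er" using U(6)[OF \<xi>0 we, of 1] unfolding du er_eq x1_def e_def w_def .
      show "norm (minus_part \<xi> (sol \<xi> u) 1 0 - y1) \<le> er" using U(7)[OF \<xi>0 we, of 1] unfolding du er_eq y1_def e_def w_def .
      show "norm (plus_part \<xi> (sol \<xi> v) 1 0 - x2) \<le> er" using V(6)[OF \<xi>0 we, of 1] unfolding dv er_eq x2_def e_def w_def .
      show "norm (minus_part \<xi> (sol \<xi> v) 1 0 - y2) \<le> er" using V(7)[OF \<xi>0 we, of 1] unfolding dv er_eq y2_def e_def w_def .
      show "norm x1 \<le> K" "norm y1 \<le> K" "norm x2 \<le> K" "norm y2 \<le> K"
        unfolding x1_def y1_def x2_def y2_def w_def by (intro Kb U(4,5) V(4,5) we)+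
      show "0 \<le> er" using UV(3) by (simp add: er_def)
    qed
    have "x1 * y2 - x2 * y1 = (\<xi> * e)\<^sup>2 * (S 1 2 0 w * (U 1 0 w * V 2 0 w - V 1 0 w * U 2 0 w))"
      by (simp add: x1_def y1_def x2_def y2_def sum_2 power2_eq_square algebra_simps)
    then have "norm (x1 * y2 - x2 * y1) = (norm \<xi> * norm e)\<^sup>2 * (norm (S 1 2 0 w) * norm (U 1 0 w * V 2 0 w - V 1 0 w * U 2 0 w))"
      by (simp add: norm_mult norm_power)
    also have "\<dots> \<ge> (norm \<xi> * norm e)\<^sup>2 * ((c2 * norm w) * (c1 * norm w))"
      using 1 2 w by (intro mult_left_mono mult_mono) auto
    finally have main: "(norm \<xi> * norm e)\<^sup>2 * ((c2 * norm w) * (c1 * norm w)) \<le> norm (x1 * y2 - x2 * y1)" .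
    have "(norm \<xi> * norm e)\<^sup>2 * ((c2 * norm w) * (c1 * norm w)) = (norm e)\<^sup>2 * (c1 * c2)"
      using \<xi>0 by (simp add: nw power2_eq_square field_simps)
    with main have main2: "(norm e)\<^sup>2 * (c1 * c2) \<le> norm (x1 * y2 - x2 * y1)" by simp
    \<comment> \<open>For Re \<xi> < 0 the main term carries the small factor |e|^2. Multiplication
      by G^2 makes up for it; this is the origin of the G^2 in the first inequality of
      \<open>wkb_error_negligible\<close>.\<close>
    have eG: "1 \<le> G * norm e"
    proof -
      have "norm e * norm (exp (- \<xi> * of_real H)) = 1"
        by (simp add: e_def norm_mult[symmetric] exp_add[symmetric])
      moreover have "norm e * norm (exp (- \<xi> * of_real H)) \<le> norm e * G"
        using exp_bounds(2)[of \<xi>] by (intro mult_left_mono) (auto simp: G_def)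
      ultimately show ?thesis by (simp add: mult.commute)
    qed
    show "tdet \<xi> (data_P \<xi> (\<xi> * jost_root (- 1) (1/\<xi>))) (data_S \<xi> (\<xi> * jost_root 1 (1/\<xi>))) \<noteq> 0"
    proof
      assume "tdet \<xi> (data_P \<xi> (\<xi> * jost_root (- 1) (1/\<xi>))) (data_S \<xi> (\<xi> * jost_root 1 (1/\<xi>))) = 0"
      then have "plus_part \<xi> (sol \<xi> u) 1 0 * minus_part \<xi> (sol \<xi> v) 1 0 - plus_part \<xi> (sol \<xi> v) 1 0 * minus_part \<xi> (sol \<xi> u) 1 0 = 0"
        using \<xi>0 unfolding tdet_parts[OF \<xi>0] u_def[symmetric] v_def[symmetric] by simp
      with err have "norm (x1 * y2 - x2 * y1) \<le> 4 * K * er + 2 * er\<^sup>2" by (simp add: norm_minus_commute)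
      with main2 have "(norm e)\<^sup>2 * (c1 * c2) \<le> 4 * K * er + 2 * er\<^sup>2" by linarith
      then have "G\<^sup>2 * ((norm e)\<^sup>2 * (c1 * c2)) \<le> G\<^sup>2 * (4 * K * er + 2 * er\<^sup>2)"
        by (intro mult_left_mono) auto
      moreover have "G\<^sup>2 * (4 * K * er + 2 * er\<^sup>2) < c1 * c2"
        using R0(2)[OF x(1), of G] G exp_bounds(4)[of \<xi>] unfolding K_def er_def by (simp add: G_def)
      moreover have "1 * (c1 * c2) \<le> (G * norm e)\<^sup>2 * (c1 * c2)"
        using eG c12 by (intro mult_right_mono) (auto intro: one_le_power)
      ultimately show False by (simp add: power_mult_distrib mult.assoc)
    qed
  qed
qed

end

section \<open>Sheets whose exponents have opposite signs\<close>

context slab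
begin

text \<open>The reflection \<open>\<xi> \<mapsto> - \<xi>\<close> turns the exponent \<open>- \<xi> r\<close> into \<open>\<xi> r\<close>, to which the expansion along the
  invariant graph applies.\<close>

lemma tdet_opposite:
  assumes "\<xi> \<noteq> 0"
  shows "tdet \<xi> u (data_S \<xi> l) = - (\<xi>\<^sup>2 / 2) * (plus_part \<xi> (sol \<xi> u) 1 0 * plus_part (- \<xi>) (sol (- \<xi>) (data_S (- \<xi>) l)) 1 0
     - minus_part (- \<xi>) (sol (- \<xi>) (data_S (- \<xi>) l)) 1 0 * minus_part \<xi> (sol \<xi> u) 1 0)"
  using assms by (simp add: tdet_def plus_part_def minus_part_def sol_data_uminus flip_def power2_eq_square field_simps)

text \<open>The flux also involves the surface displacements. The second components contain 2 \<xi>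
  (y 1 + y 2) and 2 \<xi> (y 1 - y 2), and the tractions mixed into them are \<xi> times the first
  components; dividing by 2 \<xi> therefore loses no power of \<xi>.\<close>

lemma displacement_bound:
  obtains M where "M > 0" "\<And>\<xi> y D. norm \<xi> \<ge> 1 \<Longrightarrow> \<forall>i. norm (plus_part \<xi> y i 0) \<le> norm \<xi> * D \<Longrightarrow>
    \<forall>i. norm (minus_part \<xi> y i 0) \<le> norm \<xi> * D \<Longrightarrow> norm (y 1 0) \<le> M * (norm \<xi> * D) \<and> norm (y 2 0) \<le> M * (norm \<xi> * D)"
proof -
  obtain Mc where Mc: "Mc > 0" "\<And>z w. z \<in> {- H..0} \<Longrightarrow> norm w \<le> 1 \<Longrightarrow> norm (cm z w) \<le> Mc"
    using jholo_bounded_cball_1[OF flat_symbol_jholo[OF flat_cm]] by blast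
  have "jholo (- H) 0 UNIV dm" using is_deriv_dm flat_symbol_jholo unfolding is_deriv_def by blast
  then obtain Md where Md: "Md > 0" "\<And>z w. z \<in> {- H..0} \<Longrightarrow> norm w \<le> 1 \<Longrightarrow> norm (dm z w) \<le> Md"
    using jholo_bounded_cball_1 by blast
  define M where "M = 1 + Mc + Md"
  show thesis
  proof (rule that[of M])
    show "M > 0" using Mc Md by (simp add: M_def)
    fix \<xi> y D assume \<xi>: "norm \<xi> \<ge> 1" and "\<forall>i. norm (plus_part \<xi> y i 0) \<le> norm \<xi> * D"
      and "\<forall>i. norm (minus_part \<xi> y i 0) \<le> norm \<xi> * D"
    then have p: "\<And>i. norm (plus_part \<xi> y i 0) \<le> norm \<xi> * D"
      and m: "\<And>i. norm (minus_part \<xi> y i 0) \<le> norm \<xi> * D" by blast+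
    have \<xi>0: "\<xi> \<noteq> 0" using \<xi> by auto
    define w where "w = 1 / \<xi>"
    have w1: "norm w \<le> 1" using \<xi> \<xi>0 by (simp add: w_def norm_divide divide_le_eq_1)
    have z: "0 \<in> {- H..0}" using H_pos by simp
    define x where "x = norm \<xi> * D"
    have x0: "x \<ge> 0" using order_trans[OF norm_ge_zero p[of 1]] by (simp add: x_def)
    have b: "norm (g + (c * h + d / 2 * (h * w))) \<le> M * x * (2 * norm \<xi>)"
      if "norm g \<le> x" "norm h \<le> x * norm \<xi>" "norm c \<le> Mc" "norm d \<le> Md" for g c h d :: complex
    proof -
      have "norm (c * h) \<le> Mc * (x * norm \<xi>)" unfolding norm_mult using that Mc by (intro mult_mono) auto
      moreover have "norm (d / 2 * (h * w)) \<le> Md * ((x * norm \<xi>) * 1)"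
        unfolding norm_mult using that Md w1 x0 by (intro mult_mono) (auto simp: norm_divide)
      moreover have "x * 1 \<le> x * norm \<xi>" using \<xi> x0 by (intro mult_left_mono)
      then have "norm g \<le> x * norm \<xi>" using that(1) by simp
      ultimately have "norm (g + (c * h + d / 2 * (h * w))) \<le> x * norm \<xi> + (Mc * (x * norm \<xi>) + Md * ((x * norm \<xi>) * 1))"
        by (intro norm_triangle_mono)
      also have "\<dots> = M * x * norm \<xi>" by (simp add: M_def algebra_simps)
      also have "\<dots> \<le> M * x * (2 * norm \<xi>)" using Mc(1) Md(1) x0 by (intro mult_left_mono) (auto simp: M_def)
      finally show ?thesis .
    qed
    define h1 where "h1 = \<xi> * minus_part \<xi> y 1 0"
    define h2 where "h2 = \<xi> * plus_part \<xi> y 1 0"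
    have h: "norm h1 \<le> x * norm \<xi>" "norm h2 \<le> x * norm \<xi>"
      unfolding h1_def h2_def norm_mult x_def using mult_left_mono[OF m[of 1] norm_ge_zero[of \<xi>]] mult_left_mono[OF p[of 1] norm_ge_zero[of \<xi>]]
      by (simp_all only: mult_ac)
    have hy: "h1 = y 3 0 + y 4 0" "h2 = y 3 0 - y 4 0" using \<xi>0 by (simp_all add: h1_def h2_def plus_part_def minus_part_def)
    have e1: "2 * \<xi> * (y 1 0 + y 2 0) = plus_part \<xi> y 2 0 + ((- cm 0 w) * h1 + (- dm 0 w) / 2 * (h1 * w))"
      by (simp add: plus_part_def hy w_def)
    have e2: "2 * \<xi> * (y 1 0 - y 2 0) = - minus_part \<xi> y 2 0 + (cm 0 w * h2 + (- dm 0 w) / 2 * (h2 * w))"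
      by (simp add: minus_part_def hy w_def)
    have n1: "norm (2 * \<xi> * (y 1 0 + y 2 0)) \<le> M * x * (2 * norm \<xi>)"
      unfolding e1 by (rule b) (use p[of 2] h Mc(2)[OF z w1] Md(2)[OF z w1] in \<open>simp_all add: x_def\<close>)
    have n2: "norm (2 * \<xi> * (y 1 0 - y 2 0)) \<le> M * x * (2 * norm \<xi>)"
      unfolding e2 by (rule b) (use m[of 2] h Mc(2)[OF z w1] Md(2)[OF z w1] in \<open>simp_all add: x_def\<close>)
    have s: "norm (y 1 0 + y 2 0) \<le> M * x" "norm (y 1 0 - y 2 0) \<le> M * x"
    proof -
      have p: "0 < 2 * norm \<xi>" using \<xi>0 by simp
      have nn: "norm (2 * \<xi> * a) = norm a * (2 * norm \<xi>)" for a by (simp add: norm_mult)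
      have "norm (y 1 0 + y 2 0) * (2 * norm \<xi>) \<le> M * x * (2 * norm \<xi>)" "norm (y 1 0 - y 2 0) * (2 * norm \<xi>) \<le> M * x * (2 * norm \<xi>)"
        using n1 n2 unfolding nn by blast+
      then show "norm (y 1 0 + y 2 0) \<le> M * x" "norm (y 1 0 - y 2 0) \<le> M * x"
        using mult_right_le_imp_le[OF _ p] by blast+
    qed
    have "norm (2 * y 1 0) \<le> 2 * (M * x)" "norm (2 * y 2 0) \<le> 2 * (M * x)"
      using norm_triangle_mono[OF s] order_trans[OF norm_triangle_ineq4 add_mono[OF s]] by simp_all
    then show "norm (y 1 0) \<le> M * (norm \<xi> * D) \<and> norm (y 2 0) \<le> M * (norm \<xi> * D)"
      by (simp add: norm_mult x_def)
  qed
qed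

text \<open>On the imaginary axis the energy flux is a sesquilinear invariant of signature (2, 2) that vanishes on
  traction-free states and is positive on the span of a P and an S wave whose exponents have
  opposite signs.\<close>

lemma flux_imp_tdet_lower:
  fixes t rP rS K :: real
  assumes t: "t > 0" and r: "rP \<ge> 1" "rS \<ge> 1" and K: "K > 0"
  defines "\<xi> \<equiv> \<i> * complex_of_real t"
  defines "u \<equiv> data_P \<xi> (\<xi> * of_real rP)" and "v \<equiv> data_S \<xi> (- (\<xi> * of_real rS))"
  assumes bu: "norm (sol \<xi> u 1 0) \<le> K * t" "norm (sol \<xi> u 2 0) \<le> K * t"
    and bv: "norm (sol \<xi> v 1 0) \<le> K * t" "norm (sol \<xi> v 2 0) \<le> K * t"
  shows "norm (tdet \<xi> u v) \<ge> 1 / (2 * (2 * K / \<omega>\<^sup>2)\<^sup>2)"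
proof -
  define K1 where "K1 = 2 * K / \<omega>\<^sup>2"
  have K1: "K1 > 0" using K omega_pos by (simp add: K1_def)
  define u3 u4 v3 v4 where "u3 = sol \<xi> u 3 0" and "u4 = sol \<xi> u 4 0" and "v3 = sol \<xi> v 3 0" and "v4 = sol \<xi> v 4 0"
  \<comment> \<open>The flux is at least t \<omega>^2 (|c1|^2 + |c2|^2), and at the surface it is at
    most displacement times traction, where the displacement is at most K t (|c1| + |c2|). One
    factor |c1| + |c2| and the factor t cancel, so tractions bound the coefficients uniformly in
    t.\<close>
  have key: "norm c1 + norm c2 \<le> K1 * (norm (c1 * u3 + c2 * v3) + norm (c1 * u4 + c2 * v4))" for c1 c2
  proof -
    define s where "s = norm c1 + norm c2"
    define T where "T = norm (c1 * u3 + c2 * v3) + norm (c1 * u4 + c2 * v4)"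
    have T0: "T \<ge> 0" by (simp add: T_def)
    define V where "V i = c1 * u i + c2 * v i" for i
    have y: "sol \<xi> V i 0 = c1 * sol \<xi> u i 0 + c2 * sol \<xi> v i 0" for i
      unfolding V_def by (rule sol_linear)
    have b: "norm (sol \<xi> V i 0) \<le> s * (K * t)" if "i = 1 \<or> i = 2" for i
    proof -
      have "norm (c1 * sol \<xi> u i 0) \<le> norm c1 * (K * t)" "norm (c2 * sol \<xi> v i 0) \<le> norm c2 * (K * t)"
        unfolding norm_mult using that bu bv by (auto intro!: mult_left_mono)
      from norm_triangle_mono[OF this] show ?thesis by (simp add: y s_def algebra_simps)
    qed
    have "Im (sol \<xi> V 1 0 * cnj (sol \<xi> V 3 0) - sol \<xi> V 2 0 * cnj (sol \<xi> V 4 0))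
        = Im (V 1 * cnj (V 3) - V 2 * cnj (V 4))"
      using flux_conserved[of t "sol \<xi> V"] t sol_ode[of \<xi> V] by (simp add: \<xi>_def sol_init)
    also have "\<dots> = t * \<omega>\<^sup>2 * (rP * (norm c1)\<^sup>2 + rS * (norm c2)\<^sup>2)"
      by (rule flux_initial) (simp add: V_def u_def v_def \<xi>_def)
    finally have fl: "t * \<omega>\<^sup>2 * (rP * (norm c1)\<^sup>2 + rS * (norm c2)\<^sup>2)
        = Im (sol \<xi> V 1 0 * cnj (sol \<xi> V 3 0) - sol \<xi> V 2 0 * cnj (sol \<xi> V 4 0))" by simp
    have "t * \<omega>\<^sup>2 * (1 * (norm c1)\<^sup>2 + 1 * (norm c2)\<^sup>2) \<le> t * \<omega>\<^sup>2 * (rP * (norm c1)\<^sup>2 + rS * (norm c2)\<^sup>2)"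
      using t r by (intro mult_left_mono add_mono mult_right_mono) auto
    also have "\<dots> \<le> norm (sol \<xi> V 1 0 * cnj (sol \<xi> V 3 0) - sol \<xi> V 2 0 * cnj (sol \<xi> V 4 0))"
      unfolding fl using abs_Im_le_cmod abs_ge_self order_trans by blast
    also have "\<dots> \<le> norm (sol \<xi> V 1 0) * norm (sol \<xi> V 3 0) + norm (sol \<xi> V 2 0) * norm (sol \<xi> V 4 0)"
      by (rule order_trans[OF norm_triangle_ineq4]) (simp add: norm_mult)
    also have "\<dots> \<le> s * (K * t) * norm (sol \<xi> V 3 0) + s * (K * t) * norm (sol \<xi> V 4 0)"
      by (intro add_mono mult_right_mono b) auto
    also have "\<dots> = t * (K * s * T)" by (simp add: y T_def u3_def u4_def v3_def v4_def algebra_simps)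
    finally have "t * (\<omega>\<^sup>2 * ((norm c1)\<^sup>2 + (norm c2)\<^sup>2)) \<le> t * (K * s * T)" by (simp add: mult.assoc)
    then have 1: "\<omega>\<^sup>2 * ((norm c1)\<^sup>2 + (norm c2)\<^sup>2) \<le> K * s * T" using t by simp
    have "s\<^sup>2 \<le> 2 * ((norm c1)\<^sup>2 + (norm c2)\<^sup>2)"
      unfolding s_def using sum_squares_bound[of "norm c1" "norm c2"] by (simp add: power2_sum)
    then have "\<omega>\<^sup>2 * s\<^sup>2 \<le> \<omega>\<^sup>2 * (2 * ((norm c1)\<^sup>2 + (norm c2)\<^sup>2))" by (intro mult_left_mono) auto
    with 1 have "s * (\<omega>\<^sup>2 * s) \<le> s * (2 * K * T)" by (simp add: power2_eq_square algebra_simps)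
    moreover have "s \<ge> 0" by (simp add: s_def)
    ultimately have "\<omega>\<^sup>2 * s \<le> 2 * K * T \<or> s = 0"
      using mult_left_le_imp_le[of s "\<omega>\<^sup>2 * s" "2 * K * T"] by linarith
    then have "s \<le> K1 * T"
      using omega_pos K1 T0 by (auto simp: K1_def field_simps)
    then show ?thesis by (simp add: s_def T_def)
  qed
  define d where "d = norm (tdet \<xi> u v)"
  \<comment> \<open>As in Cramer's rule: v3 and - u3 cancel the third component and leave the
    determinant, up to sign, in the fourth; the next line exchanges the roles of the two
    components.\<close>
  have 3: "norm v3 + norm u3 \<le> K1 * d"
    using key[of v3 "- u3"] by (simp add: d_def tdet_def u3_def u4_def v3_def v4_def mult.commute norm_minus_commute)
  have 4: "norm v4 + norm u4 \<le> K1 * d"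
    using key[of v4 "- u4"] by (simp add: d_def tdet_def u3_def u4_def v3_def v4_def mult.commute)
  \<comment> \<open>With c1 = 1 and c2 = 0, \<open>key\<close> shows that the first traction column
    is not small, so the determinant that bounds it cannot be small either.\<close>
  have "1 \<le> K1 * (norm u3 + norm u4)" using key[of 1 0] by simp
  also have "\<dots> \<le> K1 * (K1 * d + K1 * d)"
    using 3 4 norm_ge_zero[of v3] norm_ge_zero[of v4] K1 by (intro mult_left_mono add_mono; linarith)
  finally have "1 \<le> 2 * K1\<^sup>2 * d" by (simp add: power2_eq_square algebra_simps)
  then show ?thesis using K1 unfolding d_def K1_def[symmetric] by (simp add: divide_le_eq mult.commute)
qed

end

context slab_graph
begin

text \<open>At w = 1 / (i t) the radicand is 1 + \<omega>^2 / (p t^2), real and at least 1. So the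
  exponents are real multiples of \<xi>, as the flux computation requires.\<close>

lemma jost_root_imaginary:
  assumes "t > 0"
  obtains r where "r \<ge> 1" "jost_root s (1 / (\<i> * complex_of_real t)) = complex_of_real r"
proof -
  define p where "p = (if s = 1 then mu0 else lam0 + 2 * mu0)"
  have p: "p > 0" using mu0_pos sg0_pos by (simp add: p_def)
  define x where "x = 1 + \<omega>\<^sup>2 / p * (1 / t)\<^sup>2"
  have x: "x \<ge> 1" using p by (simp add: x_def)
  have "1 - of_real (\<omega>\<^sup>2 / p) * (1 / (\<i> * complex_of_real t))\<^sup>2 = complex_of_real x"
    by (simp add: x_def power_divide power_mult_distrib)
  then have "jost_root s (1 / (\<i> * complex_of_real t)) = csqrt (of_real x)"
    by (simp add: jost_root_def p_def)
  also have "\<dots> = of_real (sqrt x)" using x by simp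
  finally show thesis using x by (intro that[of "sqrt x"]) auto
qed

text \<open>The factor exp (\<xi> H) of the P column meets exp (- \<xi> H) of the reflected S
  column. The exponentials cancel and the leading term is \<xi>^2 times a function holomorphic in
  w.\<close>

lemma opposite_error:
  assumes U: "wkb_column (- 1) \<epsilon> Q B U" and V: "wkb_column 1 \<epsilon> Q B V" and Q: "Q > 0"
    and \<xi>: "\<xi> \<noteq> 0" "norm (1/\<xi>) < \<epsilon>"
  defines "d \<equiv> \<lambda>w. U 1 0 w * V 1 0 (- w) - (\<Sum>j\<in>UNIV. S 1 j 0 (- w) * V j 0 (- w)) * (\<Sum>j\<in>UNIV. S 1 j 0 w * U j 0 w)"
    and "G \<equiv> exp (H * \<bar>Re \<xi>\<bar>)"
  shows "norm (- (2 / \<xi>\<^sup>2) * tdet \<xi> (data_P \<xi> (\<xi> * jost_root (- 1) (1/\<xi>))) (data_S \<xi> (- (\<xi> * jost_root 1 (1/\<xi>)))) + \<xi>\<^sup>2 * d (1/\<xi>))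
     \<le> 4 * (norm \<xi> * G * B) * (Q * (1 / norm \<xi>) ^ 13 * G\<^sup>2) + 2 * (Q * (1 / norm \<xi>) ^ 13 * G\<^sup>2)\<^sup>2"
proof -
  define w where "w = 1 / \<xi>"
  define u where "u = data_P \<xi> (\<xi> * jost_root (- 1) (1/\<xi>))"
  define v where "v = data_S (- \<xi>) (- (\<xi> * jost_root 1 (1/\<xi>)))"
  have du: "jost_data (- 1) \<xi> (\<xi> * jost_root (- 1) (1/\<xi>)) = u"
    by (simp add: jost_data_def u_def)
  have dv: "jost_data 1 (- \<xi>) (- \<xi> * jost_root 1 (1/- \<xi>)) = v"
    using jost_root_uminus[of 1 "1 / \<xi>"] by (simp add: jost_data_def v_def)
  have m\<xi>: "- \<xi> \<noteq> 0" "norm (1 / - \<xi>) < \<epsilon>" using \<xi> by simp_all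
  have mw: "1 / - \<xi> = - w" by (simp add: w_def)
  define er where "er = Q * (1 / norm \<xi>) ^ 13 * G\<^sup>2"
  define K where "K = norm \<xi> * G * B"
  have er_eq: "Q * norm (1/\<xi>) ^ 13 * exp (2 * H * \<bar>Re \<xi>\<bar>) = er" "Q * norm (1/- \<xi>) ^ 13 * exp (2 * H * \<bar>Re (- \<xi>)\<bar>) = er"
    by (simp_all add: er_def norm_divide G_def exp_bounds(3))
  have Kb: "norm (\<xi> * exp (\<xi> * of_real H) * s) \<le> K" "norm (- \<xi> * exp (- \<xi> * of_real H) * s) \<le> K" if "norm s \<le> B" for s
    unfolding norm_mult K_def G_def using exp_bounds(1,2)[of \<xi>] that by (intro mult_mono; simp)+
  define x y x' y' where "x = \<xi> * exp (\<xi> * of_real H) * U 1 0 w" and "y = \<xi> * exp (\<xi> * of_real H) * (\<Sum>j\<in>UNIV. S 1 j 0 w * U j 0 w)"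
    and "x' = - \<xi> * exp (- \<xi> * of_real H) * (\<Sum>j\<in>UNIV. S 1 j 0 (- w) * V j 0 (- w))" and "y' = - \<xi> * exp (- \<xi> * of_real H) * V 1 0 (- w)"
  note U' = wkb_columnD[OF U] and V' = wkb_columnD[OF V]
  have err: "norm ((plus_part \<xi> (sol \<xi> u) 1 0 * plus_part (- \<xi>) (sol (- \<xi>) v) 1 0 - minus_part (- \<xi>) (sol (- \<xi>) v) 1 0 * minus_part \<xi> (sol \<xi> u) 1 0)
      - (x * y' - x' * y)) \<le> 4 * K * er + 2 * er\<^sup>2"
  proof (rule cross_product_error)
    show "norm (plus_part \<xi> (sol \<xi> u) 1 0 - x) \<le> er" using U'(6)[OF \<xi>, of 1] unfolding du er_eq x_def w_def .
    show "norm (minus_part \<xi> (sol \<xi> u) 1 0 - y) \<le> er" using U'(7)[OF \<xi>, of 1] unfolding du er_eq y_def w_def .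
    show "norm (plus_part (- \<xi>) (sol (- \<xi>) v) 1 0 - y') \<le> er" using V'(6)[OF m\<xi>, of 1] unfolding dv er_eq unfolding mw y'_def .
    show "norm (minus_part (- \<xi>) (sol (- \<xi>) v) 1 0 - x') \<le> er" using V'(7)[OF m\<xi>, of 1] unfolding dv er_eq unfolding mw x'_def .
    show "norm x \<le> K" "norm y \<le> K" unfolding x_def y_def w_def by (intro Kb U'(4,5) \<xi>)+
    show "norm x' \<le> K" "norm y' \<le> K" unfolding x'_def y'_def mw[symmetric] by (intro Kb V'(4,5) m\<xi>)+
    show "0 \<le> er" using Q by (simp add: er_def)
  qed
  have ee: "exp (\<xi> * of_real H) * exp (- \<xi> * of_real H) = 1" by (simp add: exp_add[symmetric])
  have "x * y' - x' * y = - (\<xi>\<^sup>2) * (exp (\<xi> * of_real H) * exp (- \<xi> * of_real H)) * d w"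
    by (simp add: x_def y_def x'_def y'_def d_def power2_eq_square algebra_simps)
  have cancel: "- (2 / \<xi>\<^sup>2) * (- (\<xi>\<^sup>2 / 2) * z) = z" for z using \<xi>(1) by simp
  from \<open>x * y' - x' * y = _\<close> have "x * y' - x' * y = - (\<xi>\<^sup>2 * d w)" unfolding ee by simp
  moreover have "- (2 / \<xi>\<^sup>2) * tdet \<xi> u (data_S \<xi> (- (\<xi> * jost_root 1 (1/\<xi>))))
      = plus_part \<xi> (sol \<xi> u) 1 0 * plus_part (- \<xi>) (sol (- \<xi>) v) 1 0 - minus_part (- \<xi>) (sol (- \<xi>) v) 1 0 * minus_part \<xi> (sol \<xi> u) 1 0"
    unfolding tdet_opposite[OF \<xi>(1)] v_def by (rule cancel)
  ultimately show ?thesis using err unfolding u_def w_def K_def er_def by simp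
qed

text \<open>For \<xi> = i t the flux bounds tdet below by a constant, and by
  \<open>opposite_error\<close> t^2 |d| agrees with 2 |tdet| / t^2 up to a smaller error, so |d|
  \<ge> c0 t^(-4). Hence d vanishes at 0 to order at most 4, and |\<xi>^4 d (1/\<xi>)| stays above a
  constant for all large \<xi>; the second inequality of \<open>wkb_error_negligible\<close> is made
  for this comparison.\<close>

lemma opposite_sheet_nonzero:
  assumes C: "C > 0"
  obtains Rr where "Rr \<ge> 1" "\<And>\<xi>. norm \<xi> \<ge> Rr \<Longrightarrow> exp (H * \<bar>Re \<xi>\<bar>) \<le> C * (norm \<xi>)\<^sup>2 \<Longrightarrow>
    tdet \<xi> (data_P \<xi> (\<xi> * jost_root (- 1) (1/\<xi>))) (data_S \<xi> (- (\<xi> * jost_root 1 (1/\<xi>)))) \<noteq> 0"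
proof -
  obtain \<epsilon> Q B U V where UV: "0 < \<epsilon>" "\<epsilon> \<le> 1" "Q > 0" "B > 0" "wkb_column (- 1) \<epsilon> Q B U" "wkb_column 1 \<epsilon> Q B V"
    by (rule wkb_columns)
  note U = wkb_columnD[OF UV(5)] and V = wkb_columnD[OF UV(6)]
  define d where "d = (\<lambda>w. U 1 0 w * V 1 0 (- w) - (\<Sum>j\<in>UNIV. S 1 j 0 (- w) * V j 0 (- w)) * (\<Sum>j\<in>UNIV. S 1 j 0 w * U j 0 w))"
  have 0: "0 \<in> {- H..0}" using H_pos by simp
  have hS: "S i j 0 holomorphic_on A" for i j A
    using jholo_holomorphic[OF jholo_graph(1) 0] holomorphic_on_subset by blast
  have um: "uminus holomorphic_on ball (0::complex) \<epsilon>" using holomorphic_on_minus[OF holomorphic_on_ident] .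
  have im: "uminus ` ball (0::complex) \<epsilon> \<subseteq> ball 0 \<epsilon>" by auto
  have hV: "(\<lambda>w. V i 0 (- w)) holomorphic_on ball 0 \<epsilon>" for i
    using holomorphic_on_compose_gen[OF um V(3) im] by (simp add: o_def)
  have hS': "(\<lambda>w. S i j 0 (- w)) holomorphic_on ball 0 \<epsilon>" for i j
    using holomorphic_on_compose_gen[OF um hS[of i j UNIV]] by (simp add: o_def)
  have hold: "d holomorphic_on ball 0 \<epsilon>"
    unfolding d_def by (intro holomorphic_intros hS hV hS' U(3))
  obtain M where M: "M > 0" "\<And>\<xi> y D. norm \<xi> \<ge> 1 \<Longrightarrow> \<forall>i. norm (plus_part \<xi> y i 0) \<le> norm \<xi> * D \<Longrightarrow>
    \<forall>i. norm (minus_part \<xi> y i 0) \<le> norm \<xi> * D \<Longrightarrow> norm (y 1 0) \<le> M * (norm \<xi> * D) \<and> norm (y 2 0) \<le> M * (norm \<xi> * D)"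
    by (rule displacement_bound) (rule that)
  define K where "K = M * (B + Q)"
  have K: "K > 0" using M UV by (simp add: K_def)
  define c0 where "c0 = 1 / (2 * (2 * K / \<omega>\<^sup>2)\<^sup>2)"
  have c0: "c0 > 0" using K omega_pos by (simp add: c0_def)
  \<comment> \<open>This instance serves only the imaginary axis, where G = 1, so C = 1 is
    enough.\<close>
  obtain R0 where R0: "R0 \<ge> 1"
    "\<And>x G. x \<ge> R0 \<Longrightarrow> 1 \<le> G \<Longrightarrow> G \<le> 1 * x\<^sup>2 \<Longrightarrow>
       G\<^sup>2 * (4 * (x * G * B) * (Q * (1/x) ^ 13 * G\<^sup>2) + 2 * (Q * (1/x) ^ 13 * G\<^sup>2)\<^sup>2) < c0 \<and>
       x\<^sup>2 * (4 * (x * G * B) * (Q * (1/x) ^ 13 * G\<^sup>2) + 2 * (Q * (1/x) ^ 13 * G\<^sup>2)\<^sup>2) < c0"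
    by (rule wkb_error_negligible[OF UV(4,3) zero_less_one c0]) (rule that)
  define t0 where "t0 = max R0 (2 / \<epsilon>)"
  have ray: "norm (d (1 / (\<i> * of_real t))) \<ge> c0 * (1 / t) ^ 4" if tt: "t \<ge> t0" for t
  proof -
    have t: "t \<ge> R0" "t \<ge> 2 / \<epsilon>" "t \<ge> 1" "t > 0" using tt R0(1) by (auto simp: t0_def)
    define \<xi> where "\<xi> = \<i> * complex_of_real t"
    have n\<xi>: "norm \<xi> = t" "Re \<xi> = 0" "\<xi> \<noteq> 0" using t by (auto simp: \<xi>_def norm_mult)
    have "2 \<le> t * \<epsilon>" using t(2) UV(1) by (simp add: pos_divide_le_eq)
    then have we: "norm (1 / \<xi>) < \<epsilon>" using t n\<xi> by (simp add: norm_divide divide_less_eq mult.commute)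
    have we': "norm (1 / - \<xi>) < \<epsilon>" "- \<xi> \<noteq> 0" using we n\<xi> by simp_all
    obtain rP where rP: "rP \<ge> 1" "jost_root (- 1) (1/\<xi>) = of_real rP" unfolding \<xi>_def by (rule jost_root_imaginary[OF t(4)])
    obtain rS where rS: "rS \<ge> 1" "jost_root 1 (1/\<xi>) = of_real rS" unfolding \<xi>_def by (rule jost_root_imaginary[OF t(4)])
    define u where "u = data_P \<xi> (\<xi> * of_real rP)"
    define v where "v = data_S \<xi> (- (\<xi> * of_real rS))"
    have col: "norm a \<le> norm \<xi>' * (B + Q)"
      if "norm (a - \<xi>' * exp (\<xi>' * of_real H) * b) \<le> Q * norm (1/\<xi>') ^ 13 * exp (2 * H * \<bar>Re \<xi>'\<bar>)" "norm b \<le> B" "\<xi>' = \<xi> \<or> \<xi>' = - \<xi>" for a b \<xi>'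
    proof -
      have f: "norm \<xi>' = t" "Re \<xi>' = 0" using that(3) n\<xi> by auto
      have "norm (\<xi>' * exp (\<xi>' * of_real H) * b) \<le> t * 1 * B"
        unfolding norm_mult f using that(2) t f by (intro mult_mono) (auto simp: norm_exp_eq_Re)
      moreover have "Q * norm (1/\<xi>') ^ 13 * exp (2 * H * \<bar>Re \<xi>'\<bar>) \<le> Q * 1 * 1"
        using UV(3) f t by (intro mult_mono power_le_one) (auto simp: norm_divide)
      moreover have "Q * 1 \<le> Q * t" using UV(3) t by (intro mult_left_mono) auto
      moreover have "norm a \<le> norm (a - \<xi>' * exp (\<xi>' * of_real H) * b) + norm (\<xi>' * exp (\<xi>' * of_real H) * b)"
        using norm_triangle_ineq[of "a - \<xi>' * exp (\<xi>' * of_real H) * b" "\<xi>' * exp (\<xi>' * of_real H) * b"] by simp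
      ultimately show ?thesis using that(1) unfolding f by (simp add: algebra_simps)
    qed
    have du: "jost_data (- 1) \<xi> (\<xi> * jost_root (- 1) (1/\<xi>)) = u" by (simp add: jost_data_def u_def rP)
    have dv: "jost_data 1 (- \<xi>) (- \<xi> * jost_root 1 (1/- \<xi>)) = data_S (- \<xi>) (- (\<xi> * of_real rS))"
      using jost_root_uminus[of 1 "1 / \<xi>"] by (simp add: jost_data_def rS)
    have bu: "norm (sol \<xi> u 1 0) \<le> M * (norm \<xi> * (B + Q)) \<and> norm (sol \<xi> u 2 0) \<le> M * (norm \<xi> * (B + Q))"
    proof (rule M(2); (rule allI)?)
      show "norm (plus_part \<xi> (sol \<xi> u) i 0) \<le> norm \<xi> * (B + Q)" for i
        by (rule col[OF U(6)[OF n\<xi>(3) we, unfolded du] U(4)[OF we]]) simp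
      show "norm (minus_part \<xi> (sol \<xi> u) i 0) \<le> norm \<xi> * (B + Q)" for i
        by (rule col[OF U(7)[OF n\<xi>(3) we, unfolded du] U(5)[OF we]]) simp
    qed (use t n\<xi> in simp)
    have "norm (sol (- \<xi>) (data_S (- \<xi>) (- (\<xi> * of_real rS))) 1 0) \<le> M * (norm (- \<xi>) * (B + Q)) \<and>
        norm (sol (- \<xi>) (data_S (- \<xi>) (- (\<xi> * of_real rS))) 2 0) \<le> M * (norm (- \<xi>) * (B + Q))"
    proof (rule M(2); (rule allI)?)
      show "norm (plus_part (- \<xi>) (sol (- \<xi>) (data_S (- \<xi>) (- (\<xi> * of_real rS)))) i 0) \<le> norm (- \<xi>) * (B + Q)" for i
        by (rule col[OF V(6)[OF we'(2,1), unfolded dv] V(4)[OF we'(1)]]) simp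
      show "norm (minus_part (- \<xi>) (sol (- \<xi>) (data_S (- \<xi>) (- (\<xi> * of_real rS)))) i 0) \<le> norm (- \<xi>) * (B + Q)" for i
        by (rule col[OF V(7)[OF we'(2,1), unfolded dv] V(5)[OF we'(1)]]) simp
    qed (use t n\<xi> in simp)
    then have bv: "norm (sol \<xi> v 1 0) \<le> M * (norm \<xi> * (B + Q)) \<and> norm (sol \<xi> v 2 0) \<le> M * (norm \<xi> * (B + Q))"
      unfolding sol_data_uminus by (simp add: flip_def v_def)
    have td: "norm (tdet \<xi> u v) \<ge> c0"
      unfolding c0_def u_def v_def \<xi>_def
      by (rule flux_imp_tdet_lower[OF t(4) rP(1) rS(1) K])
        (use bu bv n\<xi> in \<open>auto simp: K_def u_def v_def \<xi>_def mult_ac\<close>)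
    define X where "X = 4 * (t * 1 * B) * (Q * (1/t) ^ 13 * 1\<^sup>2) + 2 * (Q * (1/t) ^ 13 * 1\<^sup>2)\<^sup>2"
    have "norm (- (2 / \<xi>\<^sup>2) * tdet \<xi> u v + \<xi>\<^sup>2 * d (1/\<xi>)) \<le> X"
      using opposite_error[OF UV(5,6,3) n\<xi>(3) we] unfolding n\<xi> rP rS d_def X_def u_def v_def by simp
    then have "norm (- (2 / \<xi>\<^sup>2) * tdet \<xi> u v) \<le> X + norm (\<xi>\<^sup>2 * d (1/\<xi>))"
      using norm_triangle_ineq4[of "- (2 / \<xi>\<^sup>2) * tdet \<xi> u v + \<xi>\<^sup>2 * d (1/\<xi>)" "\<xi>\<^sup>2 * d (1/\<xi>)"] by simp
    then have 1: "2 / t\<^sup>2 * norm (tdet \<xi> u v) \<le> X + t\<^sup>2 * norm (d (1/\<xi>))"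
      by (simp add: norm_mult norm_divide norm_power n\<xi>)
    have 2: "t\<^sup>2 * X < c0" using R0(2)[OF t(1), of 1] t unfolding X_def by simp
    have "2 * c0 \<le> t\<^sup>2 * (2 / t\<^sup>2 * norm (tdet \<xi> u v))" using td t by simp
    also have "\<dots> \<le> t\<^sup>2 * (X + t\<^sup>2 * norm (d (1/\<xi>)))" by (intro mult_left_mono 1) simp
    finally have "2 * c0 \<le> t\<^sup>2 * X + t\<^sup>2 * (t\<^sup>2 * norm (d (1/\<xi>)))" by (simp add: distrib_left)
    with 2 have "c0 \<le> t ^ 4 * norm (d (1/\<xi>))" by (simp add: power2_eq_square power4_eq_xxxx)
    then show ?thesis using t by (simp add: \<xi>_def power_divide divide_le_eq mult.commute)
  qed
  obtain c' \<epsilon>' where c': "c' > 0" "\<epsilon>' > 0" "\<And>w. norm w < \<epsilon>' \<Longrightarrow> norm (d w) \<ge> c' * norm w ^ 4"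
    by (rule holomorphic_lower_bound_from_ray[OF hold UV(1) c0 ray]) (assumption, rule that)
  obtain R1 where R1: "R1 \<ge> 1"
    "\<And>x G. x \<ge> R1 \<Longrightarrow> 1 \<le> G \<Longrightarrow> G \<le> C * x\<^sup>2 \<Longrightarrow>
       G\<^sup>2 * (4 * (x * G * B) * (Q * (1/x) ^ 13 * G\<^sup>2) + 2 * (Q * (1/x) ^ 13 * G\<^sup>2)\<^sup>2) < c' \<and>
       x\<^sup>2 * (4 * (x * G * B) * (Q * (1/x) ^ 13 * G\<^sup>2) + 2 * (Q * (1/x) ^ 13 * G\<^sup>2)\<^sup>2) < c'"
    by (rule wkb_error_negligible[OF UV(4,3) C c'(1)]) (rule that)
  define Rr where "Rr = max R1 (max (2 / \<epsilon>) (2 / \<epsilon>'))"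
  show thesis
  proof (rule that[of Rr])
    show "Rr \<ge> 1" using R1(1) by (simp add: Rr_def)
    fix \<xi> assume \<xi>: "norm \<xi> \<ge> Rr" and G: "exp (H * \<bar>Re \<xi>\<bar>) \<le> C * (norm \<xi>)\<^sup>2"
    have x: "norm \<xi> \<ge> R1" "norm \<xi> \<ge> 2 / \<epsilon>" "norm \<xi> \<ge> 2 / \<epsilon>'" "norm \<xi> \<ge> 1" using \<xi> R1(1) by (auto simp: Rr_def)
    then have \<xi>0: "\<xi> \<noteq> 0" by auto
    have "2 \<le> norm \<xi> * \<epsilon>" "2 \<le> norm \<xi> * \<epsilon>'" using x(2,3) UV(1) c'(2) by (simp_all add: pos_divide_le_eq)
    then have w: "norm (1 / \<xi>) < \<epsilon>" "norm (1 / \<xi>) < \<epsilon>'" using \<xi>0 by (simp_all add: norm_divide divide_less_eq mult.commute)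
    show "tdet \<xi> (data_P \<xi> (\<xi> * jost_root (- 1) (1/\<xi>))) (data_S \<xi> (- (\<xi> * jost_root 1 (1/\<xi>)))) \<noteq> 0"
    proof
      assume "tdet \<xi> (data_P \<xi> (\<xi> * jost_root (- 1) (1/\<xi>))) (data_S \<xi> (- (\<xi> * jost_root 1 (1/\<xi>)))) = 0"
      with opposite_error[OF UV(5,6,3) \<xi>0 w(1)]
      have "norm (\<xi>\<^sup>2 * d (1/\<xi>)) \<le> 4 * (norm \<xi> * exp (H * \<bar>Re \<xi>\<bar>) * B) * (Q * (1 / norm \<xi>) ^ 13 * (exp (H * \<bar>Re \<xi>\<bar>))\<^sup>2) + 2 * (Q * (1 / norm \<xi>) ^ 13 * (exp (H * \<bar>Re \<xi>\<bar>))\<^sup>2)\<^sup>2"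
        (is "_ \<le> ?X") by (simp add: d_def)
      then have "(norm \<xi>)\<^sup>2 * norm (\<xi>\<^sup>2 * d (1/\<xi>)) \<le> (norm \<xi>)\<^sup>2 * ?X" by (intro mult_left_mono) auto
      also have "\<dots> < c'" using R1(2)[OF x(1) exp_bounds(4) G] by blast
      finally have 1: "(norm \<xi>)\<^sup>2 * norm (\<xi>\<^sup>2 * d (1/\<xi>)) < c'" .
      have "norm \<xi> ^ 4 * (c' * norm (1/\<xi>) ^ 4) \<le> norm \<xi> ^ 4 * norm (d (1/\<xi>))"
        by (intro mult_left_mono c'(3) w) auto
      moreover have "norm \<xi> ^ 4 * (c' * norm (1/\<xi>) ^ 4) = c'" using \<xi>0 by (simp add: norm_divide power_divide)
      moreover have "norm \<xi> ^ 4 * norm (d (1/\<xi>)) = (norm \<xi>)\<^sup>2 * norm (\<xi>\<^sup>2 * d (1/\<xi>))"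
        by (simp add: norm_mult norm_power power2_eq_square power4_eq_xxxx)
      ultimately show False using 1 by linarith
    qed
  qed
qed

end

section \<open>Jost solutions and resonances\<close>

lemma has_vector_derivative_vec_nth:
  fixes f :: "real \<Rightarrow> complex ^ 'n"
  assumes "(f has_vector_derivative f') (at x within S)"
  shows "((\<lambda>x. f x $ i) has_vector_derivative f' $ i) (at x within S)"
  by (rule bounded_linear.has_vector_derivative[OF bounded_linear_vec_nth assms])

lemma mat_mult_components:
  "(matP lam mu Z *v x) $ 1 = of_real (mu Z) * x $ 1" "(matP lam mu Z *v x) $ 2 = of_real (lam Z + 2 * mu Z) * x $ 2"
  "(matM lam mu Z *v x) $ 1 = of_real (lam Z + 2 * mu Z) * x $ 1" "(matM lam mu Z *v x) $ 2 = of_real (mu Z) * x $ 2"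
  "(matN lam mu Z *v x) $ 1 = - of_real (lam Z) * x $ 2" "(matN lam mu Z *v x) $ 2 = of_real (mu Z) * x $ 1"
  "(x v* matN lam mu Z) $ 1 = of_real (mu Z) * x $ 2" "(x v* matN lam mu Z) $ 2 = - of_real (lam Z) * x $ 1"
  by (simp_all add: matP_def matM_def matN_def matrix_vector_mult_def vector_matrix_mult_def sum_2)

section \<open>The Rayleigh system as a first-order system\<close>

context slab
begin

lemma lame_differentiable:
  assumes "Z < 0"
  shows "\<exists>D. ((\<lambda>z. complex_of_real (lam z)) has_vector_derivative D) (at Z)"
    "\<exists>D. ((\<lambda>z. complex_of_real (mu z)) has_vector_derivative D) (at Z)"
proof -
  have *: "\<exists>D. ((\<lambda>z. complex_of_real (f z)) has_vector_derivative D) (at Z)" if f: "Ck_on 20 {..0} f" for f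
  proof -
    obtain D :: "nat \<Rightarrow> real \<Rightarrow> real" where D0: "\<forall>x\<in>{..0}. D 0 x = f x"
      and D: "\<forall>j<20. \<forall>x\<in>{..0}. (D j has_real_derivative D (Suc j) x) (at x within {..0})"
      using f unfolding Ck_on_def by blast
    have "(D 0 has_real_derivative D (Suc 0) Z) (at Z within {..0})"
      using D[rule_format, of 0 Z] assms by simp
    then have "(D 0 has_real_derivative D 1 Z) (at Z within {..0})" by simp
    then have "(D 0 has_real_derivative D 1 Z) (at Z)"
      using at_within_interior[of Z "{..0}"] assms by simp
    then have "(f has_real_derivative D 1 Z) (at Z)"
      by (rule has_field_derivative_transform_within_open[of _ _ _ "{..<0}"]) (use D0 assms in auto)
    then show ?thesis using has_vector_derivative_of_real by blast
  qed
  show "\<exists>D. ((\<lambda>z. complex_of_real (lam z)) has_vector_derivative D) (at Z)"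
    "\<exists>D. ((\<lambda>z. complex_of_real (mu z)) has_vector_derivative D) (at Z)"
    using *[OF smooth(1)] *[OF smooth(2)] by auto
qed

text \<open>The last two components are P psi' - \<xi> N^T psi. The Rayleigh system gives the
  derivative of precisely this combination, so the coefficients of the first-order system contain no
  derivative of the Lame functions.\<close>

definition state :: "complex \<Rightarrow> (real \<Rightarrow> complex ^ 2) \<Rightarrow> 4 \<Rightarrow> real \<Rightarrow> complex" where
  "state \<xi> \<psi> i Z = (if i = 1 then \<psi> Z $ 1 else if i = 2 then \<psi> Z $ 2
     else if i = 3 then of_real (mu Z) * vderiv \<psi> Z $ 1 - \<xi> * (of_real (mu Z) * \<psi> Z $ 2)
     else of_real (lam Z + 2 * mu Z) * vderiv \<psi> Z $ 2 + \<xi> * (of_real (lam Z) * \<psi> Z $ 1))"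

lemma stress_has_derivative:
  assumes Z: "Z < 0" and \<psi>: "\<psi> differentiable at Z"
  obtains n' where "((\<lambda>z. transpose (matN lam mu z) *v \<psi> z) has_vector_derivative n') (at Z)"
proof -
  obtain l m where lm: "((\<lambda>z. complex_of_real (lam z)) has_vector_derivative l) (at Z)"
    "((\<lambda>z. complex_of_real (mu z)) has_vector_derivative m) (at Z)"
    using lame_differentiable[OF Z] by blast
  have d: "((\<lambda>z. \<psi> z $ i) has_vector_derivative vderiv \<psi> Z $ i) (at Z)" for i
    using has_vector_derivative_vec_nth \<psi> vector_derivative_works by blast
  have eq: "transpose (matN lam mu z) *v \<psi> z = (\<chi> i. if i = 1 then of_real (mu z) * \<psi> z $ 2 else - of_real (lam z) * \<psi> z $ 1)" for z
    by (simp add: vec_eq_iff forall_2 mat_mult_components)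
  have "((\<lambda>z. if i = 1 then of_real (mu z) * \<psi> z $ 2 else - of_real (lam z) * \<psi> z $ 1) has_vector_derivative
     (if i = 1 then of_real (mu Z) * vderiv \<psi> Z $ 2 + m * \<psi> Z $ 2 else - of_real (lam Z) * vderiv \<psi> Z $ 1 + (- l) * \<psi> Z $ 1)) (at Z)" for i :: 2
    by (cases "i = 1"; simp only: if_True if_False simp_thms; intro has_vector_derivative_mult has_vector_derivative_minus lm d)
  note di = this
  have "((\<lambda>z. transpose (matN lam mu z) *v \<psi> z) has_vector_derivative
     (\<chi> i. if i = 1 then of_real (mu Z) * vderiv \<psi> Z $ 2 + m * \<psi> Z $ 2 else - of_real (lam Z) * vderiv \<psi> Z $ 1 + (- l) * \<psi> Z $ 1)) (at Z)"
    unfolding eq by (rule has_vector_derivative_vec_lambda) (rule di)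
  then show thesis by (rule that)
qed

lemma state_ode:
  assumes sol: "rayleigh_solution \<omega> lam mu \<xi> \<psi>" and Z: "Z < 0"
  shows "(state \<xi> \<psi> i has_vector_derivative (\<Sum>j\<in>UNIV. rcoeff i j Z \<xi> * state \<xi> \<psi> j Z)) (at Z)"
proof -
  define p where "p z = matP lam mu z *v vderiv \<psi> z" for z
  define n where "n z = transpose (matN lam mu z) *v \<psi> z" for z
  have \<psi>: "\<psi> differentiable at Z" and pd: "p differentiable at Z"
    and eq: "vderiv p Z + \<xi> *s (matN lam mu Z *v vderiv \<psi> Z - vderiv n Z)
        + (of_real (\<omega>\<^sup>2) *s \<psi> Z - \<xi>\<^sup>2 *s (matM lam mu Z *v \<psi> Z)) = 0"
    using sol Z unfolding rayleigh_solution_def p_def n_def by auto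
  obtain n' where n': "(n has_vector_derivative n') (at Z)" using stress_has_derivative[OF Z \<psi>] unfolding n_def by blast
  have dp: "((\<lambda>z. p z $ i) has_vector_derivative vderiv p Z $ i) (at Z)" for i
    using has_vector_derivative_vec_nth pd vector_derivative_works by blast
  have dn: "((\<lambda>z. n z $ i) has_vector_derivative vderiv n Z $ i) (at Z)" for i
    using has_vector_derivative_vec_nth[OF n'] vector_derivative_at[OF n'] by simp
  have d: "((\<lambda>z. \<psi> z $ i) has_vector_derivative vderiv \<psi> Z $ i) (at Z)" for i
    using has_vector_derivative_vec_nth \<psi> vector_derivative_works by blast
  define m l where "m = complex_of_real (mu Z)" and "l = complex_of_real (lam Z)"
  define s where "s = l + 2 * m"
  have nz: "m \<noteq> 0" "s \<noteq> 0" using lame_nonzero[of Z] Z by (auto simp: m_def l_def s_def)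
  have s1: "state \<xi> \<psi> 1 = (\<lambda>z. \<psi> z $ 1)" "state \<xi> \<psi> 2 = (\<lambda>z. \<psi> z $ 2)"
    "state \<xi> \<psi> 3 = (\<lambda>z. p z $ 1 - \<xi> * n z $ 1)" "state \<xi> \<psi> 4 = (\<lambda>z. p z $ 2 - \<xi> * n z $ 2)"
    by (auto simp: state_def fun_eq_iff p_def n_def mat_mult_components)
  have v: "vderiv \<psi> Z $ 1 = (state \<xi> \<psi> 3 Z + \<xi> * (m * \<psi> Z $ 2)) / m"
    "vderiv \<psi> Z $ 2 = (state \<xi> \<psi> 4 Z - \<xi> * (l * \<psi> Z $ 1)) / s"
    using nz by (simp_all add: state_def l_def[symmetric] m_def[symmetric] s_def[symmetric])
  have e1: "vderiv p Z $ 1 - \<xi> * vderiv n Z $ 1 = \<xi> * l * vderiv \<psi> Z $ 2 - of_real (\<omega>\<^sup>2) * \<psi> Z $ 1 + \<xi>\<^sup>2 * s * \<psi> Z $ 1"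
    using arg_cong[OF eq, of "\<lambda>x::complex ^ 2. x $ 1"] by (simp add: mat_mult_components l_def s_def m_def algebra_simps)
  have e2: "vderiv p Z $ 2 - \<xi> * vderiv n Z $ 2 = - \<xi> * m * vderiv \<psi> Z $ 1 - of_real (\<omega>\<^sup>2) * \<psi> Z $ 2 + \<xi>\<^sup>2 * m * \<psi> Z $ 2"
    using arg_cong[OF eq, of "\<lambda>x::complex ^ 2. x $ 2"] by (simp add: mat_mult_components l_def s_def m_def algebra_simps)
  have d3: "(state \<xi> \<psi> 3 has_vector_derivative \<xi> * l * vderiv \<psi> Z $ 2 - of_real (\<omega>\<^sup>2) * \<psi> Z $ 1 + \<xi>\<^sup>2 * s * \<psi> Z $ 1) (at Z)"
    unfolding s1 e1[symmetric] by (intro has_vector_derivative_diff has_vector_derivative_mult_right dp dn)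
  have d4: "(state \<xi> \<psi> 4 has_vector_derivative - \<xi> * m * vderiv \<psi> Z $ 1 - of_real (\<omega>\<^sup>2) * \<psi> Z $ 2 + \<xi>\<^sup>2 * m * \<psi> Z $ 2) (at Z)"
    unfolding s1 e2[symmetric] by (intro has_vector_derivative_diff has_vector_derivative_mult_right dp dn)
  note cf = ray_coeff_def Let_def m_def[symmetric] l_def[symmetric] s_def[symmetric]
  have s12: "state \<xi> \<psi> 1 Z = \<psi> Z $ 1" "state \<xi> \<psi> 2 Z = \<psi> Z $ 2" by (simp_all add: s1)
  consider "i = 1" | "i = 2" | "i = 3" | "i = 4" using exhaust_4 by blast
  then show ?thesis
  proof cases
    case 1
    show ?thesis unfolding 1 s1(1)
      by (rule has_vector_derivative_eq_rhs[OF d[of 1]])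
        (use nz in \<open>simp add: v sum_4 cf s12, simp add: field_simps\<close>)
  next
    case 2
    show ?thesis unfolding 2 s1(2)
      by (rule has_vector_derivative_eq_rhs[OF d[of 2]])
        (use nz in \<open>simp add: v sum_4 cf s12, simp add: field_simps\<close>)
  next
    case 3
    show ?thesis unfolding 3
      by (rule has_vector_derivative_eq_rhs[OF d3])
        (use nz in \<open>simp add: v sum_4 cf s12, simp add: field_simps power2_eq_square\<close>)
  next
    case 4
    show ?thesis unfolding 4
      by (rule has_vector_derivative_eq_rhs[OF d4])
        (use nz in \<open>simp add: v sum_4 cf s12, simp add: field_simps power2_eq_square\<close>)
  qed
qed

text \<open>The first two equations say that P psi' = (y 3, y 4) + \<xi> N^T psi. The right side is
  differentiable, which is the regularity that \<open>rayleigh_solution\<close> asks for; the last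
  two equations are then the Rayleigh system itself.\<close>

lemma rayleigh_solutionI:
  assumes y: "\<And>i Z. Z < 0 \<Longrightarrow> (y i has_vector_derivative (\<Sum>j\<in>UNIV. rcoeff i j Z \<xi> * y j Z)) (at Z)"
  shows "rayleigh_solution \<omega> lam mu \<xi> (\<lambda>Z. vector [y 1 Z, y 2 Z])" (is "rayleigh_solution _ _ _ _ ?\<psi>")
proof -
  have psi: "?\<psi> = (\<lambda>Z. \<chi> i. if i = 1 then y 1 Z else y 2 Z)"
    by (simp add: fun_eq_iff vec_eq_iff forall_2)
  define Y' where "Y' i Z = (\<Sum>j\<in>UNIV. rcoeff i j Z \<xi> * y j Z)" for i Z
  have d: "(?\<psi> has_vector_derivative (\<chi> i. if i = 1 then Y' 1 Z else Y' 2 Z)) (at Z)" if "Z < 0" for Z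
    unfolding psi by (rule has_vector_derivative_vec_lambda) (use y[OF that] in \<open>auto simp: Y'_def\<close>)
  have vd: "vderiv ?\<psi> Z $ 1 = Y' 1 Z" "vderiv ?\<psi> Z $ 2 = Y' 2 Z" if "Z < 0" for Z
    using vector_derivative_at[OF d[OF that]] by simp_all
  define n where "n z = transpose (matN lam mu z) *v ?\<psi> z" for z
  have p: "matP lam mu Z *v vderiv ?\<psi> Z = (\<chi> i. if i = 1 then y 3 Z else y 4 Z) + \<xi> *s n Z" if "Z < 0" for Z
  proof -
    define m l where "m = complex_of_real (mu Z)" and "l = complex_of_real (lam Z)"
    define s where "s = l + 2 * m"
    have nz: "m \<noteq> 0" "s \<noteq> 0" using lame_nonzero[of Z] that by (auto simp: m_def l_def s_def)
    note cf = ray_coeff_def Let_def m_def[symmetric] l_def[symmetric] s_def[symmetric]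
    show ?thesis
      by (simp add: vec_eq_iff forall_2 mat_mult_components vd[OF that] n_def Y'_def sum_4 cf)
        (use nz in \<open>simp add: field_simps\<close>)
  qed
  show ?thesis
    unfolding rayleigh_solution_def
  proof (intro allI impI conjI)
    fix Z :: real assume Z: "Z < 0"
    show dif: "?\<psi> differentiable at Z" using d[OF Z] differentiableI_vector by blast
    obtain n' where n': "(n has_vector_derivative n') (at Z)" using stress_has_derivative[OF Z dif] unfolding n_def by blast
    have dn: "((\<lambda>z. \<xi> *s n z) has_vector_derivative \<xi> *s n') (at Z)"
    proof -
      have "bounded_linear (\<lambda>x::complex ^ 2. \<xi> *s x)"
        unfolding linear_conv_bounded_linear[symmetric]
        by (rule linearI) (simp_all add: vec_eq_iff algebra_simps)
      from bounded_linear.has_vector_derivative[OF this n'] show ?thesis .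
    qed
    have "((\<lambda>z. (\<chi> i. if i = 1 then y 3 z else y 4 z) + \<xi> *s n z) has_vector_derivative
        (\<chi> i. if i = 1 then Y' 3 Z else Y' 4 Z) + \<xi> *s n') (at Z)"
      by (intro has_vector_derivative_add has_vector_derivative_vec_lambda dn) (use y[OF Z] in \<open>auto simp: Y'_def\<close>)
    then have dP: "((\<lambda>z. matP lam mu z *v vderiv ?\<psi> z) has_vector_derivative (\<chi> i. if i = 1 then Y' 3 Z else Y' 4 Z) + \<xi> *s n') (at Z)"
      by (rule has_vector_derivative_transform_within_open[of _ _ _ "{..<0}"]) (use Z p in auto)
    then show "(\<lambda>z. matP lam mu z *v vderiv ?\<psi> z) differentiable at Z" using differentiableI_vector by blast
    have nv: "vderiv (\<lambda>z. transpose (matN lam mu z) *v ?\<psi> z) Z = n'"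
      using vector_derivative_at[OF n'] unfolding n_def .
    define m l where "m = complex_of_real (mu Z)" and "l = complex_of_real (lam Z)"
    define s where "s = l + 2 * m"
    have nz: "m \<noteq> 0" "s \<noteq> 0" using lame_nonzero[of Z] Z by (auto simp: m_def l_def s_def)
    note cf = ray_coeff_def Let_def m_def[symmetric] l_def[symmetric] s_def[symmetric]
    show "vderiv (\<lambda>z. matP lam mu z *v vderiv ?\<psi> z) Z
        + \<xi> *s (matN lam mu Z *v vderiv ?\<psi> Z - vderiv (\<lambda>z. transpose (matN lam mu z) *v ?\<psi> z) Z)
        + (of_real (\<omega>\<^sup>2) *s ?\<psi> Z - \<xi>\<^sup>2 *s (matM lam mu Z *v ?\<psi> Z)) = 0"
      unfolding vector_derivative_at[OF dP] nv
      by (simp add: vec_eq_iff forall_2 mat_mult_components vd[OF Z] Y'_def sum_4 cf)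
        (use nz in \<open>simp add: field_simps power2_eq_square\<close>)
  qed
qed

section \<open>Existence and uniqueness of the Jost solutions\<close>

definition half_space_data :: "complex \<Rightarrow> complex \<Rightarrow> (4 \<Rightarrow> complex) \<Rightarrow> bool" where
  "half_space_data \<xi> l v \<longleftrightarrow> (\<forall>Z \<le> - H. \<forall>i. l * v i = (\<Sum>j\<in>UNIV. rcoeff i j Z \<xi> * v j))"

lemma half_space_data_P:
  assumes l: "l\<^sup>2 = \<xi>\<^sup>2 - of_real (\<omega>\<^sup>2 / (lam0 + 2 * mu0))"
  shows "half_space_data \<xi> l (data_P \<xi> l)"
  unfolding half_space_data_def
proof (intro allI impI)
  fix Z :: real and i :: 4 assume Z: "Z \<le> - H"
  define m k where "m = complex_of_real mu0" and "k = complex_of_real lam0"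
  define s where "s = k + 2 * m"
  have nz: "m \<noteq> 0" "s \<noteq> 0" using mu0_pos lame_nonzero(3)[of "- H"] const_le[of "- H"] H_pos by (auto simp: m_def k_def s_def)
  have l': "l\<^sup>2 * s = \<xi>\<^sup>2 * s - of_real (\<omega>\<^sup>2)"
    using nz unfolding l by (simp add: m_def k_def s_def left_diff_distrib)
  have k: "k = s - 2 * m" by (simp add: s_def)
  note cf = ray_coeff_def Let_def const_le[OF Z] m_def[symmetric] k_def[symmetric] s_def[symmetric] data_P_def sum_4
  consider "i = 1" | "i = 2" | "i = 3" | "i = 4" using exhaust_4 by blast
  then show "l * data_P \<xi> l i = (\<Sum>j\<in>UNIV. rcoeff i j Z \<xi> * data_P \<xi> l j)"
  proof cases
    case 1 then show ?thesis using nz by (simp add: cf)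
  next
    case 2
    have "l * l = (\<xi> * k * \<xi> + (2 * m * \<xi>\<^sup>2 - of_real (\<omega>\<^sup>2))) / s"
      using nz l' unfolding k by (simp add: eq_divide_eq power2_eq_square algebra_simps)
    then show ?thesis using 2 nz by (simp add: cf add_divide_distrib)
  next
    case 3
    have "(l * (- 2 * m * \<xi> * l)) * s = ((\<xi>\<^sup>2 * (s - k\<^sup>2 / s) - of_real (\<omega>\<^sup>2)) * (- \<xi>) + \<xi> * k / s * (2 * m * \<xi>\<^sup>2 - of_real (\<omega>\<^sup>2))) * s"
    proof -
      have "(l * (- 2 * m * \<xi> * l)) * s = - 2 * m * \<xi> * (l\<^sup>2 * s)" by (simp add: power2_eq_square)
      also have "\<dots> = (\<xi>\<^sup>2 * (s * s - k\<^sup>2) - of_real (\<omega>\<^sup>2) * s) * (- \<xi>) + \<xi> * k * (2 * m * \<xi>\<^sup>2 - of_real (\<omega>\<^sup>2))"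
        unfolding l' k by (simp add: power2_eq_square algebra_simps)
      also have "\<dots> = ((\<xi>\<^sup>2 * (s - k\<^sup>2 / s) - of_real (\<omega>\<^sup>2)) * (- \<xi>) + \<xi> * k / s * (2 * m * \<xi>\<^sup>2 - of_real (\<omega>\<^sup>2))) * s"
        using nz by (simp add: field_simps)
      finally show ?thesis .
    qed
    then have "l * (- 2 * m * \<xi> * l) = (\<xi>\<^sup>2 * (s - k\<^sup>2 / s) - of_real (\<omega>\<^sup>2)) * (- \<xi>) + \<xi> * k / s * (2 * m * \<xi>\<^sup>2 - of_real (\<omega>\<^sup>2))"
      unfolding mult_right_cancel[OF nz(2)] .
    then show ?thesis using 3 by (simp add: cf)
  next
    case 4 then show ?thesis by (simp add: cf power2_eq_square algebra_simps)
  qed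
qed

lemma half_space_data_S:
  assumes l: "l\<^sup>2 = \<xi>\<^sup>2 - of_real (\<omega>\<^sup>2 / mu0)"
  shows "half_space_data \<xi> l (data_S \<xi> l)"
  unfolding half_space_data_def
proof (intro allI impI)
  fix Z :: real and i :: 4 assume Z: "Z \<le> - H"
  define m k where "m = complex_of_real mu0" and "k = complex_of_real lam0"
  define s where "s = k + 2 * m"
  have nz: "m \<noteq> 0" "s \<noteq> 0" using mu0_pos lame_nonzero(3)[of "- H"] const_le[of "- H"] H_pos by (auto simp: m_def k_def s_def)
  have l': "l\<^sup>2 * m = \<xi>\<^sup>2 * m - of_real (\<omega>\<^sup>2)"
    using nz unfolding l by (simp add: m_def left_diff_distrib)
  have k: "k = s - 2 * m" by (simp add: s_def)
  note cf = ray_coeff_def Let_def const_le[OF Z] m_def[symmetric] k_def[symmetric] s_def[symmetric] data_S_def sum_4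
  consider "i = 1" | "i = 2" | "i = 3" | "i = 4" using exhaust_4 by blast
  then show "l * data_S \<xi> l i = (\<Sum>j\<in>UNIV. rcoeff i j Z \<xi> * data_S \<xi> l j)"
  proof cases
    case 1
    have "l * l = - (\<xi> * \<xi>) + (2 * m * \<xi>\<^sup>2 - of_real (\<omega>\<^sup>2)) / m"
      using nz l' by (simp add: eq_divide_eq field_simps power2_eq_square)
    then show ?thesis using 1 by (simp add: cf)
  next
    case 2
    have "l * (- \<xi>) = - \<xi> * k / s * l + (- 2 * m * \<xi> * l) / s"
      using nz unfolding k by (simp add: field_simps)
    then show ?thesis using 2 by (simp add: cf)
  next
    case 3
    have "l * (2 * m * \<xi>\<^sup>2 - of_real (\<omega>\<^sup>2)) = (\<xi>\<^sup>2 * (s - k\<^sup>2 / s) - of_real (\<omega>\<^sup>2)) * l + \<xi> * k / s * (- 2 * m * \<xi> * l)"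
      using nz unfolding k by (simp add: field_simps power2_eq_square)
    then show ?thesis using 3 by (simp add: cf)
  next
    case 4
    have "l * (- 2 * m * \<xi> * l) = - 2 * \<xi> * (l\<^sup>2 * m)" by (simp add: power2_eq_square)
    also have "\<dots> = - of_real (\<omega>\<^sup>2) * (- \<xi>) - \<xi> * (2 * m * \<xi>\<^sup>2 - of_real (\<omega>\<^sup>2))"
      unfolding l' by (simp add: power2_eq_square algebra_simps)
    finally show ?thesis using 4 by (simp add: cf)
  qed
qed

lemma exp_vector_derivative:
  "((\<lambda>z. exp (l * complex_of_real z) * c) has_vector_derivative (l * (exp (l * of_real z) * c))) (at z within S)"
  by (rule has_vector_derivative_real_field[where f = "\<lambda>u. exp (l * u) * c", THEN has_vector_derivative_eq_rhs])
    (auto intro!: derivative_eq_intros)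

text \<open>The exponential below - H is glued to the solution in the slab. For a first-order system
  with coefficients given at every point, equal values at - H imply equal one-sided derivatives, so
  the glued function is differentiable there.\<close>

lemma jost_exists:
  assumes v: "half_space_data \<xi> l v"
  shows "\<exists>\<psi>. rayleigh_solution \<omega> lam mu \<xi> \<psi> \<and> (\<forall>Z \<le> - H. \<psi> Z = exp (l * of_real Z) *s vector [v 1, v 2])"
proof -
  define y where "y i Z = (if Z \<in> {..- H} then exp (l * of_real Z) * v i else exp (- l * of_real H) * sol \<xi> v i Z)" for i Z
  have match: "exp (l * of_real (- H)) * v i = exp (- l * of_real H) * sol \<xi> v i (- H)" for i
    by (simp add: sol_init)
  have "(y i has_vector_derivative (\<Sum>j\<in>UNIV. rcoeff i j Z \<xi> * y j Z)) (at Z)" if Z: "Z < 0" for i Z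
  proof -
    have cl: "closure {..- H} = {..- H}" "closure {- H<..<0} = {- H..0}" using H_pos by auto
    have E: "((\<lambda>z. exp (l * of_real z) * v i) has_vector_derivative (\<Sum>j\<in>UNIV. rcoeff i j x \<xi> * (exp (l * of_real x) * v j))) (at x within S)"
      if "x \<le> - H" for x S
    proof (rule has_vector_derivative_eq_rhs[OF exp_vector_derivative])
      have "l * v i = (\<Sum>j\<in>UNIV. rcoeff i j x \<xi> * v j)" using v that unfolding half_space_data_def by blast
      then have "exp (l * of_real x) * (l * v i) = (\<Sum>j\<in>UNIV. exp (l * of_real x) * (rcoeff i j x \<xi> * v j))"
        by (simp add: sum_distrib_left)
      then show "l * (exp (l * of_real x) * v i) = (\<Sum>j\<in>UNIV. rcoeff i j x \<xi> * (exp (l * of_real x) * v j))"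
        by (simp add: mult_ac)
    qed
    have F: "((\<lambda>z. exp (- l * of_real H) * sol \<xi> v i z) has_vector_derivative
        (\<Sum>j\<in>UNIV. rcoeff i j x \<xi> * (exp (- l * of_real H) * sol \<xi> v j x))) (at x within {- H..0})" if "x \<in> {- H..0}" for x
    proof -
      have "((\<lambda>z. exp (- l * of_real H) * sol \<xi> v i z) has_vector_derivative
        exp (- l * of_real H) * (\<Sum>j\<in>UNIV. rcoeff i j x \<xi> * sol \<xi> v j x)) (at x within {- H..0})"
        by (rule has_vector_derivative_mult_right) (use sol_ode that in \<open>auto simp: ray_ode_def\<close>)
      then show ?thesis by (rule has_vector_derivative_eq_rhs) (simp add: sum_distrib_left mult_ac)
    qed
    have ci: "closure {..- H} \<inter> closure {- H<..<0} = {- H}" unfolding cl using H_pos by auto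
    have un: "{..<0} = {..- H} \<union> {- H<..<0}" using H_pos by auto
    have "((\<lambda>x. if x \<in> {..- H} then exp (l * of_real x) * v i else exp (- l * of_real H) * sol \<xi> v i x) has_vector_derivative
      (if Z \<in> {..- H} then (\<Sum>j\<in>UNIV. rcoeff i j Z \<xi> * (exp (l * of_real Z) * v j)) else (\<Sum>j\<in>UNIV. rcoeff i j Z \<xi> * (exp (- l * of_real H) * sol \<xi> v j Z)))) (at Z within {..<0})"
    proof (rule has_vector_derivative_If_within_closures[where x = Z
          and f' = "\<lambda>Z. \<Sum>j\<in>UNIV. rcoeff i j Z \<xi> * (exp (l * of_real Z) * v j)"
          and g' = "\<lambda>Z. \<Sum>j\<in>UNIV. rcoeff i j Z \<xi> * (exp (- l * of_real H) * sol \<xi> v j Z)", OF _ un])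
      show "Z \<in> {..- H} \<union> {- H<..<0}" using Z by auto
      show "((\<lambda>x. exp (l * of_real x) * v i) has_vector_derivative (\<Sum>j\<in>UNIV. rcoeff i j Z \<xi> * (exp (l * of_real Z) * v j)))
          (at Z within {..- H} \<union> (closure {..- H} \<inter> closure {- H<..<0}))"
        if "Z \<in> {..- H} \<union> (closure {..- H} \<inter> closure {- H<..<0})"
        using that unfolding ci by (intro E) auto
      show "((\<lambda>x. exp (- l * of_real H) * sol \<xi> v i x) has_vector_derivative (\<Sum>j\<in>UNIV. rcoeff i j Z \<xi> * (exp (- l * of_real H) * sol \<xi> v j Z)))
          (at Z within {- H<..<0} \<union> (closure {..- H} \<inter> closure {- H<..<0}))"
        if "Z \<in> {- H<..<0} \<union> (closure {..- H} \<inter> closure {- H<..<0})"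
        using that H_pos unfolding ci by (intro has_vector_derivative_within_subset[OF F]) auto
    next
      assume "Z \<in> closure {..- H}" "Z \<in> closure {- H<..<0}"
      then have "Z \<in> closure {..- H} \<inter> closure {- H<..<0}" by (rule IntI)
      then have "Z = - H" unfolding ci by simp
      then have "exp (l * of_real Z) * v j = exp (- l * of_real H) * sol \<xi> v j Z" for j using match by simp
      then show "exp (l * of_real Z) * v i = exp (- l * of_real H) * sol \<xi> v i Z"
        "(\<Sum>j\<in>UNIV. rcoeff i j Z \<xi> * (exp (l * of_real Z) * v j)) = (\<Sum>j\<in>UNIV. rcoeff i j Z \<xi> * (exp (- l * of_real H) * sol \<xi> v j Z))"
        by simp_all
    qed
    then have "(y i has_vector_derivative (\<Sum>j\<in>UNIV. rcoeff i j Z \<xi> * y j Z)) (at Z within {..<0})"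
      unfolding y_def[abs_def] by (cases "Z \<in> {..- H}") (simp_all only: if_True if_False simp_thms)
    then show ?thesis using at_within_open[of Z "{..<0}"] Z by simp
  qed
  from rayleigh_solutionI[OF this]
  have "rayleigh_solution \<omega> lam mu \<xi> (\<lambda>Z. vector [y 1 Z, y 2 Z])" by blast
  moreover have "vector [y 1 Z, y 2 Z] = exp (l * of_real Z) *s (vector [v 1, v 2] :: complex ^ 2)" if "Z \<le> - H" for Z
    using that by (simp add: vec_eq_iff forall_2 y_def)
  ultimately show ?thesis by blast
qed

text \<open>The state of every candidate is determined on Z < 0, so the choice by
  \<open>SOME\<close> in the Jost solutions is harmless. The explicit derivative is available only
  for Z < - H; at - H the state is found by continuity, and from there uniqueness in the slab takes
  over.\<close>

lemma jost_state:
  assumes \<psi>: "rayleigh_solution \<omega> lam mu \<xi> \<psi>" and init: "\<And>Z. Z \<le> - H \<Longrightarrow> \<psi> Z = exp (l * of_real Z) *s vector [v 1, v 2]"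
    and v3: "v 3 = of_real mu0 * (l * v 1) - \<xi> * (of_real mu0 * v 2)"
    and v4: "v 4 = of_real (lam0 + 2 * mu0) * (l * v 2) + \<xi> * (of_real lam0 * v 1)"
    and z: "- H \<le> z" "z < 0"
  shows "state \<xi> \<psi> i z = exp (- l * of_real H) * sol \<xi> v i z"
proof -
  have left: "state \<xi> \<psi> i Z = exp (l * of_real Z) * v i" if Z: "Z < - H" for i Z
  proof -
    have "(\<psi> has_vector_derivative (\<chi> j. l * (exp (l * of_real Z) * (vector [v 1, v 2] :: complex ^ 2) $ j))) (at Z)"
    proof (rule has_vector_derivative_transform_within_open[where S = "{..<- H}"])
      show "((\<lambda>Z. \<chi> j. exp (l * of_real Z) * (vector [v 1, v 2] :: complex ^ 2) $ j) has_vector_derivative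
         (\<chi> j. l * (exp (l * of_real Z) * (vector [v 1, v 2] :: complex ^ 2) $ j))) (at Z)"
        by (rule has_vector_derivative_vec_lambda) (rule exp_vector_derivative)
      show "(\<chi> j. exp (l * of_real x) * (vector [v 1, v 2] :: complex ^ 2) $ j) = \<psi> x" if "x \<in> {..<- H}" for x
        using init[of x] that by (simp add: vec_eq_iff)
    qed (use Z in auto)
    from vector_derivative_at[OF this]
    have d: "vderiv \<psi> Z $ 1 = l * (exp (l * of_real Z) * v 1)" "vderiv \<psi> Z $ 2 = l * (exp (l * of_real Z) * v 2)" by simp_all
    have p: "\<psi> Z $ 1 = exp (l * of_real Z) * v 1" "\<psi> Z $ 2 = exp (l * of_real Z) * v 2" using init[of Z] Z by simp_all
    have c: "lam Z = lam0" "mu Z = mu0" using const_le[of Z] Z by auto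
    show ?thesis using exhaust_4[of i] by (auto simp: state_def d p c v3 v4 algebra_simps)
  qed
  have at_H: "state \<xi> \<psi> i (- H) = exp (- l * of_real H) * v i" for i
  proof -
    have "isCont (state \<xi> \<psi> i) (- H)"
      using has_vector_derivative_continuous[OF state_ode[OF \<psi>, of "- H" i]] H_pos by simp
    then have "(state \<xi> \<psi> i \<longlongrightarrow> state \<xi> \<psi> i (- H)) (at_left (- H))"
      unfolding isCont_def by (rule tendsto_within_subset) auto
    moreover have "((\<lambda>Z. exp (l * of_real Z) * v i) \<longlongrightarrow> exp (l * of_real (- H)) * v i) (at_left (- H))"
      by (intro tendsto_intros)
    then have "(state \<xi> \<psi> i \<longlongrightarrow> exp (l * of_real (- H)) * v i) (at_left (- H))"
      by (rule Lim_transform_eventually) (auto simp: eventually_at_filter left)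
    ultimately have "state \<xi> \<psi> i (- H) = exp (l * of_real (- H)) * v i"
      using tendsto_unique trivial_limit_at_left_real by blast
    then show ?thesis by simp
  qed
  have "state \<xi> \<psi> i z = sol \<xi> (\<lambda>i. exp (- l * of_real H) * v i) i z"
  proof (rule ray_ode_unique_upto[where b = z])
    show "(state \<xi> \<psi> i has_vector_derivative (\<Sum>j\<in>UNIV. rcoeff i j x \<xi> * state \<xi> \<psi> j x)) (at x within {- H..z})"
      if "x \<in> {- H..z}" for i x
      by (rule has_vector_derivative_at_within[OF state_ode[OF \<psi>]]) (use that z in auto)
  qed (use z at_H in auto)
  also have "\<dots> = exp (- l * of_real H) * sol \<xi> v i z"
    using sol_linear[of \<xi> "exp (- l * of_real H)" v 0 "\<lambda>i. 0" i z] by simp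
  finally show ?thesis .
qed

lemma left0_eqI: "(f \<longlongrightarrow> c) (at_left (0::real)) \<Longrightarrow> left0 f = c"
  by (rule tendsto_Lim) simp_all

text \<open>The tractions are i times the fourth and one times the third component of the state,
  with left limits at the surface. These limits exist because \<open>sol\<close> is continuous up to
  0 and agrees with the state below, up to the scalar.\<close>

lemma jost_tractions:
  assumes \<psi>: "rayleigh_solution \<omega> lam mu \<xi> \<psi>" and init: "\<And>Z. Z \<le> - H \<Longrightarrow> \<psi> Z = exp (l * of_real Z) *s vector [v 1, v 2]"
    and v3: "v 3 = of_real mu0 * (l * v 1) - \<xi> * (of_real mu0 * v 2)"
    and v4: "v 4 = of_real (lam0 + 2 * mu0) * (l * v 2) + \<xi> * (of_real lam0 * v 1)"
  shows "traction_a lam mu \<xi> \<psi> = \<i> * (exp (- l * of_real H) * sol \<xi> v 4 0)"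
    "traction_b mu \<xi> \<psi> = exp (- l * of_real H) * sol \<xi> v 3 0"
proof -
  define Y where "Y i = exp (- l * of_real H) * sol \<xi> v i 0" for i
  have near: "\<forall>\<^sub>F z in at_left (0::real). - H \<le> z \<and> z < 0"
    unfolding eventually_at_left_field using H_pos by (intro exI[of _ "- H"]) auto
  have lim: "(state \<xi> \<psi> i \<longlongrightarrow> Y i) (at_left 0)" for i
  proof -
    have "(sol \<xi> v i has_vector_derivative (\<Sum>j\<in>UNIV. rcoeff i j 0 \<xi> * sol \<xi> v j 0)) (at 0 within {- H..0})"
      using sol_ode[of \<xi> v] H_pos unfolding ray_ode_def by auto
    then have "continuous (at 0 within {- H..0}) (sol \<xi> v i)" by (rule has_vector_derivative_continuous)
    then have "(sol \<xi> v i \<longlongrightarrow> sol \<xi> v i 0) (at 0 within {- H..0})" by (simp add: continuous_within)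
    then have "(sol \<xi> v i \<longlongrightarrow> sol \<xi> v i 0) (at_left 0)"
      using at_within_Icc_at_left[of "- H" 0] H_pos by simp
    then have "((\<lambda>z. exp (- l * of_real H) * sol \<xi> v i z) \<longlongrightarrow> Y i) (at_left 0)"
      unfolding Y_def by (rule tendsto_mult_left)
    then show ?thesis
      by (rule Lim_transform_eventually)
        (use near jost_state[OF \<psi> init v3 v4] in \<open>auto elim!: eventually_mono\<close>)
  qed
  have cl: "(lam \<longlongrightarrow> lam 0) (at_left 0)" "(mu \<longlongrightarrow> mu 0) (at_left 0)"
    using lam_cont mu_cont unfolding continuous_on_def by (auto intro: tendsto_within_subset)
  define m k s where "m = complex_of_real (mu 0)" and "k = complex_of_real (lam 0)" and "s = k + 2 * m"
  have nz: "m \<noteq> 0" "s \<noteq> 0" using lame_nonzero[of 0] by (auto simp: m_def k_def s_def)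
  have L1: "((\<lambda>Z. \<psi> Z $ 1) \<longlongrightarrow> Y 1) (at_left 0)" "((\<lambda>Z. \<psi> Z $ 2) \<longlongrightarrow> Y 2) (at_left 0)"
    using lim[of 1] lim[of 2] by (simp_all add: state_def[abs_def])
  have LL: "((\<lambda>z. complex_of_real (mu z)) \<longlongrightarrow> m) (at_left 0)" "((\<lambda>z. complex_of_real (lam z)) \<longlongrightarrow> k) (at_left 0)"
    unfolding m_def k_def by (intro tendsto_of_real cl)+
  have "((\<lambda>z. (state \<xi> \<psi> 3 z + \<xi> * (of_real (mu z) * \<psi> z $ 2)) / of_real (mu z)) \<longlongrightarrow> (Y 3 + \<xi> * (m * Y 2)) / m) (at_left 0)"
    by (intro tendsto_intros lim L1 LL nz)
  then have L3: "((\<lambda>Z. vderiv \<psi> Z $ 1) \<longlongrightarrow> (Y 3 + \<xi> * (m * Y 2)) / m) (at_left 0)"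
  proof (rule Lim_transform_eventually)
    show "\<forall>\<^sub>F x in at_left 0. (state \<xi> \<psi> 3 x + \<xi> * (of_real (mu x) * \<psi> x $ 2)) / of_real (mu x) = vderiv \<psi> x $ 1"
      using near by (rule eventually_mono) (use lame_nonzero in \<open>auto simp: state_def\<close>)
  qed
  have "((\<lambda>z. (state \<xi> \<psi> 4 z - \<xi> * (of_real (lam z) * \<psi> z $ 1)) / (of_real (lam z) + 2 * of_real (mu z))) \<longlongrightarrow> (Y 4 - \<xi> * (k * Y 1)) / s) (at_left 0)"
    unfolding s_def by (intro tendsto_intros lim L1 LL) (use nz in \<open>simp add: s_def\<close>)
  then have L4: "((\<lambda>Z. vderiv \<psi> Z $ 2) \<longlongrightarrow> (Y 4 - \<xi> * (k * Y 1)) / s) (at_left 0)"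
  proof (rule Lim_transform_eventually)
    show "\<forall>\<^sub>F x in at_left 0. (state \<xi> \<psi> 4 x - \<xi> * (of_real (lam x) * \<psi> x $ 1)) / (of_real (lam x) + 2 * of_real (mu x)) = vderiv \<psi> x $ 2"
      using near by (rule eventually_mono) (use lame_nonzero in \<open>auto simp: state_def\<close>)
  qed
  have s': "complex_of_real (lam 0 + 2 * mu 0) = s" by (simp add: s_def k_def m_def)
  have "traction_a lam mu \<xi> \<psi> = \<i> * Y 4"
    unfolding traction_a_def left0_eqI[OF cl(1)] left0_eqI[OF cl(2)] left0_eqI[OF L1(1)] left0_eqI[OF L4] s' k_def[symmetric]
    using nz by (simp add: mult_ac)
  then show "traction_a lam mu \<xi> \<psi> = \<i> * (exp (- l * of_real H) * sol \<xi> v 4 0)" by (simp add: Y_def)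
  have "traction_b mu \<xi> \<psi> = Y 3"
    unfolding traction_b_def left0_eqI[OF cl(2)] left0_eqI[OF L1(2)] left0_eqI[OF L3] m_def[symmetric]
    using nz by (simp add: mult_ac)
  then show "traction_b mu \<xi> \<psi> = exp (- l * of_real H) * sol \<xi> v 3 0" by (simp add: Y_def)
qed

end

text \<open>Multiplying over the two signs of s gives U + p V for p and U - p V for - p, where U and
  V contain s and p only through their squares; the remaining product is U^2 - p^2 V^2.\<close>

lemma four_sheet_product:
  fixes p s :: "'a::comm_ring_1"
  shows "(c0 + p * c1 + s * c2 + p * s * c3) * (c0 + p * c1 + (- s) * c2 + p * (- s) * c3) *
      ((c0 + (- p) * c1 + s * c2 + (- p) * s * c3) * (c0 + (- p) * c1 + (- s) * c2 + (- p) * (- s) * c3)) =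
    (c0\<^sup>2 + p\<^sup>2 * c1\<^sup>2 - s\<^sup>2 * (c2\<^sup>2 + p\<^sup>2 * c3\<^sup>2))\<^sup>2 - p\<^sup>2 * (2 * c0 * c1 - 2 * s\<^sup>2 * c2 * c3)\<^sup>2"
    (is "?L = ?U\<^sup>2 - p\<^sup>2 * ?V\<^sup>2")
proof -
  have 1: "(c0 + p * c1 + s * c2 + p * s * c3) * (c0 + p * c1 + (- s) * c2 + p * (- s) * c3) = ?U + p * ?V"
    "(c0 + (- p) * c1 + s * c2 + (- p) * s * c3) * (c0 + (- p) * c1 + (- s) * c2 + (- p) * (- s) * c3) = ?U - p * ?V"
    by (simp_all add: algebra_simps power2_eq_square)
  have "(u + p * v) * (u - p * v) = u\<^sup>2 - p\<^sup>2 * v\<^sup>2" for u v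
    by (simp add: algebra_simps power2_eq_square)
  then show ?thesis unfolding 1 by simp
qed

section \<open>The Rayleigh determinant on the four sheets and the entire function F\<close>

context slab
begin

lemma jost_P_tractions:
  assumes q: "qP\<^sup>2 = of_real (\<omega>\<^sup>2 / (lam0 + 2 * mu0)) - \<xi>\<^sup>2"
  shows "traction_a lam mu \<xi> (jost_P \<omega> H lam mu (- 1) (\<xi>, qP, qS)) = \<i> * (exp (\<i> * qP * of_real H) * sol \<xi> (data_P \<xi> (- \<i> * qP)) 4 0)"
    "traction_b mu \<xi> (jost_P \<omega> H lam mu (- 1) (\<xi>, qP, qS)) = exp (\<i> * qP * of_real H) * sol \<xi> (data_P \<xi> (- \<i> * qP)) 3 0"
proof -
  define l where "l = - \<i> * qP"
  have l: "l\<^sup>2 = \<xi>\<^sup>2 - of_real (\<omega>\<^sup>2 / (lam0 + 2 * mu0))" using q by (simp add: l_def power_mult_distrib)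
  have ex: "\<exists>\<psi>. rayleigh_solution \<omega> lam mu \<xi> \<psi> \<and> (\<forall>Z \<le> - H. \<psi> Z = exp (- 1 * \<i> * of_real Z * qP) *s vector [- \<xi>, - 1 * \<i> * qP])"
    using jost_exists[OF half_space_data_P[OF l]] by (simp add: data_P_def l_def mult_ac)
  have J: "rayleigh_solution \<omega> lam mu \<xi> (jost_P \<omega> H lam mu (- 1) (\<xi>, qP, qS)) \<and>
      (\<forall>Z \<le> - H. jost_P \<omega> H lam mu (- 1) (\<xi>, qP, qS) Z = exp (- 1 * \<i> * of_real Z * qP) *s vector [- \<xi>, - 1 * \<i> * qP])"
    unfolding jost_P.simps using someI_ex[OF ex] by simp
  have v: "data_P \<xi> l 3 = of_real mu0 * (l * data_P \<xi> l 1) - \<xi> * (of_real mu0 * data_P \<xi> l 2)"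
    "data_P \<xi> l 4 = of_real (lam0 + 2 * mu0) * (l * data_P \<xi> l 2) + \<xi> * (of_real lam0 * data_P \<xi> l 1)"
  proof -
    have "of_real (lam0 + 2 * mu0) * (l * l) = of_real (lam0 + 2 * mu0) * \<xi>\<^sup>2 - of_real (\<omega>\<^sup>2)"
    proof -
      have "complex_of_real (lam0 + 2 * mu0) \<noteq> 0" unfolding of_real_eq_0_iff using sg0_pos by linarith
      then show ?thesis
        unfolding power2_eq_square[of l, symmetric] l of_real_divide right_diff_distrib by (simp del: of_real_add)
    qed
    then show "data_P \<xi> l 4 = of_real (lam0 + 2 * mu0) * (l * data_P \<xi> l 2) + \<xi> * (of_real lam0 * data_P \<xi> l 1)"
      by (simp add: data_P_def power2_eq_square algebra_simps)
  qed (simp add: data_P_def)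
  have init: "jost_P \<omega> H lam mu (- 1) (\<xi>, qP, qS) Z = exp (l * of_real Z) *s vector [data_P \<xi> l 1, data_P \<xi> l 2]" if "Z \<le> - H" for Z
    using J that by (simp add: l_def data_P_def mult_ac del: jost_P.simps)
  show "traction_a lam mu \<xi> (jost_P \<omega> H lam mu (- 1) (\<xi>, qP, qS)) = \<i> * (exp (\<i> * qP * of_real H) * sol \<xi> (data_P \<xi> (- \<i> * qP)) 4 0)"
    "traction_b mu \<xi> (jost_P \<omega> H lam mu (- 1) (\<xi>, qP, qS)) = exp (\<i> * qP * of_real H) * sol \<xi> (data_P \<xi> (- \<i> * qP)) 3 0"
    using jost_tractions[OF conjunct1[OF J] init v] by (simp_all add: l_def del: jost_P.simps)
qed

lemma jost_S_tractions:
  assumes q: "qS\<^sup>2 = of_real (\<omega>\<^sup>2 / mu0) - \<xi>\<^sup>2"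
  shows "traction_a lam mu \<xi> (jost_S \<omega> H lam mu (- 1) (\<xi>, qP, qS)) = \<i> * (exp (\<i> * qS * of_real H) * sol \<xi> (data_S \<xi> (- \<i> * qS)) 4 0)"
    "traction_b mu \<xi> (jost_S \<omega> H lam mu (- 1) (\<xi>, qP, qS)) = exp (\<i> * qS * of_real H) * sol \<xi> (data_S \<xi> (- \<i> * qS)) 3 0"
proof -
  define l where "l = - \<i> * qS"
  have l: "l\<^sup>2 = \<xi>\<^sup>2 - of_real (\<omega>\<^sup>2 / mu0)" using q by (simp add: l_def power_mult_distrib)
  have ex: "\<exists>\<psi>. rayleigh_solution \<omega> lam mu \<xi> \<psi> \<and> (\<forall>Z \<le> - H. \<psi> Z = exp (- 1 * \<i> * of_real Z * qS) *s vector [- 1 * \<i> * qS, - \<xi>])"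
    using jost_exists[OF half_space_data_S[OF l]] by (simp add: data_S_def l_def mult_ac)
  have J: "rayleigh_solution \<omega> lam mu \<xi> (jost_S \<omega> H lam mu (- 1) (\<xi>, qP, qS)) \<and>
      (\<forall>Z \<le> - H. jost_S \<omega> H lam mu (- 1) (\<xi>, qP, qS) Z = exp (- 1 * \<i> * of_real Z * qS) *s vector [- 1 * \<i> * qS, - \<xi>])"
    unfolding jost_S.simps using someI_ex[OF ex] by simp
  have v: "data_S \<xi> l 3 = of_real mu0 * (l * data_S \<xi> l 1) - \<xi> * (of_real mu0 * data_S \<xi> l 2)"
    "data_S \<xi> l 4 = of_real (lam0 + 2 * mu0) * (l * data_S \<xi> l 2) + \<xi> * (of_real lam0 * data_S \<xi> l 1)"
  proof -
    have "of_real mu0 * (l * l) = of_real mu0 * \<xi>\<^sup>2 - of_real (\<omega>\<^sup>2)"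
      unfolding power2_eq_square[of l, symmetric] l using mu0_pos
      by (simp add: right_diff_distrib flip: of_real_mult)
    then show "data_S \<xi> l 3 = of_real mu0 * (l * data_S \<xi> l 1) - \<xi> * (of_real mu0 * data_S \<xi> l 2)"
      by (simp add: data_S_def power2_eq_square algebra_simps)
  qed (simp add: data_S_def algebra_simps)
  have init: "jost_S \<omega> H lam mu (- 1) (\<xi>, qP, qS) Z = exp (l * of_real Z) *s vector [data_S \<xi> l 1, data_S \<xi> l 2]" if "Z \<le> - H" for Z
    using J that by (simp add: l_def data_S_def mult_ac del: jost_S.simps)
  show "traction_a lam mu \<xi> (jost_S \<omega> H lam mu (- 1) (\<xi>, qP, qS)) = \<i> * (exp (\<i> * qS * of_real H) * sol \<xi> (data_S \<xi> (- \<i> * qS)) 4 0)"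
    "traction_b mu \<xi> (jost_S \<omega> H lam mu (- 1) (\<xi>, qP, qS)) = exp (\<i> * qS * of_real H) * sol \<xi> (data_S \<xi> (- \<i> * qS)) 3 0"
    using jost_tractions[OF conjunct1[OF J] init v] by (simp_all add: l_def del: jost_S.simps)
qed

lemma rayleigh_det_tdet:
  assumes "(\<xi>, qP, qS) \<in> rayleigh_surface \<omega> lam0 mu0"
  shows "rayleigh_det \<omega> H lam mu (\<xi>, qP, qS)
     = - \<i> * exp (\<i> * (qP + qS) * of_real H) * tdet \<xi> (data_P \<xi> (- \<i> * qP)) (data_S \<xi> (- \<i> * qS))"
proof -
  have q: "qP\<^sup>2 = of_real (\<omega>\<^sup>2 / (lam0 + 2 * mu0)) - \<xi>\<^sup>2" "qS\<^sup>2 = of_real (\<omega>\<^sup>2 / mu0) - \<xi>\<^sup>2"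
    using assms by (auto simp: rayleigh_surface_def)
  have e: "exp (\<i> * (qP + qS) * of_real H) = exp (\<i> * qP * of_real H) * exp (\<i> * qS * of_real H)"
    by (simp add: exp_add[symmetric] algebra_simps)
  show ?thesis
    unfolding rayleigh_det_def boundary_matrix_def Let_def det_2 tdet_def e
    by (simp add: jost_P_tractions[OF q(1)] jost_S_tractions[OF q(2)] del: jost_P.simps jost_S.simps)
      (simp add: algebra_simps)
qed

text \<open>Over the four sheets the phases multiply to (- i)^4 = 1 and the exponents, which run
  through all sign combinations, add up to 0. So no exponential factor survives.\<close>

lemma rayleigh_F_tdet:
  assumes lP: "lP\<^sup>2 = \<xi>\<^sup>2 - of_real (\<omega>\<^sup>2 / (lam0 + 2 * mu0))" and lS: "lS\<^sup>2 = \<xi>\<^sup>2 - of_real (\<omega>\<^sup>2 / mu0)"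
  shows "rayleigh_F \<omega> H lam mu lam0 mu0 \<xi> =
    tdet \<xi> (data_P \<xi> lP) (data_S \<xi> lS) * tdet \<xi> (data_P \<xi> lP) (data_S \<xi> (- lS)) *
    (tdet \<xi> (data_P \<xi> (- lP)) (data_S \<xi> lS) * tdet \<xi> (data_P \<xi> (- lP)) (data_S \<xi> (- lS)))"
proof -
  define qP qS where "qP = \<i> * lP" and "qS = \<i> * lS"
  have p: "(\<xi>, s * qP, t * qS) \<in> rayleigh_surface \<omega> lam0 mu0" if "s\<^sup>2 = 1" "t\<^sup>2 = 1" for s t
    using lP lS that by (simp add: rayleigh_surface_def qP_def qS_def power_mult_distrib)
  have l: "- \<i> * qP = lP" "- \<i> * qS = lS" "- \<i> * - qP = - lP" "- \<i> * - qS = - lS"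
    by (simp_all add: qP_def qS_def)
  have D: "rayleigh_det \<omega> H lam mu (\<xi>, qP, qS) = - \<i> * exp (\<i> * (qP + qS) * of_real H) * tdet \<xi> (data_P \<xi> lP) (data_S \<xi> lS)"
    "rayleigh_det \<omega> H lam mu (\<xi>, qP, - qS) = - \<i> * exp (\<i> * (qP + - qS) * of_real H) * tdet \<xi> (data_P \<xi> lP) (data_S \<xi> (- lS))"
    "rayleigh_det \<omega> H lam mu (\<xi>, - qP, qS) = - \<i> * exp (\<i> * (- qP + qS) * of_real H) * tdet \<xi> (data_P \<xi> (- lP)) (data_S \<xi> lS)"
    "rayleigh_det \<omega> H lam mu (\<xi>, - qP, - qS) = - \<i> * exp (\<i> * (- qP + - qS) * of_real H) * tdet \<xi> (data_P \<xi> (- lP)) (data_S \<xi> (- lS))"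
    using rayleigh_det_tdet[OF p[of 1 1]] rayleigh_det_tdet[OF p[of 1 "-1"]] rayleigh_det_tdet[OF p[of "-1" 1]] rayleigh_det_tdet[OF p[of "-1" "-1"]]
    unfolding l[symmetric] by simp_all
  have E: "exp (\<i> * (qP + qS) * of_real H) * exp (\<i> * (qP + - qS) * of_real H)
      * (exp (\<i> * (- qP + qS) * of_real H) * exp (\<i> * (- qP + - qS) * of_real H)) = 1"
    unfolding exp_add[symmetric] by (simp add: algebra_simps)
  have "rayleigh_F \<omega> H lam mu lam0 mu0 \<xi> =
      rayleigh_det \<omega> H lam mu (\<xi>, qP, qS) * rayleigh_det \<omega> H lam mu (\<xi>, qP, - qS) *
      rayleigh_det \<omega> H lam mu (\<xi>, - qP, qS) * rayleigh_det \<omega> H lam mu (\<xi>, - qP, - qS)"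
    using rayleigh_F_eq[OF p[of 1 1], of H lam mu] by simp
  also have "\<dots> = (exp (\<i> * (qP + qS) * of_real H) * exp (\<i> * (qP + - qS) * of_real H)
      * (exp (\<i> * (- qP + qS) * of_real H) * exp (\<i> * (- qP + - qS) * of_real H))) *
     (tdet \<xi> (data_P \<xi> lP) (data_S \<xi> lS) * tdet \<xi> (data_P \<xi> lP) (data_S \<xi> (- lS)) *
    (tdet \<xi> (data_P \<xi> (- lP)) (data_S \<xi> lS) * tdet \<xi> (data_P \<xi> (- lP)) (data_S \<xi> (- lS))))"
    unfolding D using i_squared by algebra
  finally show ?thesis unfolding E by simp
qed

lemma rayleigh_F_entire: "rayleigh_F \<omega> H lam mu lam0 mu0 holomorphic_on UNIV"
proof -
  define f where "f k i \<xi> = fund k i 0 \<xi>" for k i \<xi>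
  have f: "f k i holomorphic_on UNIV" for k i using fund(3)[of 0 k i] H_pos by (simp add: f_def[abs_def])
  define D where "D \<xi> = 2 * of_real mu0 * \<xi>\<^sup>2 - complex_of_real (\<omega>\<^sup>2)" for \<xi>
  \<comment> \<open>The Jost data are affine in the exponent l, hence so are the surface values.
    This separates the roots from coefficients that are entire in \<xi>.\<close>
  define p0 p1 s0 s1 where "p0 i \<xi> = - \<xi> * f 1 i \<xi> + D \<xi> * f 4 i \<xi>" and "p1 i \<xi> = f 2 i \<xi> - 2 * of_real mu0 * \<xi> * f 3 i \<xi>"
    and "s0 i \<xi> = - \<xi> * f 2 i \<xi> + D \<xi> * f 3 i \<xi>" and "s1 i \<xi> = f 1 i \<xi> - 2 * of_real mu0 * \<xi> * f 4 i \<xi>" for i \<xi>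
  have P: "sol \<xi> (data_P \<xi> l) i 0 = p0 i \<xi> + l * p1 i \<xi>" for \<xi> l i
    by (simp add: sol_def sum_4 data_P_def p0_def p1_def f_def D_def algebra_simps)
  have S: "sol \<xi> (data_S \<xi> l) i 0 = s0 i \<xi> + l * s1 i \<xi>" for \<xi> l i
    by (simp add: sol_def sum_4 data_S_def s0_def s1_def f_def D_def algebra_simps)
  define c0 c1 c2 c3 where "c0 \<xi> = p0 3 \<xi> * s0 4 \<xi> - s0 3 \<xi> * p0 4 \<xi>" and "c1 \<xi> = p1 3 \<xi> * s0 4 \<xi> - s0 3 \<xi> * p1 4 \<xi>"
    and "c2 \<xi> = p0 3 \<xi> * s1 4 \<xi> - s1 3 \<xi> * p0 4 \<xi>" and "c3 \<xi> = p1 3 \<xi> * s1 4 \<xi> - s1 3 \<xi> * p1 4 \<xi>" for \<xi>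
  have T: "tdet \<xi> (data_P \<xi> l) (data_S \<xi> l') = c0 \<xi> + l * c1 \<xi> + l' * c2 \<xi> + l * l' * c3 \<xi>" for \<xi> l l'
    unfolding tdet_def P S c0_def c1_def c2_def c3_def by (simp add: algebra_simps)
  define a b where "a \<xi> = \<xi>\<^sup>2 - of_real (\<omega>\<^sup>2 / (lam0 + 2 * mu0))" and "b \<xi> = \<xi>\<^sup>2 - of_real (\<omega>\<^sup>2 / mu0)" for \<xi> :: complex
  \<comment> \<open>The product over the four sheets is even in both square roots, hence a polynomial in their squares.\<close>
  define F where "F \<xi> = ((c0 \<xi>)\<^sup>2 + a \<xi> * (c1 \<xi>)\<^sup>2 - b \<xi> * ((c2 \<xi>)\<^sup>2 + a \<xi> * (c3 \<xi>)\<^sup>2))\<^sup>2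
      - a \<xi> * (2 * c0 \<xi> * c1 \<xi> - 2 * b \<xi> * c2 \<xi> * c3 \<xi>)\<^sup>2" for \<xi>
  have "rayleigh_F \<omega> H lam mu lam0 mu0 \<xi> = F \<xi>" for \<xi>
  proof -
    define lP lS where "lP = csqrt (a \<xi>)" and "lS = csqrt (b \<xi>)"
    have l: "lP\<^sup>2 = a \<xi>" "lS\<^sup>2 = b \<xi>" by (simp_all add: lP_def lS_def)
    show ?thesis
      unfolding rayleigh_F_tdet[OF l(1)[unfolded a_def] l(2)[unfolded b_def]] T F_def l[symmetric] by (rule four_sheet_product)
  qed
  then have F: "rayleigh_F \<omega> H lam mu lam0 mu0 = F" by (rule ext)
  have D: "D holomorphic_on UNIV" unfolding D_def[abs_def] by (intro holomorphic_intros)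
  have ps: "p0 i holomorphic_on UNIV" "p1 i holomorphic_on UNIV" "s0 i holomorphic_on UNIV" "s1 i holomorphic_on UNIV" for i
    unfolding p0_def[abs_def] p1_def[abs_def] s0_def[abs_def] s1_def[abs_def] by (intro holomorphic_intros f D)+
  have c: "c0 holomorphic_on UNIV" "c1 holomorphic_on UNIV" "c2 holomorphic_on UNIV" "c3 holomorphic_on UNIV"
    unfolding c0_def[abs_def] c1_def[abs_def] c2_def[abs_def] c3_def[abs_def] by (intro holomorphic_intros ps)+
  have ab: "a holomorphic_on UNIV" "b holomorphic_on UNIV"
    unfolding a_def[abs_def] b_def[abs_def] by (intro holomorphic_intros)+
  show ?thesis unfolding F F_def[abs_def] by (intro holomorphic_intros c ab)
qed

end

section \<open>The zero-free region and its consequences\<close>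

context slab_graph
begin

text \<open>Two of the four sign combinations of (\<xi> rP, \<xi> rS) are covered by the preceding
  lemmas at \<xi>. The other two are the same lemmas at - \<xi>, by \<open>tdet_uminus\<close>,
  since the region depends only on |\<xi>| and |Re \<xi>|.\<close>

lemma rayleigh_F_nonzero_of_graph:
  assumes C: "C > 0"
  shows "\<exists>Rr\<ge>1. \<forall>\<xi>. norm \<xi> \<ge> Rr \<longrightarrow> exp (H * \<bar>Re \<xi>\<bar>) \<le> C * (norm \<xi>)\<^sup>2 \<longrightarrow> rayleigh_F \<omega> H lam mu lam0 mu0 \<xi> \<noteq> 0"
proof -
  obtain R1 where R1: "R1 \<ge> 1" "\<And>\<xi>. norm \<xi> \<ge> R1 \<Longrightarrow> exp (H * \<bar>Re \<xi>\<bar>) \<le> C * (norm \<xi>)\<^sup>2 \<Longrightarrow>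
    tdet \<xi> (data_P \<xi> (\<xi> * jost_root (- 1) (1/\<xi>))) (data_S \<xi> (\<xi> * jost_root 1 (1/\<xi>))) \<noteq> 0"
    by (rule same_sheet_nonzero[OF C]) (rule that)
  obtain R2 where R2: "R2 \<ge> 1" "\<And>\<xi>. norm \<xi> \<ge> R2 \<Longrightarrow> exp (H * \<bar>Re \<xi>\<bar>) \<le> C * (norm \<xi>)\<^sup>2 \<Longrightarrow>
    tdet \<xi> (data_P \<xi> (\<xi> * jost_root (- 1) (1/\<xi>))) (data_S \<xi> (- (\<xi> * jost_root 1 (1/\<xi>)))) \<noteq> 0"
    by (rule opposite_sheet_nonzero[OF C]) (rule that)
  show ?thesis
  proof (rule exI[of _ "max R1 R2"], intro conjI allI impI)
    show "1 \<le> max R1 R2" using R1(1) by simp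
    fix \<xi> assume \<xi>: "max R1 R2 \<le> norm \<xi>" and G: "exp (H * \<bar>Re \<xi>\<bar>) \<le> C * (norm \<xi>)\<^sup>2"
    have \<xi>0: "\<xi> \<noteq> 0" using \<xi> R1(1) by auto
    define rP rS where "rP = jost_root (- 1) (1/\<xi>)" and "rS = jost_root 1 (1/\<xi>)"
    have m: "jost_root t (1 / - \<xi>) = jost_root t (1 / \<xi>)" for t using jost_root_uminus[of t "1 / \<xi>"] by simp
    have n: "R1 \<le> norm \<xi>" "R2 \<le> norm \<xi>" "R1 \<le> norm (- \<xi>)" "R2 \<le> norm (- \<xi>)" "exp (H * \<bar>Re (- \<xi>)\<bar>) \<le> C * (norm (- \<xi>))\<^sup>2"
      using \<xi> G by simp_all
    have "tdet \<xi> (data_P \<xi> (\<xi> * rP)) (data_S \<xi> (\<xi> * rS)) \<noteq> 0" "tdet \<xi> (data_P \<xi> (\<xi> * rP)) (data_S \<xi> (- (\<xi> * rS))) \<noteq> 0"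
      using R1(2)[OF n(1) G] R2(2)[OF n(2) G] by (simp_all add: rP_def rS_def)
    moreover have "tdet \<xi> (data_P \<xi> (- (\<xi> * rP))) (data_S \<xi> (- (\<xi> * rS))) \<noteq> 0" "tdet \<xi> (data_P \<xi> (- (\<xi> * rP))) (data_S \<xi> (\<xi> * rS)) \<noteq> 0"
      using R1(2)[OF n(3,5)] R2(2)[OF n(4,5)] unfolding tdet_uminus m by (simp_all add: rP_def rS_def)
    moreover have "(\<xi> * rP)\<^sup>2 = \<xi>\<^sup>2 - of_real (\<omega>\<^sup>2 / (lam0 + 2 * mu0))" "(\<xi> * rS)\<^sup>2 = \<xi>\<^sup>2 - of_real (\<omega>\<^sup>2 / mu0)"
      using \<xi>0 by (simp_all add: rP_def rS_def jost_root_def power_mult_distrib power_divide right_diff_distrib)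
    ultimately show "rayleigh_F \<omega> H lam mu lam0 mu0 \<xi> \<noteq> 0"
      by (subst rayleigh_F_tdet) simp_all
  qed
qed

end

context slab
begin

lemma rayleigh_F_nonzero:
  assumes "C > 0"
  obtains Rr where "Rr \<ge> 1"
    "\<And>\<xi>. norm \<xi> \<ge> Rr \<Longrightarrow> exp (H * \<bar>Re \<xi>\<bar>) \<le> C * (norm \<xi>)\<^sup>2 \<Longrightarrow> rayleigh_F \<omega> H lam mu lam0 mu0 \<xi> \<noteq> 0"
proof -
  have "\<exists>S S' R T. approx_invariant_graph (- H) 0 blockA blockB blockC blockD S S' R T 4 13"
    by (rule approx_invariant_graph_exists) (simp_all add: flat_blocks del: flat_symbol.simps)
  then obtain S S' R T where "approx_invariant_graph (- H) 0 blockA blockB blockC blockD S S' R T 4 13" by blast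
  then interpret slab_graph \<omega> H lam mu lam0 mu0 S S' R T by unfold_locales
  from rayleigh_F_nonzero_of_graph[OF assms] show thesis using that by blast
qed

lemma resonance_bound:
  obtains C1 where "C1 > 0" "\<And>\<xi>. rayleigh_F \<omega> H lam mu lam0 mu0 \<xi> = 0 \<Longrightarrow> Re \<xi> < 0 \<Longrightarrow> norm \<xi> ^ 14 \<le> C1 * exp (- 8 * H * Re \<xi>)"
proof -
  obtain Rr where Rr: "Rr \<ge> 1"
    "\<And>\<xi>. norm \<xi> \<ge> Rr \<Longrightarrow> exp (H * \<bar>Re \<xi>\<bar>) \<le> 1 * (norm \<xi>)\<^sup>2 \<Longrightarrow> rayleigh_F \<omega> H lam mu lam0 mu0 \<xi> \<noteq> 0"
    by (rule rayleigh_F_nonzero[OF zero_less_one]) (rule that)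
  \<comment> \<open>The constant takes care of the zeros with |\<xi>| < Rr, as the exponential is at
    least 1. The larger ones lie outside the region for C = 1, and the eighth power of |\<xi>|^2
    \<le> G settles them.\<close>
  show thesis
  proof (rule that[of "Rr ^ 14"])
    show "Rr ^ 14 > 0" using Rr(1) by simp
    fix \<xi> assume F: "rayleigh_F \<omega> H lam mu lam0 mu0 \<xi> = 0" and Re: "Re \<xi> < 0"
    have E: "exp (- 8 * H * Re \<xi>) = exp (H * \<bar>Re \<xi>\<bar>) ^ 8" using Re by (simp flip: exp_of_nat_mult)
    have E1: "exp (H * \<bar>Re \<xi>\<bar>) \<ge> 1" using H_pos by simp
    show "norm \<xi> ^ 14 \<le> Rr ^ 14 * exp (- 8 * H * Re \<xi>)"
    proof (cases "norm \<xi> \<ge> Rr")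
      case True
      then have "(norm \<xi>)\<^sup>2 \<le> exp (H * \<bar>Re \<xi>\<bar>)" using Rr(2)[OF True] F by (intro leI notI) simp
      then have "((norm \<xi>)\<^sup>2) ^ 8 \<le> exp (H * \<bar>Re \<xi>\<bar>) ^ 8" by (rule power_mono) simp
      also have "\<dots> \<le> Rr ^ 14 * exp (H * \<bar>Re \<xi>\<bar>) ^ 8"
        using mult_right_mono[OF one_le_power[OF Rr(1), of 14], of "exp (H * \<bar>Re \<xi>\<bar>) ^ 8"] by simp
      finally have "norm \<xi> ^ 16 \<le> Rr ^ 14 * exp (H * \<bar>Re \<xi>\<bar>) ^ 8" unfolding power_mult[symmetric] by simp
      moreover have "norm \<xi> ^ 14 \<le> norm \<xi> ^ 16" using True Rr(1) by (intro power_increasing) auto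
      ultimately show ?thesis unfolding E by linarith
    next
      case False
      then have "norm \<xi> ^ 14 * 1 \<le> Rr ^ 14 * exp (H * \<bar>Re \<xi>\<bar>) ^ 8"
        using E1 Rr(1) by (intro mult_mono power_mono one_le_power) auto
      then show ?thesis unfolding E by simp
    qed
  qed
qed

text \<open>Reading log 0 as minus infinity, the region contains no real point;
  \<open>Im \<xi> \<noteq> 0\<close> expresses this, because the value of \<open>ln\<close> at 0 is
  a mere convention.\<close>

lemma finite_resonances_near_axis:
  assumes A: "A > 0"
  shows "finite {\<xi>. rayleigh_F \<omega> H lam mu lam0 mu0 \<xi> = 0 \<and> Im \<xi> \<noteq> 0 \<and> 0 > Re \<xi> \<and> Re \<xi> \<ge> - A - 7 / (4 * H) * ln \<bar>Im \<xi>\<bar>}"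
    (is "finite ?Z")
proof -
  let ?F = "rayleigh_F \<omega> H lam mu lam0 mu0"
  \<comment> \<open>The shift A of the region becomes the factor exp (H A) in front of
    |\<xi>|^2.\<close>
  obtain Rr where Rr: "Rr \<ge> 1"
    "\<And>\<xi>. norm \<xi> \<ge> Rr \<Longrightarrow> exp (H * \<bar>Re \<xi>\<bar>) \<le> exp (H * A) * (norm \<xi>)\<^sup>2 \<Longrightarrow> ?F \<xi> \<noteq> 0"
    by (rule rayleigh_F_nonzero[of "exp (H * A)"]) (simp, rule that)
  have sub: "?Z \<subseteq> {\<xi> \<in> cball 0 Rr. ?F \<xi> = 0}"
  proof
    fix \<xi> assume "\<xi> \<in> ?Z"
    then have F: "?F \<xi> = 0" and Im: "Im \<xi> \<noteq> 0" and Re: "Re \<xi> < 0" "- A - 7 / (4 * H) * ln \<bar>Im \<xi>\<bar> \<le> Re \<xi>" by auto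
    have "norm \<xi> \<le> Rr"
    proof (rule ccontr)
      assume "\<not> norm \<xi> \<le> Rr"
      then have n: "norm \<xi> \<ge> Rr" "norm \<xi> \<ge> 1" using Rr(1) by auto
      \<comment> \<open>ln |Im \<xi>| may be negative, so the step from 7/4 to 2 is made on ln
        |\<xi>|, which is nonnegative.\<close>
      have "ln \<bar>Im \<xi>\<bar> \<le> ln (norm \<xi>)" using Im abs_Im_le_cmod[of \<xi>] by (intro ln_mono) auto
      moreover have "0 \<le> ln (norm \<xi>)" using n by simp
      ultimately have l: "7 / 4 * ln \<bar>Im \<xi>\<bar> \<le> 2 * ln (norm \<xi>)" by linarith
      have "H * \<bar>Re \<xi>\<bar> \<le> H * (A + 7 / (4 * H) * ln \<bar>Im \<xi>\<bar>)" using Re H_pos by (intro mult_left_mono) auto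
      also have "\<dots> = H * A + 7 / 4 * ln \<bar>Im \<xi>\<bar>" using H_pos by (simp add: distrib_left)
      also have "\<dots> \<le> H * A + 2 * ln (norm \<xi>)" using l by simp
      finally have "exp (H * \<bar>Re \<xi>\<bar>) \<le> exp (H * A + 2 * ln (norm \<xi>))" by simp
      also have "\<dots> = exp (H * A) * (norm \<xi>)\<^sup>2"
      proof -
        have "norm \<xi> > 0" using n by linarith
        then show ?thesis by (simp only: exp_add exp_double exp_ln)
      qed
      finally show False using Rr(2)[OF n(1)] F by blast
    qed
    with F show "\<xi> \<in> {\<xi> \<in> cball 0 Rr. ?F \<xi> = 0}" by simp
  qed
  \<comment> \<open>The point i Rr lies in the zero-free region, so F does not vanish identically
    and its zeros in a compact disc are finite in number.\<close>
  have nz: "?F (\<i> * of_real Rr) \<noteq> 0"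
  proof (rule Rr(2))
    have "1 * 1 \<le> exp (H * A) * Rr\<^sup>2" using A H_pos Rr(1) by (intro mult_mono one_le_power) auto
    then show "exp (H * \<bar>Re (\<i> * complex_of_real Rr)\<bar>) \<le> exp (H * A) * (norm (\<i> * complex_of_real Rr))\<^sup>2"
      using Rr(1) by (simp add: norm_mult)
  qed (use Rr(1) in \<open>simp add: norm_mult\<close>)
  have "finite {\<xi> \<in> cball 0 Rr. ?F \<xi> = 0}"
  proof (cases "?F constant_on UNIV")
    case True
    then have F: "?F \<xi> = ?F (\<i> * of_real Rr)" for \<xi> by (auto simp: constant_on_def)
    have "?F \<xi> \<noteq> 0" for \<xi> unfolding F[of \<xi>] by (rule nz)
    then have "{\<xi> \<in> cball 0 Rr. ?F \<xi> = 0} = {}" by blast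
    then show ?thesis by (simp only: finite.emptyI)
  next
    case False
    show ?thesis
      by (rule holomorphic_compact_finite_zeros[OF rayleigh_F_entire open_UNIV connected_UNIV compact_cball subset_UNIV False])
  qed
  then show ?thesis by (rule finite_subset[OF sub])
qed

end

theorem mainTheorem3:
  shows "\<exists>N0 :: nat. \<forall>N\<ge>N0. \<forall>(\<omega> :: real) (H :: real) lam mu (lam0 :: real) (mu0 :: real).
    slab_medium \<omega> H lam mu lam0 mu0 \<longrightarrow> Ck_on N {..0} lam \<longrightarrow> Ck_on N {..0} mu \<longrightarrow>
    (\<exists>(c2 :: real) (c4 :: real) (c6 :: real) (c8 :: real) (c10 :: real) (c12 :: real) (C1 :: real).
        C1 > 0 \<and>
        (\<forall>\<xi> \<in> wavenumber_resonances \<omega> H lam mu lam0 mu0. Re \<xi> < 0 \<longrightarrow>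
           cmod (\<xi>\<^sup>2 * (\<xi> ^ 12 - of_real c2 * \<xi> ^ 10 + of_real c4 * \<xi> ^ 8 - of_real c6 * \<xi> ^ 6
                        + of_real c8 * \<xi> ^ 4 - of_real c10 * \<xi>\<^sup>2 + of_real c12))
             \<le> C1 * exp (- 8 * H * Re \<xi>))) \<and>
    (\<forall>A>0. finite {\<xi> \<in> wavenumber_resonances \<omega> H lam mu lam0 mu0.
        Im \<xi> \<noteq> 0 \<and> 0 > Re \<xi> \<and> Re \<xi> \<ge> - A - 7 / (4 * H) * ln \<bar>Im \<xi>\<bar>})"
proof (rule exI[of _ 20], intro allI impI)
  fix N :: nat and \<omega> H lam mu lam0 mu0
  assume N: "20 \<le> N" and medium: "slab_medium \<omega> H lam mu lam0 mu0" and C: "Ck_on N {..0} lam" "Ck_on N {..0} mu"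
  interpret slab \<omega> H lam mu lam0 mu0
    using medium Ck_on_mono[OF C(1) N] Ck_on_mono[OF C(2) N] by unfold_locales
  obtain C1 where C1: "C1 > 0"
    "\<And>\<xi>. rayleigh_F \<omega> H lam mu lam0 mu0 \<xi> = 0 \<Longrightarrow> Re \<xi> < 0 \<Longrightarrow> norm \<xi> ^ 14 \<le> C1 * exp (- 8 * H * Re \<xi>)"
    by (rule resonance_bound) (rule that)
  show "(\<exists>(c2 :: real) (c4 :: real) (c6 :: real) (c8 :: real) (c10 :: real) (c12 :: real) (C1 :: real).
        C1 > 0 \<and>
        (\<forall>\<xi> \<in> wavenumber_resonances \<omega> H lam mu lam0 mu0. Re \<xi> < 0 \<longrightarrow>
           cmod (\<xi>\<^sup>2 * (\<xi> ^ 12 - of_real c2 * \<xi> ^ 10 + of_real c4 * \<xi> ^ 8 - of_real c6 * \<xi> ^ 6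
                        + of_real c8 * \<xi> ^ 4 - of_real c10 * \<xi>\<^sup>2 + of_real c12))
             \<le> C1 * exp (- 8 * H * Re \<xi>))) \<and>
    (\<forall>A>0. finite {\<xi> \<in> wavenumber_resonances \<omega> H lam mu lam0 mu0.
        Im \<xi> \<noteq> 0 \<and> 0 > Re \<xi> \<and> Re \<xi> \<ge> - A - 7 / (4 * H) * ln \<bar>Im \<xi>\<bar>})"
  proof (intro conjI allI impI)
    \<comment> \<open>The lower-order terms are negligible against \<open>\<xi>\<^sup>1\<^sup>4\<close>, so all six coefficients can be taken to be 0.\<close>
    have "cmod (\<xi>\<^sup>2 * (\<xi> ^ 12 - of_real 0 * \<xi> ^ 10 + of_real 0 * \<xi> ^ 8 - of_real 0 * \<xi> ^ 6
                        + of_real 0 * \<xi> ^ 4 - of_real 0 * \<xi>\<^sup>2 + of_real 0))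
             \<le> C1 * exp (- 8 * H * Re \<xi>)"
      if "\<xi> \<in> wavenumber_resonances \<omega> H lam mu lam0 mu0" "Re \<xi> < 0" for \<xi>
      using C1(2)[of \<xi>] that by (simp add: wavenumber_resonances_def norm_mult norm_power flip: power_add)
    with C1(1) show "\<exists>(c2 :: real) (c4 :: real) (c6 :: real) (c8 :: real) (c10 :: real) (c12 :: real) (C1 :: real).
        C1 > 0 \<and>
        (\<forall>\<xi> \<in> wavenumber_resonances \<omega> H lam mu lam0 mu0. Re \<xi> < 0 \<longrightarrow>
           cmod (\<xi>\<^sup>2 * (\<xi> ^ 12 - of_real c2 * \<xi> ^ 10 + of_real c4 * \<xi> ^ 8 - of_real c6 * \<xi> ^ 6
                        + of_real c8 * \<xi> ^ 4 - of_real c10 * \<xi>\<^sup>2 + of_real c12))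
             \<le> C1 * exp (- 8 * H * Re \<xi>))"
      by blast
    show "finite {\<xi> \<in> wavenumber_resonances \<omega> H lam mu lam0 mu0.
        Im \<xi> \<noteq> 0 \<and> 0 > Re \<xi> \<and> Re \<xi> \<ge> - A - 7 / (4 * H) * ln \<bar>Im \<xi>\<bar>}" if "A > 0" for A
      using finite_resonances_near_axis[OF that] by (simp add: wavenumber_resonances_def)
  qed
qed

end
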